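(* Let $\mathbf V$ be a variety of algebras, let $A\in\mathbf V$, and let $Z=\mathbb{Z}[A,\mathbf V]$ be the enveloping ringoid of $A$ with respect to $\mathbf V$. Then the functors $\mathcal G:\mathrm{Ab}[A,\mathbf V]\to Z\text{-}\mathrm{Mod}$ and $\mathcal H:Z\text{-}\mathrm{Mod}\to\mathrm{Ab}[A,\mathbf V]$ are inverses, i.e. $\mathcal H\mathcal G=1_{\mathrm{Ab}[A,\mathbf V]}$ and $\mathcal G\mathcal H=1_{Z\text{-}\mathrm{Mod}}$.
   Context: A type $\Omega$ is a family of sets $\Omega_n$ ($n\in\mathbb{N}$, $0\in\mathbb N$) of $n$-ary operation symbols; algebras may be empty. Let $A$ be an algebra of type $\Omega$. Modules and pointed overalgebras. An $A$-module $M$ is an $|A|$-tuple of abelian groups $({}_aM)_{a\in A}$ with, for each $n$-ary $\omega$ and $\mathbf{a}\in A^n$, a group homomorphism $\omega^M_{\mathbf a}:{}_{\mathbf a}M\to{}_{\omega(\mathbf a)}M$, where ${}_{\mathbf a}M={}_{a_1}M\times\cdots\times{}_{a_n}M$. Write $\omega^M_{\mathbf a,i}(m)=\omega^M_{\mathbf a}({}_{a_1}0,\ldots,{}_{a_{i-1}}0,m,{}_{a_{i+1}}0,\ldots,{}_{a_n}0)$ for $m\in{}_{a_i}M$; the maps $\omega^M_{\mathbf a,i}$ determine $\omega^M_{\mathbf a}(\mathbf m)=\sum_i\omega^M_{\mathbf a,i}(m_i)$. A pointed $A$-overalgebra $P$ is the same as an $A$-module with pointed sets ${}_aP$ (basepoint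 ${}_a*$) and pointed maps instead. A homomorphism is an $A$-tuple of group homomorphisms (resp. pointed maps) ${}_a\phi:{}_aM\to{}_aM'$ with ${}_{\omega(\mathbf a)}\phi(\omega^M_{\mathbf a}(\mathbf m))=\omega^{M'}_{\mathbf a}({}_{a_1}\phi(m_1),\ldots,{}_{a_n}\phi(m_n))$. The forgetful functor $\mathcal{U}$ takes an $A$-module to the pointed $A$-overalgebra with the same maps and basepoints ${}_a0$. The total algebra $A\ltimes M$ is $\{\langle a,m\rangle: m\in{}_aM\}$ with $\omega(\langle a_1,m_1\rangle,\ldots)=\langle\omega(\mathbf a),\omega^M_{\mathbf a}(\mathbf m)\rangle$; $M$ is totally in $\mathbf V$ if $A\ltimes M\in\mathbf V$. $\mathrm{Ab}[A,\mathbf V]$ and $\mathrm{Pnt}[A,\mathbf V]$ denote the categories of $A$-modules and pointed $A$-overalgebras totally in $\mathbf V$. Modulization. Given a pointed $A$-overalgebra $P$, let $\hat{\mathcal M}P$ be the $A$-module with ${}_a(\hat{\mathcal M}P)$ the free abelian group on the set ${}_aP$ and $\omega^{\hat{\mathcal M}P}_{\mathbf a}(\mathbf m)=\sum_{i}\omega^{\hat{\mathcal M}P}_{\mathbf a,i}(m_i)$, where $\omega^{\hat{\mathcal M}P}_{\mathbf a,i}$ is the group homomorphism with $\omega^{\hat{\mathcal M}P}_{\mathbf a,i}(p)=\omega^P_{\mathbf a}({}_{a_1}*,\ldots,{}_{a_{i-1}}*,p,{}_{a_{i+1}}*,\ldots,{}_{a_n}* )$ for $p\in{}_{a_i}P$.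 Let $\mathcal KP$ be the smallest submodule (family of subgroups closed under all $\omega_{\mathbf a}$) containing every ${}_a*$ and every $\omega^P_{\mathbf a}(\mathbf p)-\sum_i\omega^{\hat{\mathcal M}P}_{\mathbf a,i}(p_i)$. Then $\mathcal MP=\hat{\mathcal M}P/\mathcal KP$, and ${}_a(\eta P):{}_aP\to{}_a(\mathcal MP)$ sends $p$ to its class; $\langle\mathcal MP,\eta P\rangle$ is a universal arrow from $P$ to $\mathcal U$, and $\mathcal MP$ is totally in $\mathbf V$ if $P$ is. Unary polynomials. $U=\mathrm{Pol}_1(A,\mathbf V)$ is the coproduct in $\mathbf V$ of $A$ and the free algebra $\mathcal F_{\mathbf V}\{x\}$, with insertion $\iota_A:A\to U$; one writes $a$ for $\iota_A(a)$. For $u\in U$, $b\in A$, $u(b)\in A$ is the image of $u$ under the homomorphism $\pi_b:U\to A$ with $a\mapsto a$, $x\mapsto b$. For $b\in A$, $U_b$ is the pointed $A$-overalgebra (totally in $\mathbf V$) with ${}_aU_b=\pi_b^{-1}(a)$, basepoint $\iota_A(a)$, and $\omega^{U_b}_{\mathbf a}(\mathbf u)=\omega^U(\mathbf u)$. Enveloping ringoid. Put ${}_aZ_b={}_a(\mathcal MU_b)$ and $(u)_b={}_{u(b)}(\eta U_b)(u)\in{}_{u(b)}Z_b$. $\mathcal MU_b$ is free in $\mathrm{Ab}[A,\mathbf V]$ on $(x)_b$: for $M\in\mathrm{Ab}[A,\mathbf V]$ and $m\in{}_bM$ there is a unique homomorphism $\theta_{b,m}:\mathcal MU_b\to M$ sending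 $(x)_b$ to $m$. For $z\in{}_aZ_b$, $m\in{}_bM$ put $zm={}_a(\theta_{b,m})(z)\in{}_aM$. For $z\in{}_aZ_b$, $z'\in{}_bZ_c$, $zz'\in{}_aZ_c$ is the result of the action of $z$ on $z'\in{}_b(\mathcal MU_c)$. With this multiplication $Z=\mathbb Z[A,\mathbf V]$ is a ringoid (small category whose hom-sets are abelian groups with bilinear composition) with object set $|A|$, ${}_aZ_b$ being the hom-set from $b$ to $a$, $1_b=(x)_b$ and ${}_a0_b=(a)_b$. A left $Z$-module is an additive functor from $Z$ to abelian groups, i.e. a family of abelian groups ${}_aM$ with a unital, bilinear, associative action ${}_aZ_b\times{}_bM\to{}_aM$; homomorphisms are natural transformations. $Z$-$\mathrm{Mod}$ is the category of left $Z$-modules. The functors. $\mathcal GM$, for $M\in\mathrm{Ab}[A,\mathbf V]$, is the $|A|$-tuple of abelian groups $({}_aM)$ with the action $zm={}_a(\theta_{b,m})(z)$; $\mathcal G\zeta=\zeta$ on homomorphisms. $\mathcal HM$, for a left $Z$-module $M$, is the same tuple of abelian groups with the $A$-module structure determined by $\omega^{\mathcal HM}_{\mathbf a,i}(m)=\left(\omega^U(a_1,\ldots,a_{i-1},x,a_{i+1},\ldots,a_n)\right)_{a_i}m$ for $m\in{}_{a_i}M$; $\mathcal H\phi=\phi$ on homomorphisms. *)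

theory Defs
  imports "HOL-Algebra.Free_Abelian_Groups" "HOL-Algebra.Weak_Morphisms"
begin

section \<open>Algebras and varieties\<close>

text \<open>A type is a family \<open>\<Omega> :: nat \<Rightarrow> 'f set\<close>; the \<open>\<Omega> n\<close> need not be disjoint, since the length of the
  argument list says which arity is meant.  Terms are only meaningful when well-formed
  (\<open>wf_terms\<close>).\<close>

datatype ('f, 'v) trm = Var 'v | App 'f "('f, 'v) trm list"

inductive_set wf_terms :: "(nat \<Rightarrow> 'f set) \<Rightarrow> 'v set \<Rightarrow> ('f, 'v) trm set"
  for \<Omega> :: "nat \<Rightarrow> 'f set" and X :: "'v set" where
  Var: "v \<in> X \<Longrightarrow> Var v \<in> wf_terms \<Omega> X"
| App: "w \<in> \<Omega> (length ts) \<Longrightarrow> (\<And>t. t \<in> set ts \<Longrightarrow> t \<in> wf_terms \<Omega> X) \<Longrightarrow> App w ts \<in> wf_terms \<Omega> X"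

primrec subst :: "('v \<Rightarrow> ('f, 'u) trm) \<Rightarrow> ('f, 'v) trm \<Rightarrow> ('f, 'u) trm" where
  "subst \<sigma> (Var v) = \<sigma> v"
| "subst \<sigma> (App w ts) = App w (map (subst \<sigma>) ts)"

record ('a, 'f) alg = "'a partial_object" +
  opn :: "'f \<Rightarrow> 'a list \<Rightarrow> 'a"

primrec eval :: "('a, 'f) alg \<Rightarrow> ('v \<Rightarrow> 'a) \<Rightarrow> ('f, 'v) trm \<Rightarrow> 'a" where
  "eval A e (Var v) = e v"
| "eval A e (App w ts) = opn A w (map (eval A e) ts)"

text \<open>A variety is given by its type and a set of identities in countably many variables.  The
  empty algebra, if the type has no constants, satisfies all identities.\<close>

record 'f variety =
  symbols :: "nat \<Rightarrow> 'f set"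
  identities :: "(('f, nat) trm \<times> ('f, nat) trm) set"

definition is_variety :: "'f variety \<Rightarrow> bool" where
  "is_variety V \<longleftrightarrow> identities V \<subseteq> wf_terms (symbols V) UNIV \<times> wf_terms (symbols V) UNIV"

definition op_args :: "'f variety \<Rightarrow> ('a, 'f) alg \<Rightarrow> ('f \<times> 'a list) set" where
  "op_args V A = {(w, as). w \<in> symbols V (length as) \<and> as \<in> lists (carrier A)}"

definition is_algebra :: "'f variety \<Rightarrow> ('a, 'f) alg \<Rightarrow> bool" where
  "is_algebra V A \<longleftrightarrow> (\<forall>(w, as) \<in> op_args V A. opn A w as \<in> carrier A)"

definition in_variety :: "'f variety \<Rightarrow> ('a, 'f) alg \<Rightarrow> bool" where
  "in_variety V A \<longleftrightarrow> is_algebra V A \<and>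
     (\<forall>(s, t) \<in> identities V. \<forall>e. range e \<subseteq> carrier A \<longrightarrow> eval A e s = eval A e t)"

definition alg_hom :: "'f variety \<Rightarrow> ('a, 'f) alg \<Rightarrow> ('b, 'f) alg \<Rightarrow> ('a \<Rightarrow> 'b) set" where
  "alg_hom V A B = {h \<in> carrier A \<rightarrow>\<^sub>E carrier B.
     \<forall>(w, as) \<in> op_args V A. h (opn A w as) = opn B w (map h as)}"


section \<open>Free algebras and coproducts in a variety\<close>

inductive_set pres_cong :: "'f variety \<Rightarrow> 'v set \<Rightarrow> (('f, 'v) trm \<times> ('f, 'v) trm) set
    \<Rightarrow> (('f, 'v) trm \<times> ('f, 'v) trm) set"
  for V :: "'f variety" and X :: "'v set" and R :: "(('f, 'v) trm \<times> ('f, 'v) trm) set" where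
  refl: "t \<in> wf_terms (symbols V) X \<Longrightarrow> (t, t) \<in> pres_cong V X R"
| sym: "(s, t) \<in> pres_cong V X R \<Longrightarrow> (t, s) \<in> pres_cong V X R"
| trans: "(s, t) \<in> pres_cong V X R \<Longrightarrow> (t, u) \<in> pres_cong V X R \<Longrightarrow> (s, u) \<in> pres_cong V X R"
| cong: "w \<in> symbols V (length ss) \<Longrightarrow> list_all2 (\<lambda>s t. (s, t) \<in> pres_cong V X R) ss ts
    \<Longrightarrow> (App w ss, App w ts) \<in> pres_cong V X R"
| rel: "(s, t) \<in> R \<Longrightarrow> (s, t) \<in> pres_cong V X R"
| ident: "(s, t) \<in> identities V \<Longrightarrow> range \<sigma> \<subseteq> wf_terms (symbols V) X
    \<Longrightarrow> (subst \<sigma> s, subst \<sigma> t) \<in> pres_cong V X R"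
monos list_all2_mono

definition presented :: "'f variety \<Rightarrow> 'v set \<Rightarrow> (('f, 'v) trm \<times> ('f, 'v) trm) set
    \<Rightarrow> (('f, 'v) trm set, 'f) alg" where
  "presented V X R =
     \<lparr>carrier = wf_terms (symbols V) X // pres_cong V X R,
      opn = (\<lambda>w Cs. \<Union>ts \<in> listset Cs. pres_cong V X R `` {App w ts})\<rparr>"

definition free_alg :: "'f variety \<Rightarrow> 'v set \<Rightarrow> (('f, 'v) trm set, 'f) alg" where
  "free_alg V X = presented V X {}"

definition free_gen :: "'f variety \<Rightarrow> 'v set \<Rightarrow> 'v \<Rightarrow> ('f, 'v) trm set" where
  "free_gen V X v = pres_cong V X {} `` {Var v}"

definition op_rels :: "'f variety \<Rightarrow> ('a, 'f) alg \<Rightarrow> ('a \<Rightarrow> 'v) \<Rightarrow> (('f, 'v) trm \<times> ('f, 'v) trm) set" where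
  "op_rels V A j = {(App w (map (\<lambda>a. Var (j a)) as), Var (j (opn A w as))) | w as. (w, as) \<in> op_args V A}"

definition coprod_rels :: "'f variety \<Rightarrow> ('a, 'f) alg \<Rightarrow> ('b, 'f) alg
    \<Rightarrow> (('f, 'a + 'b) trm \<times> ('f, 'a + 'b) trm) set" where
  "coprod_rels V A B = op_rels V A Inl \<union> op_rels V B Inr"

definition coprod :: "'f variety \<Rightarrow> ('a, 'f) alg \<Rightarrow> ('b, 'f) alg
    \<Rightarrow> (('f, 'a + 'b) trm set, 'f) alg" where
  "coprod V A B = presented V (carrier A <+> carrier B) (coprod_rels V A B)"

definition coprod_inl :: "'f variety \<Rightarrow> ('a, 'f) alg \<Rightarrow> ('b, 'f) alg \<Rightarrow> 'a \<Rightarrow> ('f, 'a + 'b) trm set" where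
  "coprod_inl V A B a = pres_cong V (carrier A <+> carrier B) (coprod_rels V A B) `` {Var (Inl a)}"

definition coprod_inr :: "'f variety \<Rightarrow> ('a, 'f) alg \<Rightarrow> ('b, 'f) alg \<Rightarrow> 'b \<Rightarrow> ('f, 'a + 'b) trm set" where
  "coprod_inr V A B b = pres_cong V (carrier A <+> carrier B) (coprod_rels V A B) `` {Var (Inr b)}"

text \<open>The universal properties: these algebras are the free algebra and the coproduct in the
  variety, with respect to algebras of the variety over an arbitrary type.\<close>

lemma pres_cong_wf:
  assumes "is_variety V" "R \<subseteq> wf_terms (symbols V) X \<times> wf_terms (symbols V) X"
    and "(s, t) \<in> pres_cong V X R"
  shows "s \<in> wf_terms (symbols V) X \<and> t \<in> wf_terms (symbols V) X"
proof -
  have sub: "subst \<sigma> u \<in> wf_terms (symbols V) X"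
    if "u \<in> wf_terms (symbols V) UNIV" "range \<sigma> \<subseteq> wf_terms (symbols V) X" for u and \<sigma> :: "nat \<Rightarrow> _"
    using that by (induction u) (auto intro!: wf_terms.App)
  show ?thesis using assms(3)
  proof (induction rule: pres_cong.induct)
    case (cong w ss ts)
    then have *: "length ss = length ts"
      "\<And>i. i < length ss \<Longrightarrow> ss ! i \<in> wf_terms (symbols V) X \<and> ts ! i \<in> wf_terms (symbols V) X"
      by (auto simp: list_all2_conv_all_nth)
    have "App w ss \<in> wf_terms (symbols V) X"
      using cong.hyps * by (intro wf_terms.App) (auto simp: in_set_conv_nth)
    moreover have "App w ts \<in> wf_terms (symbols V) X"
      using cong.hyps * by (intro wf_terms.App) (auto simp: in_set_conv_nth)
    ultimately show ?case ..
  next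
    case (ident s t \<sigma>)
    then show ?case using sub assms(1) unfolding is_variety_def by blast
  qed (use assms(2) in auto)
qed

lemma pres_cong_equiv:
  assumes "is_variety V" "R \<subseteq> wf_terms (symbols V) X \<times> wf_terms (symbols V) X"
  shows "equiv (wf_terms (symbols V) X) (pres_cong V X R)"
  using pres_cong_wf[OF assms]
  by (intro equivI refl_onI symI transI) (auto intro: pres_cong.refl pres_cong.sym pres_cong.trans)

lemma listset_iff: "xs \<in> listset Cs \<longleftrightarrow> list_all2 (\<in>) xs Cs"
  by (induction Cs arbitrary: xs) (auto simp: set_Cons_def list_all2_Cons2)

lemma presented_opn:
  assumes "is_variety V" "R \<subseteq> wf_terms (symbols V) X \<times> wf_terms (symbols V) X"
    and w: "w \<in> symbols V (length ts)" and ts: "set ts \<subseteq> wf_terms (symbols V) X"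
  shows "opn (presented V X R) w (map (\<lambda>t. pres_cong V X R `` {t}) ts) = pres_cong V X R `` {App w ts}"
proof -
  let ?E = "pres_cong V X R"
  note eq = pres_cong_equiv[OF assms(1,2)]
  have "?E `` {App w ss} = ?E `` {App w ts}" if "ss \<in> listset (map (\<lambda>t. ?E `` {t}) ts)" for ss
  proof -
    have "list_all2 (\<lambda>t s. (t, s) \<in> ?E) ts ss"
      using that by (auto simp: listset_iff list_all2_conv_all_nth)
    then have "(App w ts, App w ss) \<in> ?E" by (rule pres_cong.cong[OF w])
    then show ?thesis using equiv_class_eq[OF eq] by blast
  qed
  moreover have "ts \<in> listset (map (\<lambda>t. ?E `` {t}) ts)"
    unfolding listset_iff list_all2_conv_all_nth
  proof (intro conjI allI impI)
    fix i assume "i < length ts"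
    then have "ts ! i \<in> wf_terms (symbols V) X" using ts nth_mem by blast
    then have "(ts ! i, ts ! i) \<in> ?E" by (rule pres_cong.refl)
    then show "ts ! i \<in> map (\<lambda>t. ?E `` {t}) ts ! i" using \<open>i < length ts\<close> by simp
  qed simp
  ultimately have "(\<Union>ss \<in> listset (map (\<lambda>t. ?E `` {t}) ts). ?E `` {App w ss}) = ?E `` {App w ts}"
    by blast
  then show ?thesis unfolding presented_def by simp
qed

lemma presented_reps:
  assumes "set Cs \<subseteq> carrier (presented V X R)"
  obtains ts where "set ts \<subseteq> wf_terms (symbols V) X" "Cs = map (\<lambda>t. pres_cong V X R `` {t}) ts"
proof -
  have "\<forall>C \<in> set Cs. \<exists>t \<in> wf_terms (symbols V) X. C = pres_cong V X R `` {t}"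
    using assms by (auto simp: presented_def quotient_def)
  then obtain f where "\<forall>C \<in> set Cs. f C \<in> wf_terms (symbols V) X \<and> C = pres_cong V X R `` {f C}"
    by metis
  then have f: "\<And>C. C \<in> set Cs \<Longrightarrow> f C \<in> wf_terms (symbols V) X"
    "\<And>C. C \<in> set Cs \<Longrightarrow> pres_cong V X R `` {f C} = C"
    by auto
  have "set (map f Cs) \<subseteq> wf_terms (symbols V) X" using f(1) by auto
  moreover have "map (\<lambda>t. pres_cong V X R `` {t}) (map f Cs) = Cs"
    unfolding map_map by (rule map_idI) (simp add: f(2))
  ultimately show ?thesis using that by metis
qed

lemma presented_in_variety:
  assumes V: "is_variety V" and R: "R \<subseteq> wf_terms (symbols V) X \<times> wf_terms (symbols V) X"
  shows "in_variety V (presented V X R)"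
proof -
  let ?E = "pres_cong V X R" and ?P = "presented V X R"
  note eq = pres_cong_equiv[OF V R]
  have "is_algebra V ?P"
    unfolding is_algebra_def
  proof clarify
    fix w Cs assume "(w, Cs) \<in> op_args V ?P"
    then have w: "w \<in> symbols V (length Cs)" and Cs: "set Cs \<subseteq> carrier ?P"
      by (auto simp: op_args_def)
    from Cs obtain ts where ts: "set ts \<subseteq> wf_terms (symbols V) X" "Cs = map (\<lambda>t. ?E `` {t}) ts"
      by (rule presented_reps)
    have "App w ts \<in> wf_terms (symbols V) X" using w ts by (intro wf_terms.App) auto
    then show "opn ?P w Cs \<in> carrier ?P"
      using presented_opn[OF V R, of w ts] w ts by (auto simp: presented_def quotientI)
  qed
  moreover have "eval ?P e s = eval ?P e t"
    if st: "(s, t) \<in> identities V" and e: "range e \<subseteq> carrier ?P" for s t e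
  proof -
    have "\<forall>n. \<exists>u. u \<in> wf_terms (symbols V) X \<and> e n = ?E `` {u}"
      using e by (auto simp: presented_def quotient_def image_subset_iff)
    then obtain \<sigma> where \<sigma>: "\<And>n. \<sigma> n \<in> wf_terms (symbols V) X" "\<And>n. e n = ?E `` {\<sigma> n}" by metis
    have ev: "subst \<sigma> u \<in> wf_terms (symbols V) X \<and> eval ?P e u = ?E `` {subst \<sigma> u}"
      if "u \<in> wf_terms (symbols V) UNIV" for u
      using that
    proof (induction u)
      case (App w ts)
      then have "eval ?P e (App w ts) = opn ?P w (map (\<lambda>t. ?E `` {t}) (map (subst \<sigma>) ts))"
        by (simp add: comp_def cong: map_cong)
      also have "\<dots> = ?E `` {App w (map (subst \<sigma>) ts)}"
        using App by (intro presented_opn[OF V R]) auto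
      finally show ?case using App by (auto intro!: wf_terms.App)
    qed (use \<sigma> in auto)
    have "(subst \<sigma> s, subst \<sigma> t) \<in> ?E" using st \<sigma> by (intro pres_cong.ident) auto
    moreover have "s \<in> wf_terms (symbols V) UNIV" "t \<in> wf_terms (symbols V) UNIV"
      using V st by (auto simp: is_variety_def)
    ultimately show ?thesis using ev equiv_class_eq[OF eq] by metis
  qed
  ultimately show ?thesis by (auto simp: in_variety_def)
qed

lemma eval_closed:
  assumes "is_algebra V B" "t \<in> wf_terms (symbols V) X" "f ` X \<subseteq> carrier B"
  shows "eval B f t \<in> carrier B"
  using assms(2)
proof (induction t)
  case (App w ts)
  then have "(w, map (eval B f) ts) \<in> op_args V B" by (auto simp: op_args_def)
  then show ?case using assms(1) by (auto simp: is_algebra_def)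
qed (use assms(3) in auto)

lemma presented_universal:
  fixes B :: "('b, 'f) alg"
  assumes V: "is_variety V" and R: "R \<subseteq> wf_terms (symbols V) X \<times> wf_terms (symbols V) X"
    and B: "in_variety V B" and f: "f ` X \<subseteq> carrier B"
    and fR: "\<And>s t. (s, t) \<in> R \<Longrightarrow> eval B f s = eval B f t"
  shows "\<exists>!h. h \<in> alg_hom V (presented V X R) B \<and> (\<forall>x \<in> X. h (pres_cong V X R `` {Var x}) = f x)"
proof -
  let ?E = "pres_cong V X R" and ?P = "presented V X R" and ?T = "wf_terms (symbols V) X"
  note eq = pres_cong_equiv[OF V R]
  have Balg: "is_algebra V B" using B by (simp add: in_variety_def)
  have inv: "eval B f s = eval B f t" if "(s, t) \<in> ?E" for s t
    using that
  proof (induction rule: pres_cong.induct)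
    case (cong w ss ts)
    then have "map (eval B f) ss = map (eval B f) ts"
      by (auto simp: list_all2_conv_all_nth intro!: nth_equalityI)
    then show ?case by simp
  next
    case (ident s t \<sigma>)
    have es: "eval B f (subst \<sigma> u) = eval B (eval B f \<circ> \<sigma>) u" for u
      by (induction u) (auto simp: comp_def cong: map_cong)
    have "range (eval B f \<circ> \<sigma>) \<subseteq> carrier B"
      using ident eval_closed[OF Balg _ f] by auto
    then show ?case using B ident(1) unfolding es in_variety_def by blast
  qed (use fR in auto)
  define h where "h = (\<lambda>C \<in> carrier ?P. eval B f (SOME t. t \<in> C))"
  have h_cls: "h (?E `` {t}) = eval B f t" if "t \<in> ?T" for t
  proof -
    have "t \<in> ?E `` {t}" using that by (auto intro: pres_cong.refl)
    then have "(SOME s. s \<in> ?E `` {t}) \<in> ?E `` {t}" by (metis someI)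
    then have "eval B f (SOME s. s \<in> ?E `` {t}) = eval B f t" using inv by auto
    then show ?thesis using that by (auto simp: h_def presented_def quotientI)
  qed
  have h_hom: "h \<in> alg_hom V ?P B"
    unfolding alg_hom_def
  proof (intro CollectI conjI)
    have "h C \<in> carrier B" if "C \<in> carrier ?P" for C
      using that h_cls eval_closed[OF Balg _ f] by (auto simp: presented_def elim!: quotientE)
    then show "h \<in> carrier ?P \<rightarrow>\<^sub>E carrier B" by (auto simp: h_def)
    show "\<forall>(w, Cs) \<in> op_args V ?P. h (opn ?P w Cs) = opn B w (map h Cs)"
    proof clarify
      fix w Cs assume "(w, Cs) \<in> op_args V ?P"
      then have w: "w \<in> symbols V (length Cs)" and Cs: "set Cs \<subseteq> carrier ?P"
        by (auto simp: op_args_def)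
      from Cs obtain ts where ts: "set ts \<subseteq> ?T" "Cs = map (\<lambda>t. ?E `` {t}) ts"
        by (rule presented_reps)
      have "App w ts \<in> ?T" using w ts by (intro wf_terms.App) auto
      then have "h (opn ?P w Cs) = eval B f (App w ts)"
        using presented_opn[OF V R, of w ts] w ts h_cls by auto
      moreover have "map h Cs = map (eval B f) ts" using ts h_cls by auto
      ultimately show "h (opn ?P w Cs) = opn B w (map h Cs)" by simp
    qed
  qed
  show ?thesis
  proof (rule ex1I[of _ h])
    show "h \<in> alg_hom V ?P B \<and> (\<forall>x \<in> X. h (?E `` {Var x}) = f x)"
      using h_hom h_cls[OF wf_terms.Var] by auto
  next
    fix k assume k: "k \<in> alg_hom V ?P B \<and> (\<forall>x \<in> X. k (?E `` {Var x}) = f x)"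
    have k_cls: "k (?E `` {t}) = eval B f t" if "t \<in> ?T" for t
      using that
    proof (induction t)
      case (App w ts)
      let ?Cs = "map (\<lambda>t. ?E `` {t}) ts"
      have "(w, ?Cs) \<in> op_args V ?P"
        using App by (auto simp: op_args_def presented_def intro!: quotientI)
      then have "k (opn ?P w ?Cs) = opn B w (map k ?Cs)" using k by (auto simp: alg_hom_def)
      moreover have "map k ?Cs = map (eval B f) ts" using App by auto
      moreover have "opn ?P w ?Cs = ?E `` {App w ts}" using App by (intro presented_opn[OF V R]) auto
      ultimately show ?case by (metis eval.simps(2))
    qed (use k in auto)
    have "k C = h C" if "C \<in> carrier ?P" for C
      using that k_cls h_cls by (auto simp: presented_def elim!: quotientE)
    moreover have "k \<in> extensional (carrier ?P)" "h \<in> extensional (carrier ?P)"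
      using k h_hom by (auto simp: alg_hom_def PiE_def)
    ultimately show "k = h" by (intro extensionalityI) auto
  qed
qed

lemma free_alg_in_variety: "is_variety V \<Longrightarrow> in_variety V (free_alg V X)"
  unfolding free_alg_def by (rule presented_in_variety) auto

lemma free_gen_carrier: "v \<in> X \<Longrightarrow> free_gen V X v \<in> carrier (free_alg V X)"
  by (auto simp: free_gen_def free_alg_def presented_def intro!: quotientI wf_terms.Var)

theorem free_alg_universal:
  fixes B :: "('b, 'f) alg"
  assumes "is_variety V" "in_variety V B" "f \<in> X \<rightarrow> carrier B"
  shows "\<exists>!h. h \<in> alg_hom V (free_alg V X) B \<and> (\<forall>v \<in> X. h (free_gen V X v) = f v)"
  using presented_universal[OF assms(1) _ assms(2), of "{}" X f] assms(3)
  unfolding free_alg_def free_gen_def by auto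

lemma op_rels_wf:
  assumes "is_algebra V A" "j ` carrier A \<subseteq> X"
  shows "op_rels V A j \<subseteq> wf_terms (symbols V) X \<times> wf_terms (symbols V) X"
proof clarify
  fix s t assume "(s, t) \<in> op_rels V A j"
  then obtain w as where wa: "(w, as) \<in> op_args V A"
    and st: "s = App w (map (\<lambda>a. Var (j a)) as)" "t = Var (j (opn A w as))"
    by (auto simp: op_rels_def)
  have as: "w \<in> symbols V (length as)" "set as \<subseteq> carrier A" using wa by (auto simp: op_args_def)
  have "opn A w as \<in> carrier A" using assms(1) wa by (auto simp: is_algebra_def)
  then have "t \<in> wf_terms (symbols V) X"
    unfolding st using assms(2) by (intro wf_terms.Var) auto
  moreover have "s \<in> wf_terms (symbols V) X"
    unfolding st using as assms(2) by (intro wf_terms.App) (auto intro!: wf_terms.Var)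
  ultimately show "s \<in> wf_terms (symbols V) X \<and> t \<in> wf_terms (symbols V) X" by simp
qed

lemma coprod_rels_wf:
  assumes "is_algebra V A" "is_algebra V B"
  shows "coprod_rels V A B \<subseteq> wf_terms (symbols V) (carrier A <+> carrier B)
    \<times> wf_terms (symbols V) (carrier A <+> carrier B)"
  unfolding coprod_rels_def using assms by (intro Un_least op_rels_wf) auto

lemma coprod_in_variety:
  assumes "is_variety V" "in_variety V A" "in_variety V B"
  shows "in_variety V (coprod V A B)"
  unfolding coprod_def using assms
  by (intro presented_in_variety coprod_rels_wf) (auto simp: in_variety_def)

lemma op_rels_hom:
  assumes V: "is_variety V" and A: "is_algebra V A" and jX: "j ` carrier A \<subseteq> X"
    and R: "R \<subseteq> wf_terms (symbols V) X \<times> wf_terms (symbols V) X" "op_rels V A j \<subseteq> R"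
  shows "(\<lambda>a \<in> carrier A. pres_cong V X R `` {Var (j a)}) \<in> alg_hom V A (presented V X R)"
  unfolding alg_hom_def
proof (intro CollectI conjI)
  show "(\<lambda>a \<in> carrier A. pres_cong V X R `` {Var (j a)}) \<in> carrier A \<rightarrow>\<^sub>E carrier (presented V X R)"
    using jX by (auto simp: presented_def intro!: quotientI wf_terms.Var)
  show "\<forall>(w, as) \<in> op_args V A. (\<lambda>a \<in> carrier A. pres_cong V X R `` {Var (j a)}) (opn A w as)
      = opn (presented V X R) w (map (\<lambda>a \<in> carrier A. pres_cong V X R `` {Var (j a)}) as)"
  proof clarify
    fix w as assume wa: "(w, as) \<in> op_args V A"
    let ?ts = "map (\<lambda>a. Var (j a)) as"
    have as: "w \<in> symbols V (length as)" "set as \<subseteq> carrier A" using wa by (auto simp: op_args_def)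
    have 1: "map (\<lambda>a \<in> carrier A. pres_cong V X R `` {Var (j a)}) as = map (\<lambda>t. pres_cong V X R `` {t}) ?ts"
      using as by auto
    have 2: "opn (presented V X R) w (map (\<lambda>t. pres_cong V X R `` {t}) ?ts) = pres_cong V X R `` {App w ?ts}"
      using as jX by (intro presented_opn[OF V R(1)]) (auto intro!: wf_terms.Var)
    have "(App w ?ts, Var (j (opn A w as))) \<in> R"
      using wa R(2) by (auto simp: op_rels_def)
    then have 3: "pres_cong V X R `` {App w ?ts} = pres_cong V X R `` {Var (j (opn A w as))}"
      using equiv_class_eq[OF pres_cong_equiv[OF V R(1)]] pres_cong.rel by metis
    have 4: "opn A w as \<in> carrier A" using A wa by (auto simp: is_algebra_def)
    show "(\<lambda>a \<in> carrier A. pres_cong V X R `` {Var (j a)}) (opn A w as)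
      = opn (presented V X R) w (map (\<lambda>a \<in> carrier A. pres_cong V X R `` {Var (j a)}) as)"
      unfolding 1 2 3 using 4 by simp
  qed
qed

lemma coprod_inl_hom:
  assumes "is_variety V" "in_variety V A" "in_variety V B"
  shows "restrict (coprod_inl V A B) (carrier A) \<in> alg_hom V A (coprod V A B)"
  unfolding coprod_def coprod_inl_def using assms
  by (intro op_rels_hom coprod_rels_wf) (auto simp: in_variety_def coprod_rels_def)

lemma coprod_inr_hom:
  assumes "is_variety V" "in_variety V A" "in_variety V B"
  shows "restrict (coprod_inr V A B) (carrier B) \<in> alg_hom V B (coprod V A B)"
  unfolding coprod_def coprod_inr_def using assms
  by (intro op_rels_hom coprod_rels_wf) (auto simp: in_variety_def coprod_rels_def)

theorem coprod_universal:
  fixes C :: "('c, 'f) alg"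
  assumes "is_variety V" "in_variety V A" "in_variety V B" "in_variety V C"
    and f: "f \<in> alg_hom V A C" and g: "g \<in> alg_hom V B C"
  shows "\<exists>!h. h \<in> alg_hom V (coprod V A B) C \<and>
    (\<forall>a \<in> carrier A. h (coprod_inl V A B a) = f a) \<and> (\<forall>b \<in> carrier B. h (coprod_inr V A B b) = g b)"
proof -
  let ?X = "carrier A <+> carrier B"
  have alg: "is_algebra V A" "is_algebra V B" using assms by (auto simp: in_variety_def)
  have im: "case_sum f g ` ?X \<subseteq> carrier C" using f g by (auto simp: alg_hom_def)
  have 1: "eval C (case_sum f g) s = eval C (case_sum f g) t" if "(s, t) \<in> coprod_rels V A B" for s t
    using that f g by (auto simp: coprod_rels_def op_rels_def alg_hom_def comp_def)
  have iff: "(\<forall>x \<in> ?X. h (pres_cong V ?X (coprod_rels V A B) `` {Var x}) = case_sum f g x) \<longleftrightarrow>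
    (\<forall>a \<in> carrier A. h (coprod_inl V A B a) = f a) \<and> (\<forall>b \<in> carrier B. h (coprod_inr V A B b) = g b)" for h
    unfolding coprod_inl_def coprod_inr_def Plus_def by auto
  show ?thesis
    using presented_universal[OF assms(1) coprod_rels_wf[OF alg] assms(4) im 1]
    unfolding iff coprod_def by simp
qed


section \<open>Unary polynomials\<close>

type_synonym ('a, 'f) upol = "('f, 'a + ('f, unit) trm set) trm set"

definition pol1 :: "'f variety \<Rightarrow> ('a, 'f) alg \<Rightarrow> (('a, 'f) upol, 'f) alg" where
  "pol1 V A = coprod V A (free_alg V {()})"

definition pconst :: "'f variety \<Rightarrow> ('a, 'f) alg \<Rightarrow> 'a \<Rightarrow> ('a, 'f) upol" where
  "pconst V A a = coprod_inl V A (free_alg V {()}) a"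

definition pvar :: "'f variety \<Rightarrow> ('a, 'f) alg \<Rightarrow> ('a, 'f) upol" where
  "pvar V A = coprod_inr V A (free_alg V {()}) (free_gen V {()} ())"

definition pol_eval :: "'f variety \<Rightarrow> ('a, 'f) alg \<Rightarrow> 'a \<Rightarrow> ('a, 'f) upol \<Rightarrow> 'a" where
  "pol_eval V A b = (THE h. h \<in> alg_hom V (pol1 V A) A \<and>
     (\<forall>a \<in> carrier A. h (pconst V A a) = a) \<and> h (pvar V A) = b)"

lemma pol1_universal:
  fixes C :: "('c, 'f) alg"
  assumes V: "is_variety V" and A: "in_variety V A" and C: "in_variety V C"
    and f: "f \<in> alg_hom V A C" and c: "c \<in> carrier C"
  shows "\<exists>!h. h \<in> alg_hom V (pol1 V A) C \<and>
    (\<forall>a \<in> carrier A. h (pconst V A a) = f a) \<and> h (pvar V A) = c"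
proof -
  let ?F = "free_alg V {()}"
  have F: "in_variety V ?F" by (rule free_alg_in_variety[OF V])
  have x: "free_gen V {()} () \<in> carrier ?F" by (rule free_gen_carrier) simp
  have uniq: "\<exists>!g. g \<in> alg_hom V ?F C \<and> g (free_gen V {()} ()) = c"
    using free_alg_universal[OF V C, of "\<lambda>_. c" "{()}"] c by simp
  then obtain g where g: "g \<in> alg_hom V ?F C" "g (free_gen V {()} ()) = c" by blast
  have U: "in_variety V (pol1 V A)" unfolding pol1_def by (rule coprod_in_variety[OF V A F])
  have iff: "h (pvar V A) = c \<longleftrightarrow> (\<forall>b \<in> carrier ?F. h (coprod_inr V A ?F b) = g b)"
    if h: "h \<in> alg_hom V (pol1 V A) C" for h
  proof
    assume hx: "h (pvar V A) = c"
    let ?r = "restrict (coprod_inr V A ?F) (carrier ?F)"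
    let ?k = "\<lambda>b \<in> carrier ?F. h (?r b)"
    have r: "?r \<in> alg_hom V ?F (pol1 V A)" unfolding pol1_def by (rule coprod_inr_hom[OF V A F])
    have r_car: "coprod_inr V A ?F b \<in> carrier (pol1 V A)" if "b \<in> carrier ?F" for b
      using r that by (auto simp: alg_hom_def PiE_def Pi_def)
    have "?k \<in> alg_hom V ?F C"
      unfolding alg_hom_def
    proof (intro CollectI conjI)
      show "?k \<in> carrier ?F \<rightarrow>\<^sub>E carrier C" using h r_car by (auto simp: alg_hom_def)
      show "\<forall>(w, bs) \<in> op_args V ?F. ?k (opn ?F w bs) = opn C w (map ?k bs)"
      proof clarify
        fix w bs assume wb: "(w, bs) \<in> op_args V ?F"
        then have bs: "w \<in> symbols V (length bs)" "set bs \<subseteq> carrier ?F" by (auto simp: op_args_def)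
        have o: "opn ?F w bs \<in> carrier ?F" using F wb by (auto simp: in_variety_def is_algebra_def)
        have 1: "?r (opn ?F w bs) = opn (pol1 V A) w (map ?r bs)" using r wb by (auto simp: alg_hom_def)
        have "(w, map ?r bs) \<in> op_args V (pol1 V A)"
          using bs r_car by (auto simp: op_args_def)
        then have 2: "h (opn (pol1 V A) w (map ?r bs)) = opn C w (map h (map ?r bs))"
          using h by (auto simp: alg_hom_def)
        have 3: "map h (map ?r bs) = map ?k bs" using bs by auto
        have "?k (opn ?F w bs) = h (?r (opn ?F w bs))" using o by simp
        then show "?k (opn ?F w bs) = opn C w (map ?k bs)" unfolding 1 2 3 .
      qed
    qed
    moreover have "?k (free_gen V {()} ()) = c" using hx x by (simp add: pvar_def)
    ultimately have k: "?k = g" using uniq g by blast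
    show "\<forall>b \<in> carrier ?F. h (coprod_inr V A ?F b) = g b"
    proof
      fix b assume "b \<in> carrier ?F"
      then show "h (coprod_inr V A ?F b) = g b" using fun_cong[OF k, of b] by simp
    qed
  next
    assume "\<forall>b \<in> carrier ?F. h (coprod_inr V A ?F b) = g b"
    then show "h (pvar V A) = c" using x g by (simp add: pvar_def)
  qed
  have "(h \<in> alg_hom V (pol1 V A) C \<and> (\<forall>a \<in> carrier A. h (pconst V A a) = f a) \<and> h (pvar V A) = c) \<longleftrightarrow>
    (h \<in> alg_hom V (coprod V A ?F) C \<and> (\<forall>a \<in> carrier A. h (coprod_inl V A ?F a) = f a) \<and>
     (\<forall>b \<in> carrier ?F. h (coprod_inr V A ?F b) = g b))" for h
    using iff[of h] unfolding pconst_def pol1_def by blast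
  then show ?thesis using coprod_universal[OF V A F C f g(1)] by simp
qed

lemma pol_eval_exists:
  assumes V: "is_variety V" and A: "in_variety V A" and b: "b \<in> carrier A"
  shows "\<exists>!h. h \<in> alg_hom V (pol1 V A) A \<and>
    (\<forall>a \<in> carrier A. h (pconst V A a) = a) \<and> h (pvar V A) = b"
proof -
  have "(\<lambda>a \<in> carrier A. a) \<in> alg_hom V A A"
    unfolding alg_hom_def
  proof (intro CollectI conjI)
    show "\<forall>(w, as) \<in> op_args V A. (\<lambda>a \<in> carrier A. a) (opn A w as) = opn A w (map (\<lambda>a \<in> carrier A. a) as)"
    proof clarify
      fix w as assume wa: "(w, as) \<in> op_args V A"
      then have "map (\<lambda>a \<in> carrier A. a) as = as" by (intro map_idI) (auto simp: op_args_def)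
      moreover have "opn A w as \<in> carrier A" using A wa by (auto simp: in_variety_def is_algebra_def)
      ultimately show "(\<lambda>a \<in> carrier A. a) (opn A w as) = opn A w (map (\<lambda>a \<in> carrier A. a) as)" by simp
    qed
  qed auto
  from pol1_universal[OF V A A this b] show ?thesis by (simp cong: conj_cong ball_cong)
qed


section \<open>Modules and pointed overalgebras over an algebra\<close>

text \<open>The abelian groups are those of HOL-Algebra, hence in multiplicative notation: the sum, the
  zero and finite sums appear as \<open>\<otimes>\<close>, \<open>\<one>\<close> and \<open>finprod\<close>.  Only the groups \<open>grp M a\<close> with
  \<open>a \<in> carrier A\<close> matter.\<close>

record ('a, 'f, 'm) amod =
  grp :: "'a \<Rightarrow> 'm monoid"
  mop :: "'f \<Rightarrow> 'a list \<Rightarrow> 'm list \<Rightarrow> 'm"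

record ('a, 'f, 'p) pover =
  pset :: "'a \<Rightarrow> 'p set"
  pbase :: "'a \<Rightarrow> 'p"
  pop :: "'f \<Rightarrow> 'a list \<Rightarrow> 'p list \<Rightarrow> 'p"

definition tuples :: "('a \<Rightarrow> 'm set) \<Rightarrow> 'a list \<Rightarrow> 'm list set" where
  "tuples S as = listset (map S as)"

definition mtuples :: "('a \<Rightarrow> 'm monoid) \<Rightarrow> 'a list \<Rightarrow> 'm list set" where
  "mtuples G as = tuples (\<lambda>a. carrier (G a)) as"

text \<open>The last conjunct fixes the operations outside their domain, so that equality of modules is
  equality of their operations on the domain.\<close>

definition is_amodule :: "'f variety \<Rightarrow> ('a, 'f) alg \<Rightarrow> ('a, 'f, 'm) amod \<Rightarrow> bool" where
  "is_amodule V A M \<longleftrightarrow>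
     (\<forall>a \<in> carrier A. comm_group (grp M a)) \<and>
     (\<forall>(w, as) \<in> op_args V A. mop M w as \<in> hom (DirProd_list (map (grp M) as)) (grp M (opn A w as))) \<and>
     (\<forall>w as ms. \<not> ((w, as) \<in> op_args V A \<and> ms \<in> mtuples (grp M) as) \<longrightarrow> mop M w as ms = undefined)"

definition total_alg :: "('a, 'f) alg \<Rightarrow> ('a, 'f, 'm) amod \<Rightarrow> ('a \<times> 'm, 'f) alg" where
  "total_alg A M =
     \<lparr>carrier = (SIGMA a : carrier A. carrier (grp M a)),
      opn = (\<lambda>w ps. (opn A w (map fst ps), mop M w (map fst ps) (map snd ps)))\<rparr>"

definition totally_in :: "'f variety \<Rightarrow> ('a, 'f) alg \<Rightarrow> ('a, 'f, 'm) amod \<Rightarrow> bool" where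
  "totally_in V A M \<longleftrightarrow> in_variety V (total_alg A M)"

definition grp_fam_hom :: "'a set \<Rightarrow> ('a \<Rightarrow> 'm monoid) \<Rightarrow> ('a \<Rightarrow> 'n monoid) \<Rightarrow> ('a \<Rightarrow> 'm \<Rightarrow> 'n) set" where
  "grp_fam_hom S G G' = (\<Pi>\<^sub>E a \<in> S. hom (G a) (G' a) \<inter> extensional (carrier (G a)))"

definition amod_hom :: "'f variety \<Rightarrow> ('a, 'f) alg \<Rightarrow> ('a, 'f, 'm) amod \<Rightarrow> ('a, 'f, 'n) amod
    \<Rightarrow> ('a \<Rightarrow> 'm \<Rightarrow> 'n) set" where
  "amod_hom V A M M' = {\<phi> \<in> grp_fam_hom (carrier A) (grp M) (grp M').
     \<forall>(w, as) \<in> op_args V A. \<forall>ms \<in> mtuples (grp M) as.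
       \<phi> (opn A w as) (mop M w as ms) = mop M' w as (map2 \<phi> as ms)}"

definition is_submodule :: "'f variety \<Rightarrow> ('a, 'f) alg \<Rightarrow> ('a, 'f, 'm) amod \<Rightarrow> ('a \<Rightarrow> 'm set) \<Rightarrow> bool" where
  "is_submodule V A M S \<longleftrightarrow>
     (\<forall>a \<in> carrier A. subgroup (S a) (grp M a)) \<and>
     (\<forall>(w, as) \<in> op_args V A. \<forall>ms \<in> tuples S as. mop M w as ms \<in> S (opn A w as))"

definition quot_amod :: "'f variety \<Rightarrow> ('a, 'f) alg \<Rightarrow> ('a, 'f, 'm) amod \<Rightarrow> ('a \<Rightarrow> 'm set)
    \<Rightarrow> ('a, 'f, 'm set) amod" where
  "quot_amod V A M S =
     \<lparr>grp = (\<lambda>a. grp M a Mod S a),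
      mop = (\<lambda>w as Cs.
        if (w, as) \<in> op_args V A \<and> Cs \<in> mtuples (\<lambda>a. grp M a Mod S a) as
        then \<Union>ms \<in> listset Cs. S (opn A w as) #>\<^bsub>grp M (opn A w as)\<^esub> mop M w as ms
        else undefined)\<rparr>"


section \<open>Modulization\<close>

text \<open>The free abelian group on a set consists of finitely supported integer-valued functions; on
  these the group operation is \<open>+\<close>, so the sums below are sums in the free abelian group.\<close>

definition fmod_op_i :: "('a, 'f, 'p) pover \<Rightarrow> 'f \<Rightarrow> 'a list \<Rightarrow> nat \<Rightarrow> ('p \<Rightarrow>\<^sub>0 int) \<Rightarrow> ('p \<Rightarrow>\<^sub>0 int)" where
  "fmod_op_i P w as i = frag_extend (\<lambda>p. frag_of (pop P w as ((map (pbase P) as)[i := p])))"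

definition fmod :: "'f variety \<Rightarrow> ('a, 'f) alg \<Rightarrow> ('a, 'f, 'p) pover \<Rightarrow> ('a, 'f, 'p \<Rightarrow>\<^sub>0 int) amod" where
  "fmod V A P =
     \<lparr>grp = (\<lambda>a. free_Abelian_group (pset P a)),
      mop = (\<lambda>w as ms.
        if (w, as) \<in> op_args V A \<and> ms \<in> mtuples (\<lambda>a. free_Abelian_group (pset P a)) as
        then \<Sum>i<length as. fmod_op_i P w as i (ms ! i)
        else undefined)\<rparr>"

definition modz_ker :: "'f variety \<Rightarrow> ('a, 'f) alg \<Rightarrow> ('a, 'f, 'p) pover \<Rightarrow> 'a \<Rightarrow> ('p \<Rightarrow>\<^sub>0 int) set" where
  "modz_ker V A P a = \<Inter>{S a | S. is_submodule V A (fmod V A P) S \<and>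
     (\<forall>c \<in> carrier A. frag_of (pbase P c) \<in> S c) \<and>
     (\<forall>(w, as) \<in> op_args V A. \<forall>ps \<in> tuples (pset P) as.
        frag_of (pop P w as ps) - (\<Sum>i<length as. fmod_op_i P w as i (frag_of (ps ! i)))
          \<in> S (opn A w as))}"

definition modz :: "'f variety \<Rightarrow> ('a, 'f) alg \<Rightarrow> ('a, 'f, 'p) pover \<Rightarrow> ('a, 'f, ('p \<Rightarrow>\<^sub>0 int) set) amod" where
  "modz V A P = quot_amod V A (fmod V A P) (modz_ker V A P)"

definition modz_unit :: "'f variety \<Rightarrow> ('a, 'f) alg \<Rightarrow> ('a, 'f, 'p) pover \<Rightarrow> 'a \<Rightarrow> 'p \<Rightarrow> ('p \<Rightarrow>\<^sub>0 int) set" where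
  "modz_unit V A P a p = modz_ker V A P a #>\<^bsub>free_Abelian_group (pset P a)\<^esub> frag_of p"


section \<open>The enveloping ringoid and its left modules\<close>

definition pol_over :: "'f variety \<Rightarrow> ('a, 'f) alg \<Rightarrow> 'a \<Rightarrow> ('a, 'f, ('a, 'f) upol) pover" where
  "pol_over V A b =
     \<lparr>pset = (\<lambda>a. {u \<in> carrier (pol1 V A). pol_eval V A b u = a}),
      pbase = pconst V A,
      pop = (\<lambda>w as us. opn (pol1 V A) w us)\<rparr>"

type_synonym ('a, 'f) zel = "(('a, 'f) upol \<Rightarrow>\<^sub>0 int) set"

definition zmod :: "'f variety \<Rightarrow> ('a, 'f) alg \<Rightarrow> 'a \<Rightarrow> ('a, 'f, ('a, 'f) zel) amod" where
  "zmod V A b = modz V A (pol_over V A b)"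

definition zcls :: "'f variety \<Rightarrow> ('a, 'f) alg \<Rightarrow> 'a \<Rightarrow> ('a, 'f) upol \<Rightarrow> ('a, 'f) zel" where
  "zcls V A b u = modz_unit V A (pol_over V A b) (pol_eval V A b u) u"

definition theta :: "'f variety \<Rightarrow> ('a, 'f) alg \<Rightarrow> ('a, 'f, 'm) amod \<Rightarrow> 'a \<Rightarrow> 'm
    \<Rightarrow> 'a \<Rightarrow> ('a, 'f) zel \<Rightarrow> 'm" where
  "theta V A M b m = (THE \<theta>. \<theta> \<in> amod_hom V A (zmod V A b) M \<and> \<theta> b (zcls V A b (pvar V A)) = m)"

text \<open>\<open>rhom R a b\<close> is the group of arrows from \<open>b\<close> to \<open>a\<close>, and \<open>rmul R a b c z z'\<close> is the composite of
  \<open>z\<close> in \<open>rhom R a b\<close> and \<open>z'\<close> in \<open>rhom R b c\<close>.\<close>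

record ('o, 'z) ringoid =
  robj :: "'o set"
  rhom :: "'o \<Rightarrow> 'o \<Rightarrow> 'z monoid"
  rmul :: "'o \<Rightarrow> 'o \<Rightarrow> 'o \<Rightarrow> 'z \<Rightarrow> 'z \<Rightarrow> 'z"
  rid :: "'o \<Rightarrow> 'z"

definition env_ringoid :: "'f variety \<Rightarrow> ('a, 'f) alg \<Rightarrow> ('a, ('a, 'f) zel) ringoid" where
  "env_ringoid V A =
     \<lparr>robj = carrier A,
      rhom = (\<lambda>a b. grp (zmod V A b) a),
      rmul = (\<lambda>a b c z z'. theta V A (zmod V A c) b z' a z),
      rid = (\<lambda>b. zcls V A b (pvar V A))\<rparr>"

record ('o, 'z, 'm) lmod =
  lgrp :: "'o \<Rightarrow> 'm monoid"
  lact :: "'o \<Rightarrow> 'o \<Rightarrow> 'z \<Rightarrow> 'm \<Rightarrow> 'm"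

definition is_lmodule :: "('o, 'z) ringoid \<Rightarrow> ('o, 'z, 'm) lmod \<Rightarrow> bool" where
  "is_lmodule R N \<longleftrightarrow>
     (\<forall>a \<in> robj R. comm_group (lgrp N a)) \<and>
     (\<forall>a \<in> robj R. \<forall>b \<in> robj R. \<forall>z \<in> carrier (rhom R a b). lact N a b z \<in> hom (lgrp N b) (lgrp N a)) \<and>
     (\<forall>a \<in> robj R. \<forall>b \<in> robj R. \<forall>m \<in> carrier (lgrp N b).
        (\<lambda>z. lact N a b z m) \<in> hom (rhom R a b) (lgrp N a)) \<and>
     (\<forall>a \<in> robj R. \<forall>m \<in> carrier (lgrp N a). lact N a a (rid R a) m = m) \<and>
     (\<forall>a \<in> robj R. \<forall>b \<in> robj R. \<forall>c \<in> robj R.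
        \<forall>z \<in> carrier (rhom R a b). \<forall>z' \<in> carrier (rhom R b c). \<forall>m \<in> carrier (lgrp N c).
          lact N a c (rmul R a b c z z') m = lact N a b z (lact N b c z' m)) \<and>
     (\<forall>a b z m. \<not> (a \<in> robj R \<and> b \<in> robj R \<and> z \<in> carrier (rhom R a b) \<and> m \<in> carrier (lgrp N b))
        \<longrightarrow> lact N a b z m = undefined)"

definition lmod_hom :: "('o, 'z) ringoid \<Rightarrow> ('o, 'z, 'm) lmod \<Rightarrow> ('o, 'z, 'n) lmod
    \<Rightarrow> ('o \<Rightarrow> 'm \<Rightarrow> 'n) set" where
  "lmod_hom R N N' = {\<phi> \<in> grp_fam_hom (robj R) (lgrp N) (lgrp N').
     \<forall>a \<in> robj R. \<forall>b \<in> robj R. \<forall>z \<in> carrier (rhom R a b). \<forall>m \<in> carrier (lgrp N b).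
       \<phi> a (lact N a b z m) = lact N' a b z (\<phi> b m)}"


section \<open>Categories and functors\<close>

record ('o, 'h) cat =
  Obj :: "'o set"
  Arr :: "'h set"
  Dom :: "'h \<Rightarrow> 'o"
  Cod :: "'h \<Rightarrow> 'o"
  Idt :: "'o \<Rightarrow> 'h"
  Cmp :: "'h \<Rightarrow> 'h \<Rightarrow> 'h"

definition is_category :: "('o, 'h) cat \<Rightarrow> bool" where
  "is_category C \<longleftrightarrow>
     (\<forall>f \<in> Arr C. Dom C f \<in> Obj C \<and> Cod C f \<in> Obj C) \<and>
     (\<forall>x \<in> Obj C. Idt C x \<in> Arr C \<and> Dom C (Idt C x) = x \<and> Cod C (Idt C x) = x) \<and>
     (\<forall>f \<in> Arr C. \<forall>g \<in> Arr C. Cod C f = Dom C g \<longrightarrow>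
        Cmp C g f \<in> Arr C \<and> Dom C (Cmp C g f) = Dom C f \<and> Cod C (Cmp C g f) = Cod C g) \<and>
     (\<forall>f \<in> Arr C. Cmp C f (Idt C (Dom C f)) = f \<and> Cmp C (Idt C (Cod C f)) f = f) \<and>
     (\<forall>f \<in> Arr C. \<forall>g \<in> Arr C. \<forall>h \<in> Arr C. Cod C f = Dom C g \<longrightarrow> Cod C g = Dom C h \<longrightarrow>
        Cmp C h (Cmp C g f) = Cmp C (Cmp C h g) f)"

record ('o, 'h, 'p, 'k) func =
  on_obj :: "'o \<Rightarrow> 'p"
  on_arr :: "'h \<Rightarrow> 'k"

definition is_functor :: "('o, 'h) cat \<Rightarrow> ('p, 'k) cat \<Rightarrow> ('o, 'h, 'p, 'k) func \<Rightarrow> bool" where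
  "is_functor C D F \<longleftrightarrow> is_category C \<and> is_category D \<and>
     (\<forall>x \<in> Obj C. on_obj F x \<in> Obj D \<and> on_arr F (Idt C x) = Idt D (on_obj F x)) \<and>
     (\<forall>f \<in> Arr C. on_arr F f \<in> Arr D \<and>
        Dom D (on_arr F f) = on_obj F (Dom C f) \<and> Cod D (on_arr F f) = on_obj F (Cod C f)) \<and>
     (\<forall>f \<in> Arr C. \<forall>g \<in> Arr C. Cod C f = Dom C g \<longrightarrow>
        on_arr F (Cmp C g f) = Cmp D (on_arr F g) (on_arr F f))"

definition func_id :: "('o, 'h, 'o, 'h) func" where
  "func_id = \<lparr>on_obj = (\<lambda>x. x), on_arr = (\<lambda>f. f)\<rparr>"

definition func_comp :: "('p, 'k, 'q, 'l) func \<Rightarrow> ('o, 'h, 'p, 'k) func \<Rightarrow> ('o, 'h, 'q, 'l) func" where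
  "func_comp G F = \<lparr>on_obj = on_obj G \<circ> on_obj F, on_arr = on_arr G \<circ> on_arr F\<rparr>"

definition func_eq :: "('o, 'h) cat \<Rightarrow> ('o, 'h, 'p, 'k) func \<Rightarrow> ('o, 'h, 'p, 'k) func \<Rightarrow> bool" where
  "func_eq C F G \<longleftrightarrow> (\<forall>x \<in> Obj C. on_obj F x = on_obj G x) \<and> (\<forall>f \<in> Arr C. on_arr F f = on_arr G f)"

text \<open>Arrows carry their source and target.  The modules in these categories are those whose groups
  have elements in the type \<open>'m\<close>, which acts as the universe.\<close>

definition ab_cat :: "'f variety \<Rightarrow> ('a, 'f) alg
    \<Rightarrow> (('a, 'f, 'm) amod, ('a, 'f, 'm) amod \<times> ('a \<Rightarrow> 'm \<Rightarrow> 'm) \<times> ('a, 'f, 'm) amod) cat" where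
  "ab_cat V A =
     \<lparr>Obj = {M. is_amodule V A M \<and> totally_in V A M},
      Arr = {(M, \<phi>, M'). is_amodule V A M \<and> totally_in V A M \<and> is_amodule V A M' \<and> totally_in V A M' \<and>
               \<phi> \<in> amod_hom V A M M'},
      Dom = fst,
      Cod = snd \<circ> snd,
      Idt = (\<lambda>M. (M, \<lambda>a \<in> carrier A. \<lambda>m \<in> carrier (grp M a). m, M)),
      Cmp = (\<lambda>(M', \<psi>, M'') (M, \<phi>, _). (M, \<lambda>a \<in> carrier A. compose (carrier (grp M a)) (\<psi> a) (\<phi> a), M''))\<rparr>"

definition lmod_cat :: "('o, 'z) ringoid
    \<Rightarrow> (('o, 'z, 'm) lmod, ('o, 'z, 'm) lmod \<times> ('o \<Rightarrow> 'm \<Rightarrow> 'm) \<times> ('o, 'z, 'm) lmod) cat" where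
  "lmod_cat R =
     \<lparr>Obj = {N. is_lmodule R N},
      Arr = {(N, \<phi>, N'). is_lmodule R N \<and> is_lmodule R N' \<and> \<phi> \<in> lmod_hom R N N'},
      Dom = fst,
      Cod = snd \<circ> snd,
      Idt = (\<lambda>N. (N, \<lambda>a \<in> robj R. \<lambda>m \<in> carrier (lgrp N a). m, N)),
      Cmp = (\<lambda>(N', \<psi>, N'') (N, \<phi>, _). (N, \<lambda>a \<in> robj R. compose (carrier (lgrp N a)) (\<psi> a) (\<phi> a), N''))\<rparr>"


section \<open>The functors\<close>

definition G_obj :: "'f variety \<Rightarrow> ('a, 'f) alg \<Rightarrow> ('a, 'f, 'm) amod \<Rightarrow> ('a, ('a, 'f) zel, 'm) lmod" where
  "G_obj V A M =
     \<lparr>lgrp = grp M,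
      lact = (\<lambda>a b z m.
        if a \<in> carrier A \<and> b \<in> carrier A \<and> z \<in> carrier (rhom (env_ringoid V A) a b) \<and> m \<in> carrier (grp M b)
        then theta V A M b m a z else undefined)\<rparr>"

definition H_obj :: "'f variety \<Rightarrow> ('a, 'f) alg \<Rightarrow> ('a, ('a, 'f) zel, 'm) lmod \<Rightarrow> ('a, 'f, 'm) amod" where
  "H_obj V A N =
     \<lparr>grp = lgrp N,
      mop = (\<lambda>w as ms.
        if (w, as) \<in> op_args V A \<and> ms \<in> mtuples (lgrp N) as
        then finprod (lgrp N (opn A w as))
          (\<lambda>i. lact N (opn A w as) (as ! i)
             (zcls V A (as ! i) (opn (pol1 V A) w ((map (pconst V A) as)[i := pvar V A]))) (ms ! i))
          {..<length as}
        else undefined)\<rparr>"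

definition G_functor :: "'f variety \<Rightarrow> ('a, 'f) alg
    \<Rightarrow> (('a, 'f, 'm) amod, ('a, 'f, 'm) amod \<times> ('a \<Rightarrow> 'm \<Rightarrow> 'm) \<times> ('a, 'f, 'm) amod,
        ('a, ('a, 'f) zel, 'm) lmod,
        ('a, ('a, 'f) zel, 'm) lmod \<times> ('a \<Rightarrow> 'm \<Rightarrow> 'm) \<times> ('a, ('a, 'f) zel, 'm) lmod) func" where
  "G_functor V A = \<lparr>on_obj = G_obj V A, on_arr = (\<lambda>(M, \<zeta>, M'). (G_obj V A M, \<zeta>, G_obj V A M'))\<rparr>"

definition H_functor :: "'f variety \<Rightarrow> ('a, 'f) alg
    \<Rightarrow> (('a, ('a, 'f) zel, 'm) lmod,
        ('a, ('a, 'f) zel, 'm) lmod \<times> ('a \<Rightarrow> 'm \<Rightarrow> 'm) \<times> ('a, ('a, 'f) zel, 'm) lmod,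
        ('a, 'f, 'm) amod, ('a, 'f, 'm) amod \<times> ('a \<Rightarrow> 'm \<Rightarrow> 'm) \<times> ('a, 'f, 'm) amod) func" where
  "H_functor V A = \<lparr>on_obj = H_obj V A, on_arr = (\<lambda>(N, \<phi>, N'). (H_obj V A N, \<phi>, H_obj V A N'))\<rparr>"

end

theory Submission
  imports Defs
begin

text \<open>A homomorphism out of \<open>\<M>U\<^sub>b\<close> amounts to a homomorphism of algebras from \<open>U = Pol\<^sub>1(A, V)\<close> into a total
  algebra sending \<open>a\<close> to \<open>(a, 0)\<close>, so it is determined by the image of \<open>x\<close>; this uniqueness gives
  the module laws for \<open>\<G>M\<close>.  Applied to \<open>\<omega>(a\<^sub>1, \<dots>, x, \<dots>, a\<^sub>n)\<close> it yields \<open>\<omega>\<^sub>i m\<close>, whence \<open>\<H>\<G> = 1\<close>.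
  Conversely, for a left module \<open>N\<close> and \<open>m\<close> in \<open>N\<^sub>b\<close>, the map \<open>z \<mapsto> z m\<close> is a homomorphism
  \<open>\<M>U\<^sub>b \<rightarrow> \<H>N\<close> sending \<open>(x)\<^sub>b\<close> to \<open>m\<close>, whence \<open>\<G>\<H> = 1\<close>.  The same maps show that \<open>\<H>N\<close> is totally in
  \<open>V\<close>: an identity over a point of \<open>A\<close> is additive in the module variables, so it can be tested on
  tuples with a single non-zero entry \<open>m\<close>, and such a tuple is the image of one in \<open>U\<close>.\<close>

section \<open>Tuples and finite products of groups\<close>

text \<open>The action z m is \<open>theta\<close>, a definite description that is under control
  only when the target module is totally in the variety. This shapes the proof in two places. The
  product of the ringoid is itself an action on a module \<open>zmod V A c\<close>, so that module
  must be shown totally in the variety before associativity can be treated. And \<open>G_obj\<close>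
  says something about \<open>H_obj V A N\<close> only once the latter is known to satisfy all
  identities, a fact to be extracted from the laws of a left module alone. Both come from one
  criterion with the unary polynomials as test algebra: the zeros of a one-entry tuple are images of
  constants, its entry is the image of a polynomial. That z \<mapsto> z m respects the operations
  rests on associativity: the coefficient belonging to slot i of an operation, multiplied by z, is
  the image of z under slot i of that operation in \<open>zmod V A b\<close>. The two composites are
  identities on the nose, since operations, actions and arrows are fixed outside their
  domains.\<close>

lemma tuples_iff:
  "ms \<in> tuples S as \<longleftrightarrow> length ms = length as \<and> (\<forall>i<length as. ms ! i \<in> S (as ! i))"
  by (auto simp: tuples_def listset_iff list_all2_conv_all_nth)

lemma mtuples_iff:
  "ms \<in> mtuples G as \<longleftrightarrow> length ms = length as \<and> (\<forall>i<length as. ms ! i \<in> carrier (G (as ! i)))"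
  by (simp add: mtuples_def tuples_iff)

lemma carrier_DirProd_list: "carrier (DirProd_list (map G as)) = mtuples G as"
proof (intro equalityI subsetI)
  fix ms assume "ms \<in> carrier (DirProd_list (map G as))"
  from DirProd_list_carrier_mem[OF this] show "ms \<in> mtuples G as" by (simp add: mtuples_iff)
qed (auto simp: mtuples_iff intro!: DirProd_list_carrier_memI)

text \<open>\<open>DirProd_list_iso\<close> presents the product over \<open>G # Gs\<close> as the
  image of a binary product under consing, and that map is a homomorphism; so induction peels off
  one factor at a time.\<close>

lemma mult_DirProd_list:
  assumes "length xs = length Gs" "length ys = length Gs"
    and "\<And>i. i < length Gs \<Longrightarrow> xs ! i \<in> carrier (Gs ! i) \<and> ys ! i \<in> carrier (Gs ! i)"
  shows "xs \<otimes>\<^bsub>DirProd_list Gs\<^esub> ys = map (\<lambda>i. xs ! i \<otimes>\<^bsub>Gs ! i\<^esub> ys ! i) [0..<length Gs]"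
  using assms
proof (induction Gs arbitrary: xs ys)
  case Nil
  then show ?case by (simp add: DirProd_list_def)
next
  case (Cons G Gs)
  then obtain x xs' y ys' where xy: "xs = x # xs'" "ys = y # ys'"
    by (metis length_Suc_conv)
  have len: "length xs' = length Gs" "length ys' = length Gs" using Cons.prems xy by auto
  have mem: "xs' ! i \<in> carrier (Gs ! i) \<and> ys' ! i \<in> carrier (Gs ! i)" if "i < length Gs" for i
    using Cons.prems(3)[of "Suc i"] that xy by simp
  have h: "(\<lambda>(g, gs). g # gs) \<in> hom (G \<times>\<times> DirProd_list Gs) (DirProd_list (G # Gs))"
    using DirProd_list_iso by (rule Group.iso_imp_homomorphism)
  have car: "(x, xs') \<in> carrier (G \<times>\<times> DirProd_list Gs)" "(y, ys') \<in> carrier (G \<times>\<times> DirProd_list Gs)"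
    using Cons.prems(3)[of 0] xy len mem by (auto intro!: DirProd_list_carrier_memI)
  have IH: "xs' \<otimes>\<^bsub>DirProd_list Gs\<^esub> ys' = map (\<lambda>i. xs' ! i \<otimes>\<^bsub>Gs ! i\<^esub> ys' ! i) [0..<length Gs]"
    by (rule Cons.IH) (use len mem in auto)
  have "xs \<otimes>\<^bsub>DirProd_list (G # Gs)\<^esub> ys = (x \<otimes>\<^bsub>G\<^esub> y) # (xs' \<otimes>\<^bsub>DirProd_list Gs\<^esub> ys')"
    using hom_mult[OF h car] xy by simp
  also have "\<dots> = map (\<lambda>i. xs ! i \<otimes>\<^bsub>(G # Gs) ! i\<^esub> ys ! i) [0..<length (G # Gs)]"
    unfolding IH using xy
    by (simp add: upt_conv_Cons map_Suc_upt[symmetric] comp_def del: upt_Suc)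
  finally show ?case .
qed

text \<open>The form in which the homomorphism clause of \<open>is_amodule\<close> is both exploited
  and verified, so that later arguments need not touch the group structure of the list product
  itself.\<close>

lemma hom_DirProd_list_iff:
  "h \<in> hom (DirProd_list (map G as)) H \<longleftrightarrow>
     (\<forall>ms \<in> mtuples G as. h ms \<in> carrier H) \<and>
     (\<forall>ms \<in> mtuples G as. \<forall>ns \<in> mtuples G as.
        h (map (\<lambda>i. ms ! i \<otimes>\<^bsub>G (as ! i)\<^esub> ns ! i) [0..<length as]) = h ms \<otimes>\<^bsub>H\<^esub> h ns)"
proof -
  have "ms \<otimes>\<^bsub>DirProd_list (map G as)\<^esub> ns = map (\<lambda>i. ms ! i \<otimes>\<^bsub>G (as ! i)\<^esub> ns ! i) [0..<length as]"
    if "ms \<in> mtuples G as" "ns \<in> mtuples G as" for ms ns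
    using that by (subst mult_DirProd_list) (auto simp: mtuples_iff)
  then show ?thesis
    unfolding hom_def carrier_DirProd_list by (auto simp: Pi_iff)
qed

lemma restrict_hom:
  assumes "monoid G" "h \<in> hom G H"
  shows "restrict h (carrier G) \<in> hom G H"
  using assms by (auto simp: hom_def Pi_iff monoid.m_closed)

lemma hom_finprod:
  assumes "comm_group G" "comm_group H" "h \<in> hom G H" "finite I" "f \<in> I \<rightarrow> carrier G"
  shows "h (finprod G f I) = finprod H (\<lambda>i. h (f i)) I"
  using assms(4,5)
proof (induction I)
  interpret G: comm_group G by fact
  interpret H: comm_group H by fact
  case empty
  then show ?case using hom_one[OF assms(3)] G.is_group H.is_group by simp
next
  interpret G: comm_group G by fact
  interpret H: comm_group H by fact
  case (insert i I)
  have "(\<lambda>i. h (f i)) \<in> insert i I \<rightarrow> carrier H"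
    using insert.prems hom_in_carrier[OF assms(3)] by auto
  then show ?case
    using insert hom_mult[OF assms(3), of "f i" "finprod G f I"] by (simp add: Pi_iff)
qed

text \<open>Operations of the free module and of \<open>H_obj\<close> are sums of one homomorphism
  per slot. Commutativity of \<open>H\<close> lets the product of two such sums be regrouped slot by
  slot.\<close>

lemma finprod_hom_DirProd_list:
  fixes G :: "'a \<Rightarrow> 'm monoid"
  assumes H: "comm_group H" and f: "\<And>i. i < length as \<Longrightarrow> f i \<in> hom (G (as ! i)) H"
  shows "(\<lambda>ms. finprod H (\<lambda>i. f i (ms ! i)) {..<length as}) \<in> hom (DirProd_list (map G as)) H"
proof -
  interpret H: comm_group H by fact
  have c: "(\<lambda>i. f i (ms ! i)) \<in> {..<length as} \<rightarrow> carrier H" if "ms \<in> mtuples G as" for ms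
    using that by (auto simp: mtuples_iff intro: hom_in_carrier[OF f])
  have "finprod H (\<lambda>i. f i (map (\<lambda>i. ms ! i \<otimes>\<^bsub>G (as ! i)\<^esub> ns ! i) [0..<length as] ! i)) {..<length as}
      = finprod H (\<lambda>i. f i (ms ! i) \<otimes>\<^bsub>H\<^esub> f i (ns ! i)) {..<length as}"
    if "ms \<in> mtuples G as" "ns \<in> mtuples G as" for ms ns
    using that c[OF that(1)] c[OF that(2)] f
    by (intro H.finprod_cong') (auto simp: mtuples_iff Pi_iff hom_mult)
  then show ?thesis
    unfolding hom_DirProd_list_iff using c by (auto intro!: H.finprod_closed)
qed

section \<open>Homomorphisms determined on generators\<close>

lemma equalizer_subgroup:
  assumes "group G" "group H" "f \<in> hom G H" "g \<in> hom G H"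
  shows "subgroup {x \<in> carrier G. f x = g x} G"
proof -
  interpret G: group G by fact
  interpret f: group_hom G H f using assms by (simp add: group_hom_def group_hom_axioms_def)
  interpret g: group_hom G H g using assms by (simp add: group_hom_def group_hom_axioms_def)
  show ?thesis by (rule G.subgroupI) (auto intro: exI[of _ "\<one>\<^bsub>G\<^esub>"])
qed

text \<open>The equalizer of \<open>f\<close> and \<open>g\<close> is a subgroup containing
  \<open>S\<close>, hence contains all that \<open>S\<close> generates. It serves for the uniqueness
  of \<open>theta\<close>, for maps out of free groups, and for identities tested on a generating
  set.\<close>

lemma hom_eq_on_generate:
  assumes "group G" "group H" "f \<in> hom G H" "g \<in> hom G H" "S \<subseteq> carrier G"
    and "\<And>x. x \<in> S \<Longrightarrow> f x = g x" "x \<in> generate G S"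
  shows "f x = g x"
proof -
  have "generate G S \<subseteq> {x \<in> carrier G. f x = g x}"
    using assms by (intro group.generate_subgroup_incl equalizer_subgroup) auto
  then show ?thesis using assms(7) by blast
qed

text \<open>\<open>free_Abelian_group_induct\<close> builds every element from zero and basis
  elements by differences, and a subgroup is closed under \<open>x \<otimes> inv y\<close>.\<close>

lemma generate_free_Abelian_group: "generate (free_Abelian_group S) (frag_of ` S) = carrier (free_Abelian_group S)"
    (is "generate ?F _ = _")
proof
  interpret group ?F by simp
  show "generate ?F (frag_of ` S) \<subseteq> carrier ?F" by (rule generate_incl) auto
  have sg: "subgroup (generate ?F (frag_of ` S)) ?F" by (rule generate_is_subgroup) auto
  show "carrier ?F \<subseteq> generate ?F (frag_of ` S)"
  proof
    fix c assume "c \<in> carrier ?F"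
    then have "Poly_Mapping.keys c \<subseteq> S" by simp
    then show "c \<in> generate ?F (frag_of ` S)"
    proof (rule free_Abelian_group_induct)
      fix x y assume *: "Poly_Mapping.keys x \<subseteq> S" "Poly_Mapping.keys y \<subseteq> S"
        "x \<in> generate ?F (frag_of ` S)" "y \<in> generate ?F (frag_of ` S)"
      then have "x \<otimes>\<^bsub>?F\<^esub> inv\<^bsub>?F\<^esub> y \<in> generate ?F (frag_of ` S)"
        using sg by (intro subgroup.m_closed subgroup.m_inv_closed)
      then show "x - y \<in> generate ?F (frag_of ` S)" using * by simp
    qed (use subgroup.one_closed[OF sg] in \<open>auto intro: generate.incl\<close>)
  qed
qed


section \<open>Modules coordinate by coordinate\<close>

lemma op_argsD:
  assumes "(w, as) \<in> op_args V A"
  shows "w \<in> symbols V (length as)" "set as \<subseteq> carrier A" "i < length as \<Longrightarrow> as ! i \<in> carrier A"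
  using assms by (auto simp: op_args_def)

lemma alg_hom_op: "h \<in> alg_hom V A B \<Longrightarrow> (w, as) \<in> op_args V A \<Longrightarrow> h (opn A w as) = opn B w (map h as)"
  by (auto simp: alg_hom_def)

lemma alg_hom_carrier: "h \<in> alg_hom V A B \<Longrightarrow> a \<in> carrier A \<Longrightarrow> h a \<in> carrier B"
  by (auto simp: alg_hom_def)

text \<open>\<open>alg_hom\<close> demands extensional functions, hence the restriction in the
  conclusion; closure of \<open>A\<close> under its operations ensures that restricting does not
  change the value at \<open>opn A w as\<close>.\<close>

lemma alg_homI:
  assumes "\<And>a. a \<in> carrier A \<Longrightarrow> h a \<in> carrier B" "is_algebra V A"
    and "\<And>w as. (w, as) \<in> op_args V A \<Longrightarrow> h (opn A w as) = opn B w (map h as)"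
  shows "restrict h (carrier A) \<in> alg_hom V A B"
  unfolding alg_hom_def
proof (intro CollectI conjI)
  show "\<forall>(w, as) \<in> op_args V A. restrict h (carrier A) (opn A w as) = opn B w (map (restrict h (carrier A)) as)"
  proof clarify
    fix w as assume wa: "(w, as) \<in> op_args V A"
    then have "map (restrict h (carrier A)) as = map h as" by (auto simp: op_args_def)
    moreover have "opn A w as \<in> carrier A" using assms(2) wa by (auto simp: is_algebra_def)
    ultimately show "restrict h (carrier A) (opn A w as) = opn B w (map (restrict h (carrier A)) as)"
      using assms(3)[OF wa] by (simp del: map_eq_conv)
  qed
qed (use assms(1) in auto)

text \<open>The map \<omega>_{a,i} of a module, with slots counted from 0; multiplicative notation
  turns the zeros into \<open>\<one>\<close>.\<close>

definition mop_i :: "('a, 'f, 'm) amod \<Rightarrow> 'f \<Rightarrow> 'a list \<Rightarrow> nat \<Rightarrow> 'm \<Rightarrow> 'm" where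
  "mop_i M w as i m = mop M w as ((map (\<lambda>a. \<one>\<^bsub>grp M a\<^esub>) as)[i := m])"

locale algebra_in_variety =
  fixes V :: "'f variety" and A :: "('a, 'f) alg"
  assumes variety: "is_variety V" and in_variety: "in_variety V A"
begin

lemma algebra: "is_algebra V A"
  using in_variety by (simp add: in_variety_def)

lemma opn_closed: "(w, as) \<in> op_args V A \<Longrightarrow> opn A w as \<in> carrier A"
  using algebra by (auto simp: is_algebra_def)

lemma amodule_group:
  assumes "is_amodule V A M" "a \<in> carrier A"
  shows "comm_group (grp M a)" "group (grp M a)" "comm_monoid (grp M a)" "monoid (grp M a)"
    "\<one>\<^bsub>grp M a\<^esub> \<in> carrier (grp M a)"
proof -
  show G: "comm_group (grp M a)" using assms by (simp add: is_amodule_def)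
  then interpret comm_group "grp M a" .
  show "group (grp M a)" "comm_monoid (grp M a)" "monoid (grp M a)" "\<one>\<^bsub>grp M a\<^esub> \<in> carrier (grp M a)"
    by unfold_locales simp
qed

lemma amodule_hom:
  assumes "is_amodule V A M" "(w, as) \<in> op_args V A"
  shows "mop M w as \<in> hom (DirProd_list (map (grp M) as)) (grp M (opn A w as))"
  using assms unfolding is_amodule_def by fast

lemma mop_closed:
  assumes "is_amodule V A M" "(w, as) \<in> op_args V A" "ms \<in> mtuples (grp M) as"
  shows "mop M w as ms \<in> carrier (grp M (opn A w as))"
  using amodule_hom[OF assms(1,2)] assms(3) by (simp add: hom_DirProd_list_iff)

lemma mop_mult:
  assumes "is_amodule V A M" "(w, as) \<in> op_args V A" "ms \<in> mtuples (grp M) as" "ns \<in> mtuples (grp M) as"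
  shows "mop M w as (map (\<lambda>i. ms ! i \<otimes>\<^bsub>grp M (as ! i)\<^esub> ns ! i) [0..<length as])
    = mop M w as ms \<otimes>\<^bsub>grp M (opn A w as)\<^esub> mop M w as ns"
  using amodule_hom[OF assms(1,2)] assms(3,4) by (simp add: hom_DirProd_list_iff)

lemma mtuples_single:
  assumes "is_amodule V A M" "(w, as) \<in> op_args V A" "i < length as" "m \<in> carrier (grp M (as ! i))"
  shows "(map (\<lambda>a. \<one>\<^bsub>grp M a\<^esub>) as)[i := m] \<in> mtuples (grp M) as"
  using assms amodule_group(5)[OF assms(1)] by (auto simp: mtuples_iff nth_list_update dest: op_argsD)

text \<open>The tuple of zeros is its own double, so its image \<open>x\<close> satisfies
  \<open>x \<otimes> x = x\<close>, and cancellation leaves only the zero.\<close>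

lemma mop_ones:
  assumes M: "is_amodule V A M" and wa: "(w, as) \<in> op_args V A"
  shows "mop M w as (map (\<lambda>a. \<one>\<^bsub>grp M a\<^esub>) as) = \<one>\<^bsub>grp M (opn A w as)\<^esub>"
proof -
  interpret H: comm_group "grp M (opn A w as)" using M opn_closed[OF wa] by (rule amodule_group)
  let ?o = "map (\<lambda>a. \<one>\<^bsub>grp M a\<^esub>) as"
  have o: "?o \<in> mtuples (grp M) as"
    using amodule_group(5)[OF M] wa by (auto simp: mtuples_iff dest: op_argsD)
  have "map (\<lambda>i. ?o ! i \<otimes>\<^bsub>grp M (as ! i)\<^esub> ?o ! i) [0..<length as] = ?o"
    using amodule_group(4,5)[OF M] op_argsD[OF wa] by (auto intro!: nth_equalityI simp: monoid.l_one)
  then have "mop M w as ?o \<otimes>\<^bsub>grp M (opn A w as)\<^esub> mop M w as ?o = mop M w as ?o"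
    using mop_mult[OF M wa o o] by simp
  then show ?thesis using mop_closed[OF M wa o] H.l_cancel_one by blast
qed

lemma mop_i_hom:
  assumes M: "is_amodule V A M" and wa: "(w, as) \<in> op_args V A" and i: "i < length as"
  shows "mop_i M w as i \<in> hom (grp M (as ! i)) (grp M (opn A w as))"
proof (rule homI)
  show "mop_i M w as i m \<in> carrier (grp M (opn A w as))" if "m \<in> carrier (grp M (as ! i))" for m
    unfolding mop_i_def using M wa mtuples_single[OF M wa i that] by (rule mop_closed)
next
  fix m n assume m: "m \<in> carrier (grp M (as ! i))" and n: "n \<in> carrier (grp M (as ! i))"
  let ?o = "\<lambda>m. (map (\<lambda>a. \<one>\<^bsub>grp M a\<^esub>) as)[i := m]"
  have "map (\<lambda>j. ?o m ! j \<otimes>\<^bsub>grp M (as ! j)\<^esub> ?o n ! j) [0..<length as] = ?o (m \<otimes>\<^bsub>grp M (as ! i)\<^esub> n)"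
    using amodule_group(4,5)[OF M] op_argsD[OF wa] i
    by (auto intro!: nth_equalityI simp: monoid.l_one nth_list_update)
  then show "mop_i M w as i (m \<otimes>\<^bsub>grp M (as ! i)\<^esub> n) = mop_i M w as i m \<otimes>\<^bsub>grp M (opn A w as)\<^esub> mop_i M w as i n"
    unfolding mop_i_def using mop_mult[OF M wa mtuples_single[OF M wa i m] mtuples_single[OF M wa i n]]
    by simp
qed

text \<open>A tuple is the sum of its one-entry tuples, and \<open>mop\<close> is additive. Hence
  homomorphisms can be checked one slot at a time, and a module structure can be rebuilt from its
  one-slot maps, as \<open>H_obj\<close> does.\<close>

lemma mop_finprod:
  assumes M: "is_amodule V A M" and wa: "(w, as) \<in> op_args V A" and ms: "ms \<in> mtuples (grp M) as"
  shows "mop M w as ms = finprod (grp M (opn A w as)) (\<lambda>i. mop_i M w as i (ms ! i)) {..<length as}"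
proof -
  interpret H: comm_group "grp M (opn A w as)" using M opn_closed[OF wa] by (rule amodule_group)
  \<comment> \<open>\<open>?t k\<close> keeps the first \<open>k\<close> entries and has zeros after
    them, so it leads from the zero tuple to \<open>ms\<close>; passing from \<open>k\<close> to
    \<open>Suc k\<close> adds the one-entry tuple in slot \<open>k\<close>.\<close>
  let ?t = "\<lambda>k. map (\<lambda>j. if j < k then ms ! j else \<one>\<^bsub>grp M (as ! j)\<^esub>) [0..<length as]"
  have ms_i: "ms ! i \<in> carrier (grp M (as ! i))" if "i < length as" for i
    using ms that by (simp add: mtuples_iff)
  have t: "?t k \<in> mtuples (grp M) as" for k
    using ms_i amodule_group(5)[OF M] op_argsD[OF wa] by (auto simp: mtuples_iff)
  have c: "mop_i M w as i (ms ! i) \<in> carrier (grp M (opn A w as))" if "i < length as" for i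
    using mop_i_hom[OF M wa that] ms_i[OF that] by (rule hom_in_carrier)
  have "mop M w as (?t k) = finprod (grp M (opn A w as)) (\<lambda>i. mop_i M w as i (ms ! i)) {..<k}"
    if "k \<le> length as" for k
    using that
  proof (induction k)
    case 0
    have "?t 0 = map (\<lambda>a. \<one>\<^bsub>grp M a\<^esub>) as" by (auto intro!: nth_equalityI)
    then show ?case using mop_ones[OF M wa] by simp
  next
    case (Suc k)
    let ?s = "(map (\<lambda>a. \<one>\<^bsub>grp M a\<^esub>) as)[k := ms ! k]"
    have s: "?s \<in> mtuples (grp M) as" using Suc.prems ms_i by (intro mtuples_single[OF M wa]) auto
    have "map (\<lambda>j. ?s ! j \<otimes>\<^bsub>grp M (as ! j)\<^esub> ?t k ! j) [0..<length as] = ?t (Suc k)"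
      using Suc.prems amodule_group(4,5)[OF M] op_argsD[OF wa] ms_i
      by (auto intro!: nth_equalityI simp: monoid.l_one monoid.r_one nth_list_update less_Suc_eq)
    then have "mop M w as (?t (Suc k)) = mop_i M w as k (ms ! k) \<otimes>\<^bsub>grp M (opn A w as)\<^esub> mop M w as (?t k)"
      using mop_mult[OF M wa s t[of k]] by (simp only: mop_i_def)
    then show ?case using Suc c by (auto simp: lessThan_Suc Pi_iff)
  qed
  from this[of "length as"] have "mop M w as (?t (length as))
      = finprod (grp M (opn A w as)) (\<lambda>i. mop_i M w as i (ms ! i)) {..<length as}"
    by (simp only: order_refl)
  moreover have "?t (length as) = ms" using ms by (auto simp: mtuples_iff intro!: nth_equalityI)
  ultimately show ?thesis by (simp only: order_refl)
qed

text \<open>If an operation is a sum of homomorphisms \<open>f j\<close>, then on a one-entry tuple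
  every summand with \<open>j \<noteq> i\<close> vanishes, being the image of a zero. This reads off
  the one-slot maps of \<open>fmod\<close> and \<open>H_obj\<close>.\<close>

lemma mop_i_eqI:
  assumes M: "is_amodule V A M" and wa: "(w, as) \<in> op_args V A" and i: "i < length as"
    and f: "\<And>i. i < length as \<Longrightarrow> f i \<in> hom (grp M (as ! i)) (grp M (opn A w as))"
    and mop: "\<And>ms. ms \<in> mtuples (grp M) as \<Longrightarrow>
      mop M w as ms = finprod (grp M (opn A w as)) (\<lambda>i. f i (ms ! i)) {..<length as}"
    and m: "m \<in> carrier (grp M (as ! i))"
  shows "mop_i M w as i m = f i m"
proof -
  interpret H: comm_group "grp M (opn A w as)" using M opn_closed[OF wa] by (rule amodule_group)
  have g: "group (grp M (as ! j))" if "j < length as" for j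
    using amodule_group[OF M] op_argsD[OF wa] that by auto
  have "mop_i M w as i m = finprod (grp M (opn A w as))
     (\<lambda>j. f j ((map (\<lambda>a. \<one>\<^bsub>grp M a\<^esub>) as)[i := m] ! j)) {..<length as}"
    unfolding mop_i_def by (rule mop[OF mtuples_single[OF M wa i m]])
  also have "\<dots> = finprod (grp M (opn A w as)) (\<lambda>j. if j = i then f i m else \<one>\<^bsub>grp M (opn A w as)\<^esub>) {..<length as}"
    using i m f hom_one[OF f g] hom_in_carrier[OF f] H.is_group
    by (intro H.finprod_cong') (auto simp: nth_list_update)
  also have "\<dots> = f i m"
    using i m hom_in_carrier[OF f[OF i]] by (intro H.finprod_singleton_swap) auto
  finally show ?thesis .
qed

section \<open>Homomorphisms of modules\<close>

lemma amod_homD: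
  assumes "\<phi> \<in> amod_hom V A M M'"
  shows "a \<in> carrier A \<Longrightarrow> \<phi> a \<in> hom (grp M a) (grp M' a)"
    "\<phi> \<in> extensional (carrier A)" "a \<in> carrier A \<Longrightarrow> \<phi> a \<in> extensional (carrier (grp M a))"
    "(w, as) \<in> op_args V A \<Longrightarrow> ms \<in> mtuples (grp M) as \<Longrightarrow>
      \<phi> (opn A w as) (mop M w as ms) = mop M' w as (map2 \<phi> as ms)"
  using assms unfolding amod_hom_def grp_fam_hom_def by (auto simp: PiE_iff)

text \<open>Extensionality in the index and in the element excludes arbitrary values elsewhere; this
  is what gives the definite description \<open>theta\<close> literal uniqueness.\<close>

lemma amod_hom_eqI:
  assumes "\<phi> \<in> amod_hom V A M M'" "\<psi> \<in> amod_hom V A M M'"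
    and "\<And>a m. a \<in> carrier A \<Longrightarrow> m \<in> carrier (grp M a) \<Longrightarrow> \<phi> a m = \<psi> a m"
  shows "\<phi> = \<psi>"
  using amod_homD(2)[OF assms(1)] amod_homD(2)[OF assms(2)]
proof (rule extensionalityI)
  fix a assume a: "a \<in> carrier A"
  show "\<phi> a = \<psi> a"
    using amod_homD(3)[OF assms(1) a] amod_homD(3)[OF assms(2) a] assms(3)[OF a] by (rule extensionalityI)
qed

lemma amod_hom_mop_i:
  assumes M: "is_amodule V A M" and M': "is_amodule V A M'" and \<phi>: "\<phi> \<in> amod_hom V A M M'"
    and wa: "(w, as) \<in> op_args V A" and i: "i < length as" and m: "m \<in> carrier (grp M (as ! i))"
  shows "\<phi> (opn A w as) (mop_i M w as i m) = mop_i M' w as i (\<phi> (as ! i) m)"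
proof -
  have "map2 \<phi> as ((map (\<lambda>a. \<one>\<^bsub>grp M a\<^esub>) as)[i := m]) = (map (\<lambda>a. \<one>\<^bsub>grp M' a\<^esub>) as)[i := \<phi> (as ! i) m]"
    using i hom_one[OF amod_homD(1)[OF \<phi>]] amodule_group(2)[OF M] amodule_group(2)[OF M'] op_argsD[OF wa]
    by (auto intro!: nth_equalityI simp: nth_list_update)
  then show ?thesis
    unfolding mop_i_def using amod_homD(4)[OF \<phi> wa mtuples_single[OF M wa i m]] by simp
qed

text \<open>By \<open>mop_finprod\<close> both sides of the homomorphism law are sums over the
  slots, and a group homomorphism commutes with finite sums; so one-entry tuples decide the
  law.\<close>

lemma amod_homI:
  assumes M: "is_amodule V A M" and M': "is_amodule V A M'"
    and ext: "\<phi> \<in> extensional (carrier A)" "\<And>a. a \<in> carrier A \<Longrightarrow> \<phi> a \<in> extensional (carrier (grp M a))"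
    and hom: "\<And>a. a \<in> carrier A \<Longrightarrow> \<phi> a \<in> hom (grp M a) (grp M' a)"
    and op: "\<And>w as i m. (w, as) \<in> op_args V A \<Longrightarrow> i < length as \<Longrightarrow> m \<in> carrier (grp M (as ! i)) \<Longrightarrow>
      \<phi> (opn A w as) (mop_i M w as i m) = mop_i M' w as i (\<phi> (as ! i) m)"
  shows "\<phi> \<in> amod_hom V A M M'"
  unfolding amod_hom_def grp_fam_hom_def
proof (intro CollectI conjI)
  show "\<phi> \<in> (\<Pi>\<^sub>E a \<in> carrier A. hom (grp M a) (grp M' a) \<inter> extensional (carrier (grp M a)))"
    using ext hom by (auto simp: PiE_iff)
  show "\<forall>(w, as) \<in> op_args V A. \<forall>ms \<in> mtuples (grp M) as.
       \<phi> (opn A w as) (mop M w as ms) = mop M' w as (map2 \<phi> as ms)"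
  proof clarify
    fix w as ms assume wa: "(w, as) \<in> op_args V A" and ms: "ms \<in> mtuples (grp M) as"
    have msi: "ms ! i \<in> carrier (grp M (as ! i))" if "i < length as" for i
      using ms that by (simp add: mtuples_iff)
    have phi: "\<phi> (as ! i) (ms ! i) \<in> carrier (grp M' (as ! i))" if "i < length as" for i
      using hom_in_carrier[OF hom msi] op_argsD[OF wa] that by blast
    have len: "length ms = length as" using ms by (simp add: mtuples_iff)
    interpret H: comm_group "grp M' (opn A w as)" using M' opn_closed[OF wa] by (rule amodule_group)
    have "\<phi> (opn A w as) (mop M w as ms)
        = finprod (grp M' (opn A w as)) (\<lambda>i. \<phi> (opn A w as) (mop_i M w as i (ms ! i))) {..<length as}"
      unfolding mop_finprod[OF M wa ms]
      using opn_closed[OF wa] amodule_group[OF M] amodule_group[OF M'] hom hom_in_carrier[OF mop_i_hom[OF M wa]] msi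
      by (intro hom_finprod) auto
    also have "\<dots> = finprod (grp M' (opn A w as)) (\<lambda>i. mop_i M' w as i (map2 \<phi> as ms ! i)) {..<length as}"
      using op[OF wa _ msi] len hom_in_carrier[OF mop_i_hom[OF M' wa]] phi by (intro H.finprod_cong') auto
    also have "\<dots> = mop M' w as (map2 \<phi> as ms)"
      using phi len by (intro mop_finprod[OF M' wa, symmetric]) (auto simp: mtuples_iff)
    finally show "\<phi> (opn A w as) (mop M w as ms) = mop M' w as (map2 \<phi> as ms)" .
  qed
qed

lemma amod_hom_compose:
  assumes M: "is_amodule V A M" and M': "is_amodule V A M'" and M'': "is_amodule V A M''"
    and \<phi>: "\<phi> \<in> amod_hom V A M M'" and \<psi>: "\<psi> \<in> amod_hom V A M' M''"
  shows "(\<lambda>a \<in> carrier A. compose (carrier (grp M a)) (\<psi> a) (\<phi> a)) \<in> amod_hom V A M M''"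
proof (rule amod_homI[OF M M''])
  fix a assume a: "a \<in> carrier A"
  note h = amod_homD(1)[OF \<phi> a] amod_homD(1)[OF \<psi> a]
  show "(\<lambda>a \<in> carrier A. compose (carrier (grp M a)) (\<psi> a) (\<phi> a)) a \<in> hom (grp M a) (grp M'' a)"
    using a h amodule_group(2)[OF M a]
    by (intro homI) (auto simp: compose_def hom_in_carrier hom_mult group.is_monoid monoid.m_closed)
next
  fix w as i m assume *: "(w, as) \<in> op_args V A" "i < length as" "m \<in> carrier (grp M (as ! i))"
  note a = op_argsD(3)[OF *(1,2)] opn_closed[OF *(1)]
  have m: "mop_i M w as i m \<in> carrier (grp M (opn A w as))"
    "\<phi> (as ! i) m \<in> carrier (grp M' (as ! i))"
    using hom_in_carrier[OF mop_i_hom[OF M *(1,2)] *(3)] hom_in_carrier[OF amod_homD(1)[OF \<phi> a(1)] *(3)] .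
  show "(\<lambda>a \<in> carrier A. compose (carrier (grp M a)) (\<psi> a) (\<phi> a)) (opn A w as) (mop_i M w as i m)
      = mop_i M'' w as i ((\<lambda>a \<in> carrier A. compose (carrier (grp M a)) (\<psi> a) (\<phi> a)) (as ! i) m)"
    using a m * amod_hom_mop_i[OF M M' \<phi> *] amod_hom_mop_i[OF M' M'' \<psi> *(1,2) m(2)]
    by (simp add: compose_eq)
qed (auto simp: compose_def)

lemma amod_hom_id:
  assumes M: "is_amodule V A M"
  shows "(\<lambda>a \<in> carrier A. \<lambda>m \<in> carrier (grp M a). m) \<in> amod_hom V A M M"
proof (rule amod_homI[OF M M])
  fix a assume a: "a \<in> carrier A"
  then show "(\<lambda>a \<in> carrier A. \<lambda>m \<in> carrier (grp M a). m) a \<in> hom (grp M a) (grp M a)"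
    using amodule_group(4)[OF M a] by (auto intro!: homI monoid.m_closed)
qed (auto simp: op_argsD opn_closed hom_in_carrier[OF mop_i_hom[OF M]])

text \<open>The sum is again additive because the groups of \<open>M'\<close> commute, and it
  respects the operations because \<open>mop_i\<close> is additive. Its purpose is the additivity of
  z m in m, through a sum of two \<open>theta\<close>.\<close>

lemma amod_hom_mult:
  assumes M: "is_amodule V A M" and M': "is_amodule V A M'"
    and \<phi>: "\<phi> \<in> amod_hom V A M M'" and \<psi>: "\<psi> \<in> amod_hom V A M M'"
  shows "(\<lambda>a \<in> carrier A. \<lambda>m \<in> carrier (grp M a). \<phi> a m \<otimes>\<^bsub>grp M' a\<^esub> \<psi> a m) \<in> amod_hom V A M M'"
proof (rule amod_homI[OF M M'])
  fix a assume a: "a \<in> carrier A"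
  note h = amod_homD(1)[OF \<phi> a] amod_homD(1)[OF \<psi> a]
  interpret G: comm_group "grp M a" using M a by (rule amodule_group)
  interpret H: comm_group "grp M' a" using M' a by (rule amodule_group)
  show "(\<lambda>a \<in> carrier A. \<lambda>m \<in> carrier (grp M a). \<phi> a m \<otimes>\<^bsub>grp M' a\<^esub> \<psi> a m) a \<in> hom (grp M a) (grp M' a)"
    using a h by (intro homI) (auto simp: hom_in_carrier hom_mult H.m_ac)
next
  fix w as i m assume *: "(w, as) \<in> op_args V A" "i < length as" "m \<in> carrier (grp M (as ! i))"
  note a = op_argsD(3)[OF *(1,2)] opn_closed[OF *(1)]
  show "(\<lambda>a \<in> carrier A. \<lambda>m \<in> carrier (grp M a). \<phi> a m \<otimes>\<^bsub>grp M' a\<^esub> \<psi> a m) (opn A w as) (mop_i M w as i m)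
    = mop_i M' w as i ((\<lambda>a \<in> carrier A. \<lambda>m \<in> carrier (grp M a). \<phi> a m \<otimes>\<^bsub>grp M' a\<^esub> \<psi> a m) (as ! i) m)"
    using a * amod_hom_mop_i[OF M M' \<phi> *] amod_hom_mop_i[OF M M' \<psi> *]
      hom_in_carrier[OF amod_homD(1)[OF \<phi> a(1)] *(3)] hom_in_carrier[OF amod_homD(1)[OF \<psi> a(1)] *(3)]
    by (simp add: hom_in_carrier[OF mop_i_hom[OF M]] hom_mult[OF mop_i_hom[OF M']])
qed auto

end


section \<open>Quotient modules\<close>

lemma generate_FactGroup:
  assumes "comm_group G" "subgroup N G" "T \<subseteq> carrier G" "generate G T = carrier G"
  shows "generate (G Mod N) ((\<lambda>x. N #>\<^bsub>G\<^esub> x) ` T) = carrier (G Mod N)"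
proof -
  interpret G: comm_group G by fact
  interpret normal N G using assms(2) by (rule G.subgroup_imp_normal)
  interpret group_hom G "G Mod N" "\<lambda>x. N #>\<^bsub>G\<^esub> x"
    using r_coset_hom_Mod factorgroup_is_group G.is_group by (simp add: group_hom_def group_hom_axioms_def)
  show ?thesis using generate_img[OF assms(3)] assms(4) by (simp add: carrier_FactGroup)
qed

context algebra_in_variety
begin

lemma quot_amod_simps: "grp (quot_amod V A M S) = (\<lambda>a. grp M a Mod S a)"
  by (simp add: quot_amod_def)

context
  fixes M :: "('a, 'f, 'm) amod" and S :: "'a \<Rightarrow> 'm set"
  assumes M: "is_amodule V A M" and S: "is_submodule V A M S"
begin

lemma submodule_subgroup: "a \<in> carrier A \<Longrightarrow> subgroup (S a) (grp M a)"
  using S by (simp add: is_submodule_def)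

lemma submodule_normal: "a \<in> carrier A \<Longrightarrow> S a \<lhd> grp M a"
  using submodule_subgroup amodule_group(1)[OF M] by (simp add: comm_group.subgroup_imp_normal)

lemma mtuples_cosets:
  assumes "set as \<subseteq> carrier A" "ms \<in> mtuples (grp M) as"
  shows "map (\<lambda>i. S (as ! i) #>\<^bsub>grp M (as ! i)\<^esub> ms ! i) [0..<length as] \<in> mtuples (\<lambda>a. grp M a Mod S a) as"
  using assms by (auto simp: mtuples_iff carrier_FactGroup)

lemma mtuples_cosetsE:
  assumes "Cs \<in> mtuples (\<lambda>a. grp M a Mod S a) as"
  obtains ms where "ms \<in> mtuples (grp M) as"
    "Cs = map (\<lambda>i. S (as ! i) #>\<^bsub>grp M (as ! i)\<^esub> ms ! i) [0..<length as]"
proof -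
  have "\<forall>i. \<exists>m. i < length as \<longrightarrow> m \<in> carrier (grp M (as ! i)) \<and> Cs ! i = S (as ! i) #>\<^bsub>grp M (as ! i)\<^esub> m"
    using assms by (auto simp: mtuples_iff carrier_FactGroup)
  then obtain f where "\<And>i. i < length as \<Longrightarrow> f i \<in> carrier (grp M (as ! i)) \<and> Cs ! i = S (as ! i) #>\<^bsub>grp M (as ! i)\<^esub> f i"
    by metis
  then have "map f [0..<length as] \<in> mtuples (grp M) as"
    "Cs = map (\<lambda>i. S (as ! i) #>\<^bsub>grp M (as ! i)\<^esub> map f [0..<length as] ! i) [0..<length as]"
    using assms by (auto simp: mtuples_iff intro!: nth_equalityI)
  then show ?thesis by (rule that)
qed

text \<open>Another choice of representatives has the form s + m with s taken from \<open>S\<close>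
  in every slot. Then \<omega>(s + m) = \<omega>(s) + \<omega>(m) with \<omega>(s) in
  \<open>S\<close>, so all sets in the union defining the quotient operation are the same
  coset.\<close>

lemma mop_quot_amod:
  assumes wa: "(w, as) \<in> op_args V A" and ms: "ms \<in> mtuples (grp M) as"
  shows "mop (quot_amod V A M S) w as (map (\<lambda>i. S (as ! i) #>\<^bsub>grp M (as ! i)\<^esub> ms ! i) [0..<length as])
    = S (opn A w as) #>\<^bsub>grp M (opn A w as)\<^esub> mop M w as ms"
    (is "mop _ w as ?Cs = ?S #>\<^bsub>?G\<^esub> _")
proof -
  note a = op_argsD[OF wa] opn_closed[OF wa]
  interpret G: comm_group ?G using M a(4) by (rule amodule_group)
  have msi: "ms ! i \<in> carrier (grp M (as ! i))" if "i < length as" for i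
    using ms that by (simp add: mtuples_iff)
  have "ms \<in> listset ?Cs"
    unfolding listset_iff list_all2_conv_all_nth
    using ms a amodule_group(2)[OF M] msi submodule_subgroup
    by (auto simp: mtuples_iff intro!: group.rcos_self)
  moreover have "?S #>\<^bsub>?G\<^esub> mop M w as ns = ?S #>\<^bsub>?G\<^esub> mop M w as ms" if ns: "ns \<in> listset ?Cs" for ns
  proof -
    have len: "length ns = length as" and nsi: "\<And>i. i < length as \<Longrightarrow> ns ! i \<in> S (as ! i) #>\<^bsub>grp M (as ! i)\<^esub> ms ! i"
      using ns by (auto simp: listset_iff list_all2_conv_all_nth)
    have "\<forall>i. \<exists>s. i < length as \<longrightarrow> s \<in> S (as ! i) \<and> ns ! i = s \<otimes>\<^bsub>grp M (as ! i)\<^esub> ms ! i"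
      using nsi by (auto simp: r_coset_def)
    then obtain s where s: "\<And>i. i < length as \<Longrightarrow> s i \<in> S (as ! i)"
      "\<And>i. i < length as \<Longrightarrow> ns ! i = s i \<otimes>\<^bsub>grp M (as ! i)\<^esub> ms ! i"
      by metis
    let ?s = "map s [0..<length as]"
    have sS: "?s \<in> tuples S as" using s by (simp add: tuples_iff)
    have sM: "?s \<in> mtuples (grp M) as"
      using s(1) a(3) subgroup.mem_carrier[OF submodule_subgroup] by (auto simp: mtuples_iff)
    have "ns = map (\<lambda>i. ?s ! i \<otimes>\<^bsub>grp M (as ! i)\<^esub> ms ! i) [0..<length as]"
      using s(2) len by (auto intro!: nth_equalityI)
    then have eq: "mop M w as ns = mop M w as ?s \<otimes>\<^bsub>?G\<^esub> mop M w as ms"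
      using mop_mult[OF M wa sM ms] by simp
    have "mop M w as ?s \<in> ?S" using S wa sS unfolding is_submodule_def by fast
    then have "mop M w as ns \<in> ?S #>\<^bsub>?G\<^esub> mop M w as ms"
      unfolding eq r_coset_def by blast
    from G.repr_independence[OF this mop_closed[OF M wa ms] submodule_subgroup[OF a(4)]]
    show ?thesis by simp
  qed
  ultimately have "(\<Union>ns \<in> listset ?Cs. ?S #>\<^bsub>?G\<^esub> mop M w as ns) = ?S #>\<^bsub>?G\<^esub> mop M w as ms"
    by (intro SUP_eq_const) blast+
  then show ?thesis
    using wa mtuples_cosets[OF a(2) ms] unfolding quot_amod_def by (simp only: amod.simps if_True simp_thms)
qed

text \<open>Every tuple of cosets has a tuple of representatives, so additivity is inherited from
  \<open>M\<close> through \<open>mop_quot_amod\<close>.\<close>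

lemma quot_amod_amodule: "is_amodule V A (quot_amod V A M S)"
  unfolding is_amodule_def quot_amod_simps
proof (intro conjI)
  show "\<forall>a \<in> carrier A. comm_group (grp M a Mod S a)"
    using comm_group.abelian_FactGroup amodule_group(1)[OF M] submodule_subgroup by blast
  show "\<forall>(w, as) \<in> op_args V A. mop (quot_amod V A M S) w as
      \<in> hom (DirProd_list (map (\<lambda>a. grp M a Mod S a) as)) (grp M (opn A w as) Mod S (opn A w as))"
  proof clarify
    fix w as assume wa: "(w, as) \<in> op_args V A"
    note a = op_argsD[OF wa] opn_closed[OF wa]
    let ?q = "\<lambda>ms. map (\<lambda>i. S (as ! i) #>\<^bsub>grp M (as ! i)\<^esub> ms ! i) [0..<length as]"
    show "mop (quot_amod V A M S) w as
      \<in> hom (DirProd_list (map (\<lambda>a. grp M a Mod S a) as)) (grp M (opn A w as) Mod S (opn A w as))"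
      unfolding hom_DirProd_list_iff
    proof (intro conjI ballI)
      fix Cs assume "Cs \<in> mtuples (\<lambda>a. grp M a Mod S a) as"
      then obtain ms where ms: "ms \<in> mtuples (grp M) as" "Cs = ?q ms" by (rule mtuples_cosetsE)
      then show "mop (quot_amod V A M S) w as Cs \<in> carrier (grp M (opn A w as) Mod S (opn A w as))"
        using mop_quot_amod[OF wa ms(1)] mop_closed[OF M wa ms(1)] by (auto simp: carrier_FactGroup)
      fix Ds assume "Ds \<in> mtuples (\<lambda>a. grp M a Mod S a) as"
      then obtain ns where ns: "ns \<in> mtuples (grp M) as" "Ds = ?q ns" by (rule mtuples_cosetsE)
      let ?p = "map (\<lambda>i. ms ! i \<otimes>\<^bsub>grp M (as ! i)\<^esub> ns ! i) [0..<length as]"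
      have p: "?p \<in> mtuples (grp M) as"
        using ms ns a amodule_group(4)[OF M] by (auto simp: mtuples_iff intro!: monoid.m_closed)
      have "map (\<lambda>i. Cs ! i \<otimes>\<^bsub>grp M (as ! i) Mod S (as ! i)\<^esub> Ds ! i) [0..<length as] = ?q ?p"
        using ms ns a normal.rcos_sum[OF submodule_normal] by (auto simp: mtuples_iff)
      then have "mop (quot_amod V A M S) w as
          (map (\<lambda>i. Cs ! i \<otimes>\<^bsub>grp M (as ! i) Mod S (as ! i)\<^esub> Ds ! i) [0..<length as])
        = S (opn A w as) #>\<^bsub>grp M (opn A w as)\<^esub> (mop M w as ms \<otimes>\<^bsub>grp M (opn A w as)\<^esub> mop M w as ns)"
        using mop_quot_amod[OF wa p] mop_mult[OF M wa ms(1) ns(1)] by (simp only:)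
      then show "mop (quot_amod V A M S) w as
          (map (\<lambda>i. Cs ! i \<otimes>\<^bsub>grp M (as ! i) Mod S (as ! i)\<^esub> Ds ! i) [0..<length as])
        = mop (quot_amod V A M S) w as Cs \<otimes>\<^bsub>grp M (opn A w as) Mod S (opn A w as)\<^esub> mop (quot_amod V A M S) w as Ds"
        using mop_quot_amod[OF wa ms(1)] mop_quot_amod[OF wa ns(1)] ms(2) ns(2) normal.rcos_sum[OF submodule_normal[OF a(4)]]
          mop_closed[OF M wa ms(1)] mop_closed[OF M wa ns(1)]
        by simp
    qed
  qed
qed (auto simp: quot_amod_def)

lemma quot_amod_proj:
  "(\<lambda>a \<in> carrier A. \<lambda>m \<in> carrier (grp M a). S a #>\<^bsub>grp M a\<^esub> m) \<in> amod_hom V A M (quot_amod V A M S)"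
    (is "?\<pi> \<in> _")
  unfolding amod_hom_def grp_fam_hom_def
proof (intro CollectI conjI)
  have "restrict (\<lambda>m. S a #>\<^bsub>grp M a\<^esub> m) (carrier (grp M a)) \<in> hom (grp M a) (grp M a Mod S a)"
    if "a \<in> carrier A" for a
    using normal.r_coset_hom_Mod[OF submodule_normal[OF that]] amodule_group(4)[OF M that]
    by (rule restrict_hom[rotated])
  then show "?\<pi> \<in> (\<Pi>\<^sub>E a \<in> carrier A. hom (grp M a) (grp (quot_amod V A M S) a) \<inter> extensional (carrier (grp M a)))"
    by (auto simp: quot_amod_simps)
  show "\<forall>(w, as) \<in> op_args V A. \<forall>ms \<in> mtuples (grp M) as.
      ?\<pi> (opn A w as) (mop M w as ms) = mop (quot_amod V A M S) w as (map2 ?\<pi> as ms)"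
  proof clarify
    fix w as ms assume wa: "(w, as) \<in> op_args V A" and ms: "ms \<in> mtuples (grp M) as"
    have "map2 ?\<pi> as ms = map (\<lambda>i. S (as ! i) #>\<^bsub>grp M (as ! i)\<^esub> ms ! i) [0..<length as]"
      using ms op_argsD[OF wa] by (auto intro!: nth_equalityI simp: mtuples_iff)
    then show "?\<pi> (opn A w as) (mop M w as ms) = mop (quot_amod V A M S) w as (map2 ?\<pi> as ms)"
      using mop_quot_amod[OF wa ms] opn_closed[OF wa] mop_closed[OF M wa ms] by simp
  qed
qed

text \<open>Elements of one coset differ by an element that \<open>\<phi> a\<close> kills, so each
  \<open>\<phi> a\<close> factors as a group homomorphism. Compatibility with the operations is
  inherited because every coset has a representative in \<open>M\<close>, where
  \<open>\<phi>\<close> respects them.\<close>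

lemma quot_amod_universal:
  assumes M': "is_amodule V A M'" and \<phi>: "\<phi> \<in> amod_hom V A M M'"
    and ker: "\<And>a s. a \<in> carrier A \<Longrightarrow> s \<in> S a \<Longrightarrow> \<phi> a s = \<one>\<^bsub>grp M' a\<^esub>"
  shows "\<exists>\<psi> \<in> amod_hom V A (quot_amod V A M S) M'.
    \<forall>a \<in> carrier A. \<forall>m \<in> carrier (grp M a). \<psi> a (S a #>\<^bsub>grp M a\<^esub> m) = \<phi> a m"
proof -
  have "\<exists>g. g \<in> hom (grp M a Mod S a) (grp M' a) \<and> (\<forall>m \<in> carrier (grp M a). g (S a #>\<^bsub>grp M a\<^esub> m) = \<phi> a m)"
    if a: "a \<in> carrier A" for a
  proof -
    interpret G: comm_group "grp M a" using M a by (rule amodule_group)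
    interpret H: comm_group "grp M' a" using M' a by (rule amodule_group)
    note h = amod_homD(1)[OF \<phi> a]
    have "\<phi> a x = \<phi> a y"
      if "x \<in> carrier (grp M a)" "y \<in> carrier (grp M a)" "S a #>\<^bsub>grp M a\<^esub> x = S a #>\<^bsub>grp M a\<^esub> y" for x y
    proof -
      have "x \<in> S a #>\<^bsub>grp M a\<^esub> y"
        using that G.rcos_self[OF _ submodule_subgroup[OF a], of x] by metis
      then obtain s where s: "s \<in> S a" "x = s \<otimes>\<^bsub>grp M a\<^esub> y" by (auto simp: r_coset_def)
      then show ?thesis
        using that ker[OF a s(1)] subgroup.mem_carrier[OF submodule_subgroup[OF a] s(1)]
        by (simp add: hom_mult[OF h] hom_in_carrier[OF h])
    qed
    then obtain g where "g \<in> hom (grp M a Mod S a) (grp M' a)"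
      "\<And>x. x \<in> carrier (grp M a) \<Longrightarrow> g (S a #>\<^bsub>grp M a\<^esub> x) = \<phi> a x"
      using FactGroup_universal[OF h submodule_normal[OF a]] by metis
    then show ?thesis by blast
  qed
  then obtain g where g: "\<And>a. a \<in> carrier A \<Longrightarrow> g a \<in> hom (grp M a Mod S a) (grp M' a)"
    "\<And>a m. a \<in> carrier A \<Longrightarrow> m \<in> carrier (grp M a) \<Longrightarrow> g a (S a #>\<^bsub>grp M a\<^esub> m) = \<phi> a m"
    by metis
  let ?Q = "quot_amod V A M S"
  let ?\<psi> = "\<lambda>a \<in> carrier A. \<lambda>C \<in> carrier (grp ?Q a). g a C"
  have "?\<psi> \<in> amod_hom V A ?Q M'"
  proof (rule amod_homI[OF quot_amod_amodule M'])
    fix a assume a: "a \<in> carrier A"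
    show "?\<psi> a \<in> hom (grp ?Q a) (grp M' a)"
      using a g(1)[OF a] restrict_hom[OF amodule_group(4)[OF quot_amod_amodule a]]
      by (simp add: quot_amod_simps)
  next
    fix w as i C assume *: "(w, as) \<in> op_args V A" "i < length as" "C \<in> carrier (grp ?Q (as ! i))"
    note a = op_argsD(3)[OF *(1,2)] opn_closed[OF *(1)]
    obtain m where m: "m \<in> carrier (grp M (as ! i))" "C = S (as ! i) #>\<^bsub>grp M (as ! i)\<^esub> m"
      using *(3) by (auto simp: quot_amod_simps carrier_FactGroup)
    have m': "mop_i M w as i m \<in> carrier (grp M (opn A w as))"
      using mop_i_hom[OF M *(1,2)] m(1) by (rule hom_in_carrier)
    \<comment> \<open>The projection is itself a homomorphism of modules, which computes the
      one-slot map of the quotient on a representative.\<close>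
    have "mop_i ?Q w as i C = S (opn A w as) #>\<^bsub>grp M (opn A w as)\<^esub> mop_i M w as i m"
      using amod_hom_mop_i[OF M quot_amod_amodule quot_amod_proj *(1,2) m(1)] a m m' by simp
    then show "?\<psi> (opn A w as) (mop_i ?Q w as i C) = mop_i M' w as i (?\<psi> (as ! i) C)"
      using a m m' g(2) *(3) amod_hom_mop_i[OF M M' \<phi> *(1,2) m(1)]
        hom_in_carrier[OF mop_i_hom[OF quot_amod_amodule *(1,2)] *(3)] by simp
  qed auto
  moreover have "\<forall>a \<in> carrier A. \<forall>m \<in> carrier (grp M a). ?\<psi> a (S a #>\<^bsub>grp M a\<^esub> m) = \<phi> a m"
    using g(2) by (simp add: quot_amod_simps carrier_FactGroup)
  ultimately show ?thesis by blast
qed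

end

text \<open>Serves to show that a homomorphism kills \<open>modz_ker\<close>: once its kernel
  contains the prescribed relations, it is one of the submodules whose intersection defines
  \<open>modz_ker\<close>.\<close>

lemma amod_hom_kernel:
  assumes M: "is_amodule V A M" and M': "is_amodule V A M'" and \<phi>: "\<phi> \<in> amod_hom V A M M'"
  shows "is_submodule V A M (\<lambda>a. {m \<in> carrier (grp M a). \<phi> a m = \<one>\<^bsub>grp M' a\<^esub>})"
  unfolding is_submodule_def
proof (intro conjI)
  show "\<forall>a \<in> carrier A. subgroup {m \<in> carrier (grp M a). \<phi> a m = \<one>\<^bsub>grp M' a\<^esub>} (grp M a)"
  proof
    fix a assume a: "a \<in> carrier A"
    have "(\<lambda>_. \<one>\<^bsub>grp M' a\<^esub>) \<in> hom (grp M a) (grp M' a)"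
      using amodule_group(4)[OF M' a] by (intro homI) (auto simp: monoid.l_one)
    then show "subgroup {m \<in> carrier (grp M a). \<phi> a m = \<one>\<^bsub>grp M' a\<^esub>} (grp M a)"
      using equalizer_subgroup amodule_group(2)[OF M a] amodule_group(2)[OF M' a] amod_homD(1)[OF \<phi> a] by blast
  qed
  show "\<forall>(w, as) \<in> op_args V A. \<forall>ms \<in> tuples (\<lambda>a. {m \<in> carrier (grp M a). \<phi> a m = \<one>\<^bsub>grp M' a\<^esub>}) as.
      mop M w as ms \<in> {m \<in> carrier (grp M (opn A w as)). \<phi> (opn A w as) m = \<one>\<^bsub>grp M' (opn A w as)\<^esub>}"
  proof clarify
    fix w as ms
    assume wa: "(w, as) \<in> op_args V A" and "ms \<in> tuples (\<lambda>a. {m \<in> carrier (grp M a). \<phi> a m = \<one>\<^bsub>grp M' a\<^esub>}) as"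
    then have ms: "ms \<in> mtuples (grp M) as" and "map2 \<phi> as ms = map (\<lambda>a. \<one>\<^bsub>grp M' a\<^esub>) as"
      by (auto simp: tuples_iff mtuples_iff intro!: nth_equalityI)
    then show "mop M w as ms \<in> carrier (grp M (opn A w as)) \<and> \<phi> (opn A w as) (mop M w as ms) = \<one>\<^bsub>grp M' (opn A w as)\<^esub>"
      using mop_closed[OF M wa ms] amod_homD(4)[OF \<phi> wa ms] mop_ones[OF M' wa] by simp
  qed
qed

end


section \<open>The universal property of modulization\<close>

text \<open>The last equation says that the operations are pointed maps. No value is prescribed
  outside the fibres: overalgebras serve as input to \<open>modz\<close> and are never compared for
  equality.\<close>

definition is_pover :: "'f variety \<Rightarrow> ('a, 'f) alg \<Rightarrow> ('a, 'f, 'p) pover \<Rightarrow> bool" where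
  "is_pover V A P \<longleftrightarrow> (\<forall>a \<in> carrier A. pbase P a \<in> pset P a) \<and>
     (\<forall>(w, as) \<in> op_args V A. (\<forall>ps \<in> tuples (pset P) as. pop P w as ps \<in> pset P (opn A w as)) \<and>
        pop P w as (map (pbase P) as) = pbase P (opn A w as))"

text \<open>Translates the sums of polynomial mappings written in \<open>fmod\<close> into group
  products, to which the general module lemmas apply.\<close>

lemma finprod_free_Abelian_group:
  assumes "finite I" "\<And>i. i \<in> I \<Longrightarrow> f i \<in> carrier (free_Abelian_group S)"
  shows "finprod (free_Abelian_group S) f I = sum f I"
proof -
  interpret comm_group "free_Abelian_group S" by (rule abelian_free_Abelian_group)
  show ?thesis using assms by (induction I) (auto simp: Pi_iff)
qed

context algebra_in_variety
begin

context
  fixes P :: "('a, 'f, 'p) pover"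
  assumes P: "is_pover V A P"
begin

lemma pbase_closed: "a \<in> carrier A \<Longrightarrow> pbase P a \<in> pset P a"
  using P by (simp add: is_pover_def)

lemma pop_closed: "(w, as) \<in> op_args V A \<Longrightarrow> ps \<in> tuples (pset P) as \<Longrightarrow> pop P w as ps \<in> pset P (opn A w as)"
  using P unfolding is_pover_def by fast

lemma tuples_single:
  assumes "(w, as) \<in> op_args V A" "i < length as" "p \<in> pset P (as ! i)"
  shows "(map (pbase P) as)[i := p] \<in> tuples (pset P) as"
  using assms pbase_closed by (auto simp: tuples_iff nth_list_update dest: op_argsD)

section \<open>The free module on a pointed overalgebra\<close>

lemma fmod_op_i_hom:
  assumes wa: "(w, as) \<in> op_args V A" and i: "i < length as"
  shows "fmod_op_i P w as i \<in> hom (free_Abelian_group (pset P (as ! i))) (free_Abelian_group (pset P (opn A w as)))"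
proof (rule homI)
  fix c :: "'p \<Rightarrow>\<^sub>0 int" assume "c \<in> carrier (free_Abelian_group (pset P (as ! i)))"
  then have c: "Poly_Mapping.keys c \<subseteq> pset P (as ! i)" by simp
  have "pop P w as ((map (pbase P) as)[i := p]) \<in> pset P (opn A w as)" if "p \<in> Poly_Mapping.keys c" for p
    using pop_closed[OF wa tuples_single[OF wa i]] c that by blast
  then show "fmod_op_i P w as i c \<in> carrier (free_Abelian_group (pset P (opn A w as)))"
    using keys_frag_extend[of "\<lambda>p. frag_of (pop P w as ((map (pbase P) as)[i := p]))" c]
    by (fastforce simp: fmod_op_i_def)
qed (simp add: fmod_op_i_def frag_extend_add)

lemma fmod_simps: "grp (fmod V A P) = (\<lambda>a. free_Abelian_group (pset P a))"
  by (simp add: fmod_def)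

lemma mop_fmod:
  assumes wa: "(w, as) \<in> op_args V A" and ms: "ms \<in> mtuples (\<lambda>a. free_Abelian_group (pset P a)) as"
  shows "mop (fmod V A P) w as ms
    = finprod (free_Abelian_group (pset P (opn A w as))) (\<lambda>i. fmod_op_i P w as i (ms ! i)) {..<length as}"
proof -
  have "mop (fmod V A P) w as ms = (\<Sum>i<length as. fmod_op_i P w as i (ms ! i))"
    using wa ms by (simp add: fmod_def)
  moreover have "fmod_op_i P w as i (ms ! i) \<in> carrier (free_Abelian_group (pset P (opn A w as)))"
    if "i < length as" for i
    using fmod_op_i_hom[OF wa that] by (rule hom_in_carrier) (use ms that in \<open>simp add: mtuples_iff\<close>)
  ultimately show ?thesis by (subst finprod_free_Abelian_group) auto
qed

lemma fmod_amodule: "is_amodule V A (fmod V A P)"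
  unfolding is_amodule_def fmod_simps
proof (intro conjI)
  show "\<forall>(w, as) \<in> op_args V A. mop (fmod V A P) w as \<in>
      hom (DirProd_list (map (\<lambda>a. free_Abelian_group (pset P a)) as)) (free_Abelian_group (pset P (opn A w as)))"
  proof clarify
    fix w as assume wa: "(w, as) \<in> op_args V A"
    note h = finprod_hom_DirProd_list[where G = "\<lambda>a. free_Abelian_group (pset P a)" and f = "fmod_op_i P w as",
        OF abelian_free_Abelian_group fmod_op_i_hom[OF wa]]
    have "map (\<lambda>i. ms ! i \<otimes>\<^bsub>free_Abelian_group (pset P (as ! i))\<^esub> ns ! i) [0..<length as]
        \<in> mtuples (\<lambda>a. free_Abelian_group (pset P a)) as"
      if "ms \<in> mtuples (\<lambda>a. free_Abelian_group (pset P a)) as" "ns \<in> mtuples (\<lambda>a. free_Abelian_group (pset P a)) as"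
      for ms ns
      using that
      by (auto simp: mtuples_iff simp del: carrier_free_Abelian_group_iff mult_free_Abelian_group
          intro!: monoid.m_closed group.is_monoid)
    then show "mop (fmod V A P) w as \<in>
      hom (DirProd_list (map (\<lambda>a. free_Abelian_group (pset P a)) as)) (free_Abelian_group (pset P (opn A w as)))"
      using h mop_fmod[OF wa] unfolding hom_DirProd_list_iff by simp
  qed
qed (auto simp: fmod_def abelian_free_Abelian_group)

lemma mop_i_fmod:
  assumes "(w, as) \<in> op_args V A" "i < length as" "m \<in> carrier (free_Abelian_group (pset P (as ! i)))"
  shows "mop_i (fmod V A P) w as i m = fmod_op_i P w as i m"
  using assms fmod_op_i_hom mop_fmod by (intro mop_i_eqI[OF fmod_amodule]) (simp_all add: fmod_simps)

text \<open>Each defining condition survives intersection. The family of submodules must be nonempty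
  for an intersection of subgroups to be a subgroup; the full free groups belong to it.\<close>

lemma modz_ker_props:
  shows modz_ker_submodule: "is_submodule V A (fmod V A P) (modz_ker V A P)"
    and modz_ker_base: "c \<in> carrier A \<Longrightarrow> frag_of (pbase P c) \<in> modz_ker V A P c"
    and modz_ker_pop: "(w, as) \<in> op_args V A \<Longrightarrow> ps \<in> tuples (pset P) as \<Longrightarrow>
      frag_of (pop P w as ps) - (\<Sum>i<length as. fmod_op_i P w as i (frag_of (ps ! i))) \<in> modz_ker V A P (opn A w as)"
proof -
  define \<S> where "\<S> = {S. is_submodule V A (fmod V A P) S \<and>
     (\<forall>c \<in> carrier A. frag_of (pbase P c) \<in> S c) \<and>
     (\<forall>(w, as) \<in> op_args V A. \<forall>ps \<in> tuples (pset P) as.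
        frag_of (pop P w as ps) - (\<Sum>i<length as. fmod_op_i P w as i (frag_of (ps ! i))) \<in> S (opn A w as))}"
  have ker: "modz_ker V A P a = (\<Inter>S \<in> \<S>. S a)" for a
    unfolding modz_ker_def \<S>_def by blast
  let ?F = "\<lambda>a. carrier (free_Abelian_group (pset P a))"
  have "is_submodule V A (fmod V A P) ?F"
    unfolding is_submodule_def
    using mop_closed[OF fmod_amodule] group.subgroup_self[OF group_free_Abelian_group]
    by (auto simp: fmod_simps mtuples_def simp del: carrier_free_Abelian_group_iff)
  moreover have "frag_of (pop P w as ps) - (\<Sum>i<length as. fmod_op_i P w as i (frag_of (ps ! i))) \<in> ?F (opn A w as)"
    if wa: "(w, as) \<in> op_args V A" and ps: "ps \<in> tuples (pset P) as" for w as ps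
  proof -
    have "fmod_op_i P w as i (frag_of (ps ! i)) \<in> ?F (opn A w as)" if "i < length as" for i
      using fmod_op_i_hom[OF wa that] by (rule hom_in_carrier) (use ps that in \<open>simp add: tuples_iff\<close>)
    then have "(\<Sum>i<length as. fmod_op_i P w as i (frag_of (ps ! i))) \<in> ?F (opn A w as)"
      by (intro sum_closed_free_Abelian_group) auto
    then show ?thesis
      using pop_closed[OF wa ps] keys_diff[of "frag_of (pop P w as ps)" "\<Sum>i<length as. fmod_op_i P w as i (frag_of (ps ! i))"]
      by auto
  qed
  ultimately have F: "?F \<in> \<S>" unfolding \<S>_def using pbase_closed by auto
  have sg: "subgroup (S a) (free_Abelian_group (pset P a))" if "S \<in> \<S>" "a \<in> carrier A" for S a
    using that by (auto simp: \<S>_def is_submodule_def fmod_simps)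
  show "is_submodule V A (fmod V A P) (modz_ker V A P)"
    unfolding is_submodule_def
  proof (intro conjI)
    show "\<forall>a \<in> carrier A. subgroup (modz_ker V A P a) (grp (fmod V A P) a)"
    proof
      fix a assume "a \<in> carrier A"
      then have "subgroup (\<Inter>((\<lambda>S. S a) ` \<S>)) (free_Abelian_group (pset P a))"
        using sg F by (intro group.subgroups_Inter) auto
      then show "subgroup (modz_ker V A P a) (grp (fmod V A P) a)" by (simp add: ker fmod_simps)
    qed
    show "\<forall>(w, as) \<in> op_args V A. \<forall>ms \<in> tuples (modz_ker V A P) as.
        mop (fmod V A P) w as ms \<in> modz_ker V A P (opn A w as)"
    proof clarify
      fix w as ms assume wa: "(w, as) \<in> op_args V A" and ms: "ms \<in> tuples (modz_ker V A P) as"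
      have "mop (fmod V A P) w as ms \<in> S (opn A w as)" if "S \<in> \<S>" for S
      proof -
        have "ms \<in> tuples S as" using ms that by (auto simp: tuples_iff ker)
        then show ?thesis using that wa unfolding \<S>_def is_submodule_def by fast
      qed
      then show "mop (fmod V A P) w as ms \<in> modz_ker V A P (opn A w as)" by (simp add: ker)
    qed
  qed
  show "c \<in> carrier A \<Longrightarrow> frag_of (pbase P c) \<in> modz_ker V A P c"
    by (simp add: ker \<S>_def)
  show "frag_of (pop P w as ps) - (\<Sum>i<length as. fmod_op_i P w as i (frag_of (ps ! i))) \<in> modz_ker V A P (opn A w as)"
    if "(w, as) \<in> op_args V A" "ps \<in> tuples (pset P) as"
    unfolding ker \<S>_def using that by fast
qed

lemma modz_simps: "grp (modz V A P) = (\<lambda>a. free_Abelian_group (pset P a) Mod modz_ker V A P a)"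
  by (simp add: modz_def quot_amod_simps fmod_simps)

lemma modz_amodule: "is_amodule V A (modz V A P)"
  unfolding modz_def using fmod_amodule modz_ker_submodule by (rule quot_amod_amodule)

lemma modz_ker_subgroup: "a \<in> carrier A \<Longrightarrow> subgroup (modz_ker V A P a) (free_Abelian_group (pset P a))"
  using submodule_subgroup[OF fmod_amodule modz_ker_submodule] by (simp add: fmod_simps)

lemma modz_unit_closed: "p \<in> pset P a \<Longrightarrow> modz_unit V A P a p \<in> carrier (grp (modz V A P) a)"
  by (simp add: modz_unit_def modz_simps carrier_FactGroup)

lemma generate_modz:
  assumes a: "a \<in> carrier A"
  shows "generate (grp (modz V A P) a) (modz_unit V A P a ` pset P a) = carrier (grp (modz V A P) a)"
  using generate_FactGroup[OF abelian_free_Abelian_group modz_ker_subgroup[OF a] _ generate_free_Abelian_group]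
  by (simp add: modz_simps modz_unit_def[abs_def] image_image image_subset_iff)

lemma modz_unit_base:
  assumes a: "a \<in> carrier A"
  shows "modz_unit V A P a (pbase P a) = \<one>\<^bsub>grp (modz V A P) a\<^esub>"
  unfolding modz_unit_def modz_simps one_FactGroup
  using pbase_closed[OF a] modz_ker_subgroup[OF a] modz_ker_base[OF a]
  by (intro group.coset_join2) auto

text \<open>The relation imposed in \<open>modz_ker\<close> says precisely that the class of
  \<omega>(p) is the sum of the one-slot images of the p_i, so it makes the unit compatible with the
  operations.\<close>

lemma modz_unit_pop:
  assumes wa: "(w, as) \<in> op_args V A" and ps: "ps \<in> tuples (pset P) as"
  shows "mop (modz V A P) w as (map2 (modz_unit V A P) as ps) = modz_unit V A P (opn A w as) (pop P w as ps)"
proof -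
  let ?K = "modz_ker V A P" and ?G = "\<lambda>a. free_Abelian_group (pset P a)"
  let ?ms = "map frag_of ps" and ?b = "opn A w as"
  have b: "?b \<in> carrier A" by (rule opn_closed[OF wa])
  have ms: "?ms \<in> mtuples (grp (fmod V A P)) as" using ps by (auto simp: tuples_iff mtuples_iff fmod_simps)
  have "map2 (modz_unit V A P) as ps = map (\<lambda>i. ?K (as ! i) #>\<^bsub>grp (fmod V A P) (as ! i)\<^esub> ?ms ! i) [0..<length as]"
    using ps by (auto simp: modz_unit_def fmod_simps tuples_iff intro!: nth_equalityI)
  then have "mop (modz V A P) w as (map2 (modz_unit V A P) as ps) = ?K ?b #>\<^bsub>?G ?b\<^esub> mop (fmod V A P) w as ?ms"
    using mop_quot_amod[OF fmod_amodule modz_ker_submodule wa ms] by (simp add: modz_def fmod_simps)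
  also have "\<dots> = ?K ?b #>\<^bsub>?G ?b\<^esub> frag_of (pop P w as ps)"
  proof (rule group.repr_independence)
    have "mop (fmod V A P) w as ?ms = (\<Sum>i<length as. fmod_op_i P w as i (frag_of (ps ! i)))"
      using wa ms ps by (auto simp: fmod_def fmod_simps tuples_iff intro!: sum.cong)
    then have "frag_of (pop P w as ps) - mop (fmod V A P) w as ?ms \<in> ?K ?b"
      using modz_ker_pop[OF wa ps] by simp
    moreover have "frag_of (pop P w as ps)
      = (frag_of (pop P w as ps) - mop (fmod V A P) w as ?ms) \<otimes>\<^bsub>?G ?b\<^esub> mop (fmod V A P) w as ?ms"
      by simp
    ultimately show "frag_of (pop P w as ps) \<in> ?K ?b #>\<^bsub>?G ?b\<^esub> mop (fmod V A P) w as ?ms"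
      unfolding r_coset_def by blast
    show "mop (fmod V A P) w as ?ms \<in> carrier (?G ?b)"
      using mop_closed[OF fmod_amodule wa ms] by (simp add: fmod_simps)
  qed (use modz_ker_subgroup[OF b] in auto)
  finally show ?thesis by (simp add: modz_unit_def)
qed

text \<open>Extend \<open>f\<close> linearly to the free groups. The extension respects the one-slot
  maps because it does so on basis elements, and it kills the relations because \<open>f\<close>
  respects basepoints and operations; hence it descends to the quotient. Only existence is claimed;
  uniqueness comes from \<open>generate_modz\<close>.\<close>

lemma modz_universal:
  assumes M: "is_amodule V A M"
    and f: "\<And>a p. a \<in> carrier A \<Longrightarrow> p \<in> pset P a \<Longrightarrow> f a p \<in> carrier (grp M a)"
    and f_base: "\<And>a. a \<in> carrier A \<Longrightarrow> f a (pbase P a) = \<one>\<^bsub>grp M a\<^esub>"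
    and f_pop: "\<And>w as ps. (w, as) \<in> op_args V A \<Longrightarrow> ps \<in> tuples (pset P) as \<Longrightarrow>
      f (opn A w as) (pop P w as ps) = mop M w as (map2 f as ps)"
  shows "\<exists>\<psi> \<in> amod_hom V A (modz V A P) M. \<forall>a \<in> carrier A. \<forall>p \<in> pset P a. \<psi> a (modz_unit V A P a p) = f a p"
proof -
  let ?F = "fmod V A P" and ?G = "\<lambda>a. free_Abelian_group (pset P a)"
  have "\<exists>h. h \<in> hom (?G a) (grp M a) \<and> (\<forall>p \<in> pset P a. h (frag_of p) = f a p)" if a: "a \<in> carrier A" for a
    using comm_group.free_Abelian_group_universal[OF amodule_group(1)[OF M a], of "f a" "pset P a"] f[OF a]
    by (metis image_subsetI)
  then obtain h where h: "\<And>a. a \<in> carrier A \<Longrightarrow> h a \<in> hom (?G a) (grp M a)"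
    "\<And>a p. a \<in> carrier A \<Longrightarrow> p \<in> pset P a \<Longrightarrow> h a (frag_of p) = f a p"
    by metis
  let ?\<phi> = "\<lambda>a \<in> carrier A. \<lambda>c \<in> carrier (grp ?F a). h a c"
  \<comment> \<open>The one-slot case of \<open>f_pop\<close>: basepoints in the other slots become
    zeros by \<open>f_base\<close>.\<close>
  have f_i: "f (opn A w as) (pop P w as ((map (pbase P) as)[i := p])) = mop_i M w as i (f (as ! i) p)"
    if wa: "(w, as) \<in> op_args V A" and i: "i < length as" and p: "p \<in> pset P (as ! i)" for w as i p
  proof -
    have "map2 f as ((map (pbase P) as)[i := p]) = (map (\<lambda>a. \<one>\<^bsub>grp M a\<^esub>) as)[i := f (as ! i) p]"
      using i f_base op_argsD[OF wa] by (auto intro!: nth_equalityI simp: nth_list_update)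
    then show ?thesis using f_pop[OF wa tuples_single[OF wa i p]] by (simp add: mop_i_def)
  qed
  have \<phi>: "?\<phi> \<in> amod_hom V A ?F M"
  proof (rule amod_homI[OF fmod_amodule M])
    fix a assume a: "a \<in> carrier A"
    show "?\<phi> a \<in> hom (grp ?F a) (grp M a)"
      using a h(1)[OF a] restrict_hom[OF amodule_group(4)[OF fmod_amodule a]]
      by (simp add: fmod_simps)
  next
    fix w as i c assume wa: "(w, as) \<in> op_args V A" and i: "i < length as" and "c \<in> carrier (grp ?F (as ! i))"
    then have c: "c \<in> carrier (?G (as ! i))" by (simp add: fmod_simps)
    note a = op_argsD(3)[OF wa i] opn_closed[OF wa]
    \<comment> \<open>Both composites are homomorphisms on a free abelian group, so they are
      compared on basis elements, where the claim is \<open>f_i\<close>.\<close>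
    have "(h (opn A w as) \<circ> fmod_op_i P w as i) c = (mop_i M w as i \<circ> h (as ! i)) c"
    proof (rule hom_eq_on_generate[where S = "frag_of ` pset P (as ! i)"])
      show "h (opn A w as) \<circ> fmod_op_i P w as i \<in> hom (?G (as ! i)) (grp M (opn A w as))"
        using fmod_op_i_hom[OF wa i] h(1)[OF a(2)] by (rule hom_compose)
      show "mop_i M w as i \<circ> h (as ! i) \<in> hom (?G (as ! i)) (grp M (opn A w as))"
        using h(1)[OF a(1)] mop_i_hom[OF M wa i] by (rule hom_compose)
      fix x assume "x \<in> frag_of ` pset P (as ! i)"
      then obtain p where p: "p \<in> pset P (as ! i)" "x = frag_of p" by blast
      then show "(h (opn A w as) \<circ> fmod_op_i P w as i) x = (mop_i M w as i \<circ> h (as ! i)) x"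
        using h(2) a f_i[OF wa i p(1)] pop_closed[OF wa tuples_single[OF wa i p(1)]] by (simp add: fmod_op_i_def)
    qed (use amodule_group(2)[OF M a(2)] c in
        \<open>auto simp: generate_free_Abelian_group simp del: carrier_free_Abelian_group_iff\<close>)
    moreover have "fmod_op_i P w as i c \<in> carrier (?G (opn A w as))"
      using fmod_op_i_hom[OF wa i] c by (rule hom_in_carrier)
    ultimately show "?\<phi> (opn A w as) (mop_i ?F w as i c) = mop_i M w as i (?\<phi> (as ! i) c)"
      using a c mop_i_fmod[OF wa i c] by (simp add: fmod_simps)
  qed auto
  let ?S = "\<lambda>a. {c \<in> carrier (grp ?F a). ?\<phi> a c = \<one>\<^bsub>grp M a\<^esub>}"
  have "is_submodule V A ?F ?S" by (rule amod_hom_kernel[OF fmod_amodule M \<phi>])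
  moreover have "\<forall>c \<in> carrier A. frag_of (pbase P c) \<in> ?S c"
    using pbase_closed h(2) f_base by (simp add: fmod_simps)
  moreover have "frag_of (pop P w as ps) - (\<Sum>i<length as. fmod_op_i P w as i (frag_of (ps ! i))) \<in> ?S (opn A w as)"
    if wa: "(w, as) \<in> op_args V A" and ps: "ps \<in> tuples (pset P) as" for w as ps
  proof -
    let ?b = "opn A w as" and ?ms = "map frag_of ps"
    have b: "?b \<in> carrier A" by (rule opn_closed[OF wa])
    have ms: "?ms \<in> mtuples (grp ?F) as" using ps by (auto simp: tuples_iff mtuples_iff fmod_simps)
    have len: "length ps = length as" using ps by (simp add: tuples_iff)
    have mop: "mop ?F w as ?ms = (\<Sum>i<length as. fmod_op_i P w as i (frag_of (ps ! i)))"
      using wa ms len by (auto simp: fmod_def fmod_simps intro!: sum.cong)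
    have "map2 ?\<phi> as ?ms = map2 f as ps"
      using ps h(2) op_argsD[OF wa] by (auto simp: tuples_iff fmod_simps intro!: nth_equalityI)
    then have eq: "?\<phi> ?b (mop ?F w as ?ms) = f ?b (pop P w as ps)"
      using amod_homD(4)[OF \<phi> wa ms] f_pop[OF wa ps] by simp
    interpret H: comm_group "grp M ?b" using M b by (rule amodule_group)
    interpret hom: group_hom "?G ?b" "grp M ?b" "h ?b"
      using h(1)[OF b] H.is_group by (simp add: group_hom_def group_hom_axioms_def)
    have x: "frag_of (pop P w as ps) \<in> carrier (?G ?b)" using pop_closed[OF wa ps] by simp
    have y: "mop ?F w as ?ms \<in> carrier (?G ?b)" using mop_closed[OF fmod_amodule wa ms] by (simp add: fmod_simps)
    \<comment> \<open>In group notation the difference becomes a quotient, which \<open>h\<close>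
      maps to the quotient of two equal elements.\<close>
    have d: "frag_of (pop P w as ps) - mop ?F w as ?ms = frag_of (pop P w as ps) \<otimes>\<^bsub>?G ?b\<^esub> inv\<^bsub>?G ?b\<^esub> mop ?F w as ?ms"
      using y by simp
    have "h ?b (frag_of (pop P w as ps) - mop ?F w as ?ms) = \<one>\<^bsub>grp M ?b\<^esub>"
      unfolding d using x y eq h(2)[OF b pop_closed[OF wa ps]] b hom.hom_closed[OF x]
      by (simp only: hom.hom_mult hom.hom_inv hom.G.inv_closed fmod_simps restrict_apply' H.r_inv)
    moreover have "frag_of (pop P w as ps) - mop ?F w as ?ms \<in> carrier (?G ?b)"
      unfolding d using x y by (simp only: hom.G.m_closed hom.G.inv_closed)
    ultimately show ?thesis using b by (simp add: mop fmod_simps)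
  qed
  \<comment> \<open>\<open>?S\<close> meets every condition imposed in \<open>modz_ker_def\<close>,
    so it contains the intersection.\<close>
  ultimately have "modz_ker V A P a \<subseteq> ?S a" for a
    unfolding modz_ker_def by blast
  then have "?\<phi> a s = \<one>\<^bsub>grp M a\<^esub>" if "a \<in> carrier A" "s \<in> modz_ker V A P a" for a s
    using that by blast
  from quot_amod_universal[OF fmod_amodule modz_ker_submodule M \<phi> this]
  obtain \<psi> where \<psi>: "\<psi> \<in> amod_hom V A (modz V A P) M"
    "\<And>a c. a \<in> carrier A \<Longrightarrow> c \<in> carrier (grp ?F a) \<Longrightarrow> \<psi> a (modz_ker V A P a #>\<^bsub>grp ?F a\<^esub> c) = ?\<phi> a c"
    unfolding modz_def by blast
  have "\<psi> a (modz_unit V A P a p) = f a p" if "a \<in> carrier A" "p \<in> pset P a" for a p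
    using \<psi>(2)[of a "frag_of p"] that h(2) by (simp add: modz_unit_def fmod_simps)
  with \<psi>(1) show ?thesis by blast
qed

end

end


section \<open>Membership of the total algebra in the variety\<close>

lemma alg_hom_eval:
  assumes B: "is_algebra V B" and h: "h \<in> alg_hom V B C"
    and t: "t \<in> wf_terms (symbols V) X" and e: "e ` X \<subseteq> carrier B"
  shows "h (eval B e t) = eval C (h \<circ> e) t"
  using t
proof (induction t)
  case (App w ts)
  have "(w, map (eval B e) ts) \<in> op_args V B"
    using App eval_closed[OF B _ e] by (auto simp: op_args_def)
  from alg_hom_op[OF h this] show ?case using App by (simp add: comp_def cong: map_cong)
qed simp

text \<open>Valuations are defined on all natural numbers, whereas additivity handles only finite
  sums of one-entry valuations; this allows the entries beyond the variables of a term to be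
  replaced by zeros.\<close>

lemma eval_finite_dependence:
  fixes t :: "('f, nat) trm"
  shows "\<exists>N. \<forall>e e'. (\<forall>n<N. e n = e' n) \<longrightarrow> eval B e t = eval B e' t"
proof (induction t)
  case (Var v)
  show ?case by (rule exI[of _ "Suc v"]) simp
next
  case (App w ts)
  then obtain N where N: "\<And>t e e'. t \<in> set ts \<Longrightarrow> \<forall>n<N t. e n = e' n \<Longrightarrow> eval B e t = eval B e' t"
    by metis
  \<comment> \<open>Inserting 0 keeps \<open>Max\<close> meaningful for a nullary symbol, whose
    argument list is empty.\<close>
  have "eval B e (App w ts) = eval B e' (App w ts)" if "\<forall>n<Max (insert 0 (N ` set ts)). e n = e' n" for e e'
  proof -
    have "eval B e t = eval B e' t" if t: "t \<in> set ts" for t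
    proof (rule N[OF t], intro allI impI)
      fix n assume "n < N t"
      also have "N t \<le> Max (insert 0 (N ` set ts))" using t by (intro Max_ge) auto
      finally show "e n = e' n" using that \<open>\<forall>n<Max (insert 0 (N ` set ts)). e n = e' n\<close> by blast
    qed
    then show ?thesis by (auto intro!: arg_cong[of _ _ "opn B w"])
  qed
  then show ?case by blast
qed

lemma carrier_total_alg: "carrier (total_alg A M) = (SIGMA a : carrier A. carrier (grp M a))"
  by (simp add: total_alg_def)

lemma opn_total_alg:
  "opn (total_alg A M) w ps = (opn A w (map fst ps), mop M w (map fst ps) (map snd ps))"
  by (simp add: total_alg_def)

lemma eval_total_alg_fst: "fst (eval (total_alg A M) e t) = eval A (fst \<circ> e) t"
proof (induction t)
  case (App w ts)
  then have "map fst (map (eval (total_alg A M) e) ts) = map (eval A (fst \<circ> e)) ts" by (simp add: comp_def)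
  then show ?case by (simp add: opn_total_alg comp_def del: map_map map_eq_conv)
qed simp

context algebra_in_variety
begin

lemma total_alg_op_argsD:
  assumes "(w, ps) \<in> op_args V (total_alg A M)"
  shows "(w, map fst ps) \<in> op_args V A" "map snd ps \<in> mtuples (grp M) (map fst ps)"
proof -
  have ps: "w \<in> symbols V (length ps)" "set ps \<subseteq> carrier (total_alg A M)" using assms by (auto simp: op_args_def)
  then show "(w, map fst ps) \<in> op_args V A" by (fastforce simp: op_args_def carrier_total_alg)
  have "ps ! i \<in> carrier (total_alg A M)" if "i < length ps" for i using ps that by auto
  then show "map snd ps \<in> mtuples (grp M) (map fst ps)"
    by (fastforce simp: mtuples_iff carrier_total_alg opn_total_alg)
qed

lemma total_alg_algebra:
  assumes M: "is_amodule V A M"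
  shows "is_algebra V (total_alg A M)"
  unfolding is_algebra_def
proof clarify
  fix w ps assume "(w, ps) \<in> op_args V (total_alg A M)"
  note ps = total_alg_op_argsD[OF this]
  show "opn (total_alg A M) w ps \<in> carrier (total_alg A M)"
    using opn_closed[OF ps(1)] mop_closed[OF M ps] by (simp add: carrier_total_alg opn_total_alg)
qed

section \<open>Evaluation of terms over a fixed valuation in the base algebra\<close>

context
  fixes M :: "('a, 'f, 'm) amod" and a :: "nat \<Rightarrow> 'a"
  assumes M: "is_amodule V A M" and a: "range a \<subseteq> carrier A"
begin

text \<open>The base part \<open>a\<close> of the valuation is held fixed, so that all values of one
  term lie in one group and depend on \<open>m\<close> alone.\<close>

definition fibre_eval :: "(nat \<Rightarrow> 'm) \<Rightarrow> ('f, nat) trm \<Rightarrow> 'm" where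
  "fibre_eval m t = snd (eval (total_alg A M) (\<lambda>n. (a n, m n)) t)"

lemma eval_total_alg: "eval (total_alg A M) (\<lambda>n. (a n, m n)) t = (eval A a t, fibre_eval m t)"
  using eval_total_alg_fst[of A M "\<lambda>n. (a n, m n)" t]
  by (auto simp: fibre_eval_def comp_def intro: prod_eqI)

lemma point_closed: "a n \<in> carrier A"
  using a by blast

lemma base_eval_closed: "t \<in> wf_terms (symbols V) UNIV \<Longrightarrow> eval A a t \<in> carrier A"
  using eval_closed[OF algebra _ a] .

lemma fibre_eval_closed:
  assumes "t \<in> wf_terms (symbols V) UNIV" "\<And>n. m n \<in> carrier (grp M (a n))"
  shows "fibre_eval m t \<in> carrier (grp M (eval A a t))"
proof -
  have "eval (total_alg A M) (\<lambda>n. (a n, m n)) t \<in> carrier (total_alg A M)"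
    using a assms by (intro eval_closed[OF total_alg_algebra[OF M]]) (auto simp: carrier_total_alg opn_total_alg)
  then show ?thesis by (simp add: eval_total_alg carrier_total_alg opn_total_alg)
qed

lemma fibre_eval_App: "fibre_eval m (App w ts) = mop M w (map (eval A a) ts) (map (fibre_eval m) ts)"
proof -
  have "eval (total_alg A M) (\<lambda>n. (a n, m n)) (App w ts)
    = opn (total_alg A M) w (map (\<lambda>t. (eval A a t, fibre_eval m t)) ts)"
    by (simp add: eval_total_alg cong: map_cong)
  then show ?thesis by (simp add: fibre_eval_def[of m "App w ts"] carrier_total_alg opn_total_alg comp_def)
qed

text \<open>Induction on the term: every operation is additive in its whole tuple of arguments, and
  since \<open>a\<close> stays fixed the groups on both sides match.\<close>

lemma fibre_eval_mult:
  assumes t: "t \<in> wf_terms (symbols V) UNIV"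
    and m: "\<And>n. m n \<in> carrier (grp M (a n))" and m': "\<And>n. m' n \<in> carrier (grp M (a n))"
  shows "fibre_eval (\<lambda>n. m n \<otimes>\<^bsub>grp M (a n)\<^esub> m' n) t
    = fibre_eval m t \<otimes>\<^bsub>grp M (eval A a t)\<^esub> fibre_eval m' t"
  using t
proof (induction t)
  case (Var v)
  then show ?case by (simp add: fibre_eval_def)
next
  case (App w ts)
  let ?as = "map (eval A a) ts"
  have wa: "(w, ?as) \<in> op_args V A" using App base_eval_closed by (auto simp: op_args_def)
  have tup: "map (fibre_eval k) ts \<in> mtuples (grp M) ?as" if "\<And>n. k n \<in> carrier (grp M (a n))" for k
    using App fibre_eval_closed[OF _ that] by (auto simp: mtuples_iff)
  have "map (fibre_eval (\<lambda>n. m n \<otimes>\<^bsub>grp M (a n)\<^esub> m' n)) ts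
    = map (\<lambda>i. map (fibre_eval m) ts ! i \<otimes>\<^bsub>grp M (?as ! i)\<^esub> map (fibre_eval m') ts ! i) [0..<length ?as]"
    using App by (auto intro!: nth_equalityI)
  then show ?case
    unfolding fibre_eval_App using mop_mult[OF M wa tup[OF m] tup[OF m']] by simp
qed

definition single_fibre :: "nat \<Rightarrow> 'm \<Rightarrow> nat \<Rightarrow> 'm" where
  "single_fibre i x n = (if n = i then x else \<one>\<^bsub>grp M (a n)\<^esub>)"

lemma ones_closed: "\<one>\<^bsub>grp M (a n)\<^esub> \<in> carrier (grp M (a n))"
  using amodule_group(5)[OF M] a by blast

lemma single_fibre_closed: "x \<in> carrier (grp M (a i)) \<Longrightarrow> single_fibre i x n \<in> carrier (grp M (a n))"
  using ones_closed by (simp add: single_fibre_def)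

lemma fibre_eval_single_hom:
  assumes t: "t \<in> wf_terms (symbols V) UNIV"
  shows "(\<lambda>x. fibre_eval (single_fibre i x) t) \<in> hom (grp M (a i)) (grp M (eval A a t))"
proof (rule homI)
  fix x y assume x: "x \<in> carrier (grp M (a i))" and y: "y \<in> carrier (grp M (a i))"
  have "single_fibre i (x \<otimes>\<^bsub>grp M (a i)\<^esub> y) = (\<lambda>n. single_fibre i x n \<otimes>\<^bsub>grp M (a n)\<^esub> single_fibre i y n)"
    using point_closed amodule_group(4,5)[OF M] by (auto simp: single_fibre_def monoid.l_one fun_eq_iff)
  then show "fibre_eval (single_fibre i (x \<otimes>\<^bsub>grp M (a i)\<^esub> y)) t
    = fibre_eval (single_fibre i x) t \<otimes>\<^bsub>grp M (eval A a t)\<^esub> fibre_eval (single_fibre i y) t"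
    using fibre_eval_mult[OF t single_fibre_closed[OF x] single_fibre_closed[OF y]] by simp
qed (use fibre_eval_closed[OF t] single_fibre_closed in blast)

text \<open>By additivity the equation for \<open>m\<close> follows from those for its one-entry
  valuations, added up over a finite range that covers the variables of \<open>s\<close> and
  \<open>t\<close>.\<close>

lemma fibre_eval_eqI:
  assumes s: "s \<in> wf_terms (symbols V) UNIV" and t: "t \<in> wf_terms (symbols V) UNIV"
    and st: "eval A a s = eval A a t"
    and single: "\<And>i x. x \<in> carrier (grp M (a i)) \<Longrightarrow> fibre_eval (single_fibre i x) s = fibre_eval (single_fibre i x) t"
    and m: "\<And>n. m n \<in> carrier (grp M (a n))"
  shows "fibre_eval m s = fibre_eval m t"
proof -
  let ?m = "\<lambda>k n. if n < k then m n else \<one>\<^bsub>grp M (a n)\<^esub>"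
  have cl: "?m k n \<in> carrier (grp M (a n))" for k n using m ones_closed by simp
  have *: "fibre_eval (?m k) s = fibre_eval (?m k) t" for k
  proof (induction k)
    case 0
    \<comment> \<open>The zero valuation is itself a one-entry valuation, with entry zero, so the
      base case is an instance of \<open>single\<close>.\<close>
    have "?m 0 = single_fibre 0 \<one>\<^bsub>grp M (a 0)\<^esub>" by (auto simp: single_fibre_def)
    then show ?case using single[OF ones_closed[of 0]] by simp
  next
    case (Suc k)
    have "?m (Suc k) = (\<lambda>n. single_fibre k (m k) n \<otimes>\<^bsub>grp M (a n)\<^esub> ?m k n)"
      using point_closed amodule_group(4,5)[OF M] m
      by (auto simp: single_fibre_def monoid.l_one monoid.r_one fun_eq_iff less_Suc_eq)
    then show ?case
      using fibre_eval_mult[OF s single_fibre_closed[OF m] cl] fibre_eval_mult[OF t single_fibre_closed[OF m] cl]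
        single[OF m] Suc st by simp
  qed
  obtain N where N: "\<And>e e'. \<forall>n<N. e n = e' n \<Longrightarrow> eval (total_alg A M) e s = eval (total_alg A M) e' s"
    using eval_finite_dependence by metis
  obtain N' where N': "\<And>e e'. \<forall>n<N'. e n = e' n \<Longrightarrow> eval (total_alg A M) e t = eval (total_alg A M) e' t"
    using eval_finite_dependence by metis
  \<comment> \<open>From \<open>max N N'\<close> on, neither term looks at the valuation, so
    truncating \<open>m\<close> there changes nothing.\<close>
  have "fibre_eval m s = fibre_eval (?m (max N N')) s"
    unfolding fibre_eval_def by (intro arg_cong[of _ _ snd] N) auto
  moreover have "fibre_eval m t = fibre_eval (?m (max N N')) t"
    unfolding fibre_eval_def by (intro arg_cong[of _ _ snd] N') auto
  ultimately show ?thesis using * by simp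
qed

end

text \<open>Over a fixed point of \<open>A\<close>, both sides of an identity are additive in the module variables; it
  therefore suffices to check tuples with a single entry, taken from a generating set.\<close>

lemma totally_in_criterion:
  fixes B :: "('b, 'f) alg"
  assumes M: "is_amodule V A M" and B: "in_variety V B"
    and S: "\<And>c. c \<in> carrier A \<Longrightarrow> S c \<subseteq> carrier (grp M c)"
    and gen: "\<And>c. c \<in> carrier A \<Longrightarrow> generate (grp M c) (S c) = carrier (grp M c)"
    and h: "\<And>c x. c \<in> carrier A \<Longrightarrow> x \<in> S c \<Longrightarrow> \<exists>h \<in> alg_hom V B (total_alg A M).
      (c, x) \<in> h ` carrier B \<and> (\<forall>a \<in> carrier A. (a, \<one>\<^bsub>grp M a\<^esub>) \<in> h ` carrier B)"
  shows "totally_in V A M"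
proof -
  let ?T = "total_alg A M"
  have "eval ?T e s = eval ?T e t" if st: "(s, t) \<in> identities V" and e: "range e \<subseteq> carrier ?T" for s t e
  proof -
    have wf: "s \<in> wf_terms (symbols V) UNIV" "t \<in> wf_terms (symbols V) UNIV"
      using st variety by (auto simp: is_variety_def)
    define a where "a = fst \<circ> e"
    define m where "m = snd \<circ> e"
    have e_eq: "e = (\<lambda>n. (a n, m n))" by (auto simp: a_def m_def)
    have "e n \<in> carrier ?T" for n using e by blast
    then have a': "a n \<in> carrier A" and m: "m n \<in> carrier (grp M (a n))" for n
      by (auto simp: e_eq carrier_total_alg opn_total_alg)
    then have a: "range a \<subseteq> carrier A" by blast
    have base: "eval A a s = eval A a t" using in_variety st a by (auto simp: in_variety_def)
    note single_hom = fibre_eval_single_hom[OF M a wf(1)] fibre_eval_single_hom[OF M a wf(2)]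
    have on_gen: "fibre_eval M a (single_fibre M a i x) s = fibre_eval M a (single_fibre M a i x) t"
      if x: "x \<in> S (a i)" for i x
    proof -
      obtain k where k: "k \<in> alg_hom V B ?T" "(a i, x) \<in> k ` carrier B"
        "\<And>c. c \<in> carrier A \<Longrightarrow> (c, \<one>\<^bsub>grp M c\<^esub>) \<in> k ` carrier B"
        using h[OF a' x] by blast
      \<comment> \<open>The valuation takes only values (a n, 0) and (a i, x), all in the image of
        \<open>k\<close>. A lift to \<open>B\<close> satisfies the identity there, and
        \<open>k\<close> carries it to the total algebra.\<close>
      have "\<forall>n. \<exists>y. y \<in> carrier B \<and> k y = (a n, single_fibre M a i x n)"
      proof
        fix n
        have "(a n, single_fibre M a i x n) \<in> k ` carrier B"
          using k(2) k(3)[OF a'] by (simp add: single_fibre_def[OF M a])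
        then show "\<exists>y. y \<in> carrier B \<and> k y = (a n, single_fibre M a i x n)" by fastforce
      qed
      then obtain y where y: "\<And>n. y n \<in> carrier B" "\<And>n. k (y n) = (a n, single_fibre M a i x n)" by metis
      have "eval ?T (k \<circ> y) s = eval ?T (k \<circ> y) t"
        using B st wf y(1) alg_hom_eval[OF _ k(1), of _ UNIV y]
        by (metis (mono_tags, lifting) case_prodD image_subsetI in_variety_def)
      then show ?thesis by (simp add: comp_def y(2) eval_total_alg[OF M a])
    qed
    \<comment> \<open>For fixed \<open>i\<close> both sides are homomorphisms in \<open>x\<close>,
      with the same codomain by \<open>base\<close>; so agreement on the generators
      \<open>S (a i)\<close> suffices.\<close>
    have "fibre_eval M a (single_fibre M a i x) s = fibre_eval M a (single_fibre M a i x) t"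
      if x: "x \<in> carrier (grp M (a i))" for i x
      using amodule_group(2)[OF M a'] amodule_group(2)[OF M base_eval_closed[OF M a wf(1)]]
        single_hom(1) single_hom(2)[folded base] S[OF a'] on_gen
      by (rule hom_eq_on_generate) (use x gen[OF a'] in auto)
    from fibre_eval_eqI[OF M a wf base this m] show ?thesis
      by (simp add: e_eq eval_total_alg[OF M a] base)
  qed
  then show ?thesis
    unfolding totally_in_def in_variety_def using total_alg_algebra[OF M] by auto
qed


section \<open>Unary polynomials and the free modules on one generator\<close>

lemma pol1_in_variety: "in_variety V (pol1 V A)"
  unfolding pol1_def using variety in_variety free_alg_in_variety[OF variety] by (rule coprod_in_variety)

lemma pol1_algebra: "is_algebra V (pol1 V A)"
  using pol1_in_variety by (simp add: in_variety_def)

lemma pol1_opn_closed: "(w, us) \<in> op_args V (pol1 V A) \<Longrightarrow> opn (pol1 V A) w us \<in> carrier (pol1 V A)"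
  using pol1_algebra by (auto simp: is_algebra_def)

lemma pconst_hom: "restrict (pconst V A) (carrier A) \<in> alg_hom V A (pol1 V A)"
  using coprod_inl_hom[OF variety in_variety free_alg_in_variety[OF variety]]
  by (simp add: pol1_def pconst_def[abs_def])

lemma pconst_closed: "a \<in> carrier A \<Longrightarrow> pconst V A a \<in> carrier (pol1 V A)"
  using alg_hom_carrier[OF pconst_hom] by fastforce

lemma pconst_opn:
  assumes "(w, as) \<in> op_args V A"
  shows "pconst V A (opn A w as) = opn (pol1 V A) w (map (pconst V A) as)"
proof -
  have "map (restrict (pconst V A) (carrier A)) as = map (pconst V A) as"
    using assms by (auto simp: op_args_def)
  then show ?thesis using alg_hom_op[OF pconst_hom assms] opn_closed[OF assms] by (simp del: map_eq_conv)
qed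

lemma pvar_closed: "pvar V A \<in> carrier (pol1 V A)"
  using alg_hom_carrier[OF coprod_inr_hom[OF variety in_variety free_alg_in_variety[OF variety]] free_gen_carrier]
  by (fastforce simp: pol1_def pvar_def free_gen_carrier)

lemma pol_eval_props:
  assumes "b \<in> carrier A"
  shows pol_eval_hom: "pol_eval V A b \<in> alg_hom V (pol1 V A) A"
    and pol_eval_const: "a \<in> carrier A \<Longrightarrow> pol_eval V A b (pconst V A a) = a"
    and pol_eval_var: "pol_eval V A b (pvar V A) = b"
  using theI'[OF pol_eval_exists[OF variety in_variety assms]] unfolding pol_eval_def by blast+

lemma pol_eval_closed: "b \<in> carrier A \<Longrightarrow> u \<in> carrier (pol1 V A) \<Longrightarrow> pol_eval V A b u \<in> carrier A"
  using alg_hom_carrier[OF pol_eval_hom] .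

lemma pol_eval_opn:
  "b \<in> carrier A \<Longrightarrow> (w, us) \<in> op_args V (pol1 V A) \<Longrightarrow>
    pol_eval V A b (opn (pol1 V A) w us) = opn A w (map (pol_eval V A b) us)"
  using alg_hom_op[OF pol_eval_hom] .

lemma pol_eval_op_args:
  "b \<in> carrier A \<Longrightarrow> (w, us) \<in> op_args V (pol1 V A) \<Longrightarrow> (w, map (pol_eval V A b) us) \<in> op_args V A"
  using pol_eval_closed by (fastforce simp: op_args_def)

section \<open>The modules \<open>zmod V A b\<close> and their generators (u)_b\<close>

context
  fixes b assumes b: "b \<in> carrier A"
begin

lemma pol_over_simps:
  "pset (pol_over V A b) a = {u \<in> carrier (pol1 V A). pol_eval V A b u = a}"
  "pbase (pol_over V A b) = pconst V A" "pop (pol_over V A b) w as = opn (pol1 V A) w"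
  by (simp_all add: pol_over_def)

lemma pol_over_tuplesD:
  assumes "(w, as) \<in> op_args V A" "us \<in> tuples (pset (pol_over V A b)) as"
  shows "(w, us) \<in> op_args V (pol1 V A)" "map (pol_eval V A b) us = as"
  using assms by (auto simp: op_args_def tuples_iff pol_over_simps in_set_conv_nth intro!: nth_equalityI)

lemma pol_over_pover: "is_pover V A (pol_over V A b)"
  unfolding is_pover_def
proof (intro conjI)
  show "\<forall>a \<in> carrier A. pbase (pol_over V A b) a \<in> pset (pol_over V A b) a"
    using pconst_closed pol_eval_const[OF b] by (simp add: pol_over_simps)
  show "\<forall>(w, as) \<in> op_args V A.
      (\<forall>ps \<in> tuples (pset (pol_over V A b)) as. pop (pol_over V A b) w as ps \<in> pset (pol_over V A b) (opn A w as)) \<and>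
      pop (pol_over V A b) w as (map (pbase (pol_over V A b)) as) = pbase (pol_over V A b) (opn A w as)"
  proof clarify
    fix w as assume wa: "(w, as) \<in> op_args V A"
    have "opn (pol1 V A) w us \<in> pset (pol_over V A b) (opn A w as)"
      if "us \<in> tuples (pset (pol_over V A b)) as" for us
      using pol_over_tuplesD[OF wa that] pol_eval_opn[OF b] pol1_opn_closed by (simp add: pol_over_simps)
    then show "(\<forall>ps \<in> tuples (pset (pol_over V A b)) as.
        pop (pol_over V A b) w as ps \<in> pset (pol_over V A b) (opn A w as)) \<and>
      pop (pol_over V A b) w as (map (pbase (pol_over V A b)) as) = pbase (pol_over V A b) (opn A w as)"
      using pconst_opn[OF wa] by (simp add: pol_over_simps)
  qed
qed

lemma zmod_amodule: "is_amodule V A (zmod V A b)"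
  unfolding zmod_def using pol_over_pover by (rule modz_amodule)

lemma zcls_closed: "u \<in> carrier (pol1 V A) \<Longrightarrow> zcls V A b u \<in> carrier (grp (zmod V A b) (pol_eval V A b u))"
  unfolding zcls_def zmod_def using pol_over_pover by (rule modz_unit_closed) (simp add: pol_over_simps)

lemma zcls_const: "a \<in> carrier A \<Longrightarrow> zcls V A b (pconst V A a) = \<one>\<^bsub>grp (zmod V A b) a\<^esub>"
  using modz_unit_base[OF pol_over_pover] by (simp add: zcls_def zmod_def pol_eval_const[OF b] pol_over_simps)

text \<open>An instance of \<open>modz_unit_pop\<close>, with the base tuple computed from
  \<open>us\<close>; it is the reason that u \<mapsto> (u(b), (u)_b) respects the
  operations.\<close>

lemma zcls_opn:
  assumes "(w, us) \<in> op_args V (pol1 V A)"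
  shows "zcls V A b (opn (pol1 V A) w us) = mop (zmod V A b) w (map (pol_eval V A b) us) (map (zcls V A b) us)"
proof -
  let ?as = "map (pol_eval V A b) us"
  have us: "us \<in> tuples (pset (pol_over V A b)) ?as"
    using assms by (auto simp: tuples_iff pol_over_simps op_args_def)
  have "map2 (modz_unit V A (pol_over V A b)) ?as us = map (zcls V A b) us"
    by (auto simp: zcls_def intro!: nth_equalityI)
  then show ?thesis
    using modz_unit_pop[OF pol_over_pover pol_eval_op_args[OF b assms] us] pol_eval_opn[OF b assms]
    by (simp add: zcls_def[of V A b "opn (pol1 V A) w us"] zmod_def pol_over_simps del: map_map)
qed

lemma generate_zmod:
  assumes "a \<in> carrier A"
  shows "generate (grp (zmod V A b) a) (zcls V A b ` {u \<in> carrier (pol1 V A). pol_eval V A b u = a})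
    = carrier (grp (zmod V A b) a)"
proof -
  have "zcls V A b ` {u \<in> carrier (pol1 V A). pol_eval V A b u = a}
    = modz_unit V A (pol_over V A b) a ` pset (pol_over V A b) a"
    by (auto simp: zcls_def pol_over_simps)
  then show ?thesis using generate_modz[OF pol_over_pover assms] by (simp add: zmod_def)
qed

text \<open>Serves twice: homomorphisms of modules that agree at (x)_b yield algebra homomorphisms
  to which the universal property of polynomials applies, and each of them supplies test points for
  \<open>totally_in_criterion\<close>.\<close>

lemma zmod_hom_alg_hom:
  assumes M: "is_amodule V A M" and \<phi>: "\<phi> \<in> amod_hom V A (zmod V A b) M"
  shows "(\<lambda>u \<in> carrier (pol1 V A). (pol_eval V A b u, \<phi> (pol_eval V A b u) (zcls V A b u)))
    \<in> alg_hom V (pol1 V A) (total_alg A M)"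
proof (rule alg_homI[OF _ pol1_algebra])
  fix u assume u: "u \<in> carrier (pol1 V A)"
  then show "(pol_eval V A b u, \<phi> (pol_eval V A b u) (zcls V A b u)) \<in> carrier (total_alg A M)"
    using pol_eval_closed[OF b u] hom_in_carrier[OF amod_homD(1)[OF \<phi>] zcls_closed] by (simp add: carrier_total_alg opn_total_alg)
next
  fix w us assume wu: "(w, us) \<in> op_args V (pol1 V A)"
  let ?as = "map (pol_eval V A b) us" and ?zs = "map (zcls V A b) us"
  have zs: "?zs \<in> mtuples (grp (zmod V A b)) ?as"
    using zcls_closed wu by (auto simp: mtuples_iff op_args_def)
  have "map2 \<phi> ?as ?zs = map (\<lambda>u. \<phi> (pol_eval V A b u) (zcls V A b u)) us"
    by (auto intro!: nth_equalityI)
  then show "(pol_eval V A b (opn (pol1 V A) w us), \<phi> (pol_eval V A b (opn (pol1 V A) w us)) (zcls V A b (opn (pol1 V A) w us)))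
    = opn (total_alg A M) w (map (\<lambda>u. (pol_eval V A b u, \<phi> (pol_eval V A b u) (zcls V A b u))) us)"
    using amod_homD(4)[OF \<phi> pol_eval_op_args[OF b wu] zs] zcls_opn[OF wu] pol_eval_opn[OF b wu]
    by (simp add: carrier_total_alg opn_total_alg comp_def)
qed

lemma zmod_hom_const:
  assumes M: "is_amodule V A M" and \<phi>: "\<phi> \<in> amod_hom V A (zmod V A b) M" and a: "a \<in> carrier A"
  shows "\<phi> a (zcls V A b (pconst V A a)) = \<one>\<^bsub>grp M a\<^esub>"
  using hom_one[OF amod_homD(1)[OF \<phi> a]] amodule_group(2)[OF M a] amodule_group(2)[OF zmod_amodule a]
  by (simp add: zcls_const[OF a])

end

text \<open>The criterion with \<open>pol1 V A\<close> as test algebra. The constant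
  \<open>a\<close> goes to (a, 0), so the zeros are always reached, and only the generators
  \<open>x\<close> have to be exhibited as values \<phi>((u)_b); the base point \<open>b\<close> may
  vary with \<open>x\<close>.\<close>

lemma totally_in_zmod_homs:
  assumes M: "is_amodule V A M"
    and S: "\<And>c. c \<in> carrier A \<Longrightarrow> S c \<subseteq> carrier (grp M c)"
    and gen: "\<And>c. c \<in> carrier A \<Longrightarrow> generate (grp M c) (S c) = carrier (grp M c)"
    and h: "\<And>c x. c \<in> carrier A \<Longrightarrow> x \<in> S c \<Longrightarrow>
      \<exists>b \<in> carrier A. \<exists>\<phi> \<in> amod_hom V A (zmod V A b) M. \<exists>u \<in> carrier (pol1 V A).
        pol_eval V A b u = c \<and> \<phi> c (zcls V A b u) = x"
  shows "totally_in V A M"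
proof (rule totally_in_criterion[OF M pol1_in_variety S gen])
  fix c x assume "c \<in> carrier A" "x \<in> S c"
  then obtain b \<phi> u where b: "b \<in> carrier A" and \<phi>: "\<phi> \<in> amod_hom V A (zmod V A b) M"
    and u: "u \<in> carrier (pol1 V A)" "pol_eval V A b u = c" "\<phi> c (zcls V A b u) = x"
    using h by blast
  let ?h = "\<lambda>u \<in> carrier (pol1 V A). (pol_eval V A b u, \<phi> (pol_eval V A b u) (zcls V A b u))"
  have "?h u = (c, x)" using u by simp
  moreover have "?h (pconst V A a) = (a, \<one>\<^bsub>grp M a\<^esub>)" if "a \<in> carrier A" for a
    using that pconst_closed pol_eval_const[OF b] zmod_hom_const[OF b M \<phi>] by simp
  ultimately show "\<exists>h \<in> alg_hom V (pol1 V A) (total_alg A M). (c, x) \<in> h ` carrier (pol1 V A) \<and>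
      (\<forall>a \<in> carrier A. (a, \<one>\<^bsub>grp M a\<^esub>) \<in> h ` carrier (pol1 V A))"
    using zmod_hom_alg_hom[OF b M \<phi>] u(1) pconst_closed by (metis (no_types, lifting) image_eqI)
qed

text \<open>The generators are the classes (u)_b, reached by the identity homomorphism. This
  justifies \<open>theta\<close> with target \<open>zmod V A c\<close>, which is how the product of
  the ringoid is defined.\<close>

lemma zmod_totally_in:
  assumes b: "b \<in> carrier A"
  shows "totally_in V A (zmod V A b)"
proof (rule totally_in_zmod_homs[OF zmod_amodule[OF b] _ generate_zmod[OF b]])
  fix c x assume c: "c \<in> carrier A" and "x \<in> zcls V A b ` {u \<in> carrier (pol1 V A). pol_eval V A b u = c}"
  then obtain u where u: "u \<in> carrier (pol1 V A)" "pol_eval V A b u = c" "x = zcls V A b u" by blast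
  then have "(\<lambda>a \<in> carrier A. \<lambda>m \<in> carrier (grp (zmod V A b) a). m) c (zcls V A b u) = x"
    using c zcls_closed[OF b u(1)] by simp
  then show "\<exists>d \<in> carrier A. \<exists>\<phi> \<in> amod_hom V A (zmod V A d) (zmod V A b). \<exists>u \<in> carrier (pol1 V A).
        pol_eval V A d u = c \<and> \<phi> c (zcls V A d u) = x"
    using b u amod_hom_id[OF zmod_amodule[OF b]] by blast
qed (use zcls_closed[OF b] in blast)

section \<open>The free module on one generator\<close>

lemma zcls_pvar_closed: "b \<in> carrier A \<Longrightarrow> zcls V A b (pvar V A) \<in> carrier (grp (zmod V A b) b)"
  using zcls_closed[OF _ pvar_closed] pol_eval_var by simp

text \<open>Let \<open>h\<close> be the algebra homomorphism to the total algebra with a \<mapsto>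
  (a, 0) and x \<mapsto> (b, m); it exists since the total algebra lies in the variety. Any
  \<open>\<theta>\<close> must take (u)_b to the second component of \<open>h u\<close>; conversely,
  that prescription respects basepoints and operations and so defines one.\<close>

lemma theta_ex1:
  assumes M: "is_amodule V A M" and tot: "totally_in V A M" and b: "b \<in> carrier A" and m: "m \<in> carrier (grp M b)"
  shows "\<exists>!\<theta>. \<theta> \<in> amod_hom V A (zmod V A b) M \<and> \<theta> b (zcls V A b (pvar V A)) = m"
proof -
  let ?U = "pol1 V A" and ?T = "total_alg A M"
  have T: "in_variety V ?T" using tot by (simp add: totally_in_def)
  have zero: "(\<lambda>a \<in> carrier A. (a, \<one>\<^bsub>grp M a\<^esub>)) \<in> alg_hom V A ?T"
  proof (rule alg_homI[OF _ algebra])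
    fix a assume "a \<in> carrier A"
    then show "(a, \<one>\<^bsub>grp M a\<^esub>) \<in> carrier ?T" using amodule_group(5)[OF M] by (simp add: carrier_total_alg opn_total_alg)
  next
    fix w as assume "(w, as) \<in> op_args V A"
    then show "(opn A w as, \<one>\<^bsub>grp M (opn A w as)\<^esub>) = opn ?T w (map (\<lambda>a. (a, \<one>\<^bsub>grp M a\<^esub>)) as)"
      using mop_ones[OF M] by (simp add: carrier_total_alg opn_total_alg comp_def)
  qed
  have bm: "(b, m) \<in> carrier ?T" using b m by (simp add: carrier_total_alg opn_total_alg)
  from pol1_universal[OF variety in_variety T zero bm]
  obtain h where h: "h \<in> alg_hom V ?U ?T" "\<And>a. a \<in> carrier A \<Longrightarrow> h (pconst V A a) = (a, \<one>\<^bsub>grp M a\<^esub>)"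
    "h (pvar V A) = (b, m)"
    and uniq: "\<And>k. k \<in> alg_hom V ?U ?T \<Longrightarrow> (\<And>a. a \<in> carrier A \<Longrightarrow> k (pconst V A a) = (a, \<one>\<^bsub>grp M a\<^esub>)) \<Longrightarrow>
      k (pvar V A) = (b, m) \<Longrightarrow> k = h"
    by (smt (verit) restrict_apply')
  \<comment> \<open>Any such \<open>\<theta>\<close> induces an algebra homomorphism agreeing with
    \<open>h\<close> on constants and on the variable, hence equal to \<open>h\<close>; this fixes
    \<open>\<theta>\<close> on the generators.\<close>
  have val: "\<theta> (pol_eval V A b u) (zcls V A b u) = snd (h u)" "pol_eval V A b u = fst (h u)"
    if \<theta>: "\<theta> \<in> amod_hom V A (zmod V A b) M" "\<theta> b (zcls V A b (pvar V A)) = m" and u: "u \<in> carrier ?U" for \<theta> u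
  proof -
    let ?k = "\<lambda>u \<in> carrier ?U. (pol_eval V A b u, \<theta> (pol_eval V A b u) (zcls V A b u))"
    have "?k = h"
      by (rule uniq[OF zmod_hom_alg_hom[OF b M \<theta>(1)]])
        (use \<theta> pconst_closed pvar_closed pol_eval_const[OF b] pol_eval_var[OF b] zmod_hom_const[OF b M \<theta>(1)] in simp_all)
    from fun_cong[OF this, of u] have "h u = (pol_eval V A b u, \<theta> (pol_eval V A b u) (zcls V A b u))"
      using u by simp
    then show "\<theta> (pol_eval V A b u) (zcls V A b u) = snd (h u)" "pol_eval V A b u = fst (h u)" by simp_all
  qed
  \<comment> \<open>The first component of \<open>h\<close> is a homomorphism to \<open>A\<close>
    that fixes constants and sends the variable to \<open>b\<close>, so it is
    \<open>pol_eval V A b\<close>. Thus the second component of \<open>h u\<close> lies in the group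
    over u(b).\<close>
  have fst_h: "fst (h u) = pol_eval V A b u" if "u \<in> carrier ?U" for u
  proof -
    have "(\<lambda>u \<in> carrier ?U. fst (h u)) \<in> alg_hom V ?U A"
    proof (rule alg_homI[OF _ pol1_algebra])
      show "fst (h u) \<in> carrier A" if "u \<in> carrier ?U" for u
        using alg_hom_carrier[OF h(1) that] by (auto simp: carrier_total_alg opn_total_alg)
      show "fst (h (opn ?U w us)) = opn A w (map (\<lambda>u. fst (h u)) us)" if "(w, us) \<in> op_args V ?U" for w us
        using alg_hom_op[OF h(1) that] by (simp add: carrier_total_alg opn_total_alg comp_def)
    qed
    then have "(\<lambda>u \<in> carrier ?U. fst (h u)) \<in> alg_hom V ?U A \<and>
      (\<forall>a \<in> carrier A. (\<lambda>u \<in> carrier ?U. fst (h u)) (pconst V A a) = a) \<and>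
      (\<lambda>u \<in> carrier ?U. fst (h u)) (pvar V A) = b"
      using h(2,3) pconst_closed pvar_closed by simp
    from the1_equality[OF pol_eval_exists[OF variety in_variety b], OF this]
    have "pol_eval V A b = (\<lambda>u \<in> carrier ?U. fst (h u))" by (simp only: pol_eval_def)
    then show ?thesis using that by simp
  qed
  show ?thesis
  proof (rule ex_ex1I)
    have "\<exists>\<psi> \<in> amod_hom V A (modz V A (pol_over V A b)) M.
      \<forall>a \<in> carrier A. \<forall>p \<in> pset (pol_over V A b) a. \<psi> a (modz_unit V A (pol_over V A b) a p) = snd (h p)"
    proof (rule modz_universal[OF pol_over_pover[OF b] M])
      fix a p assume "a \<in> carrier A" "p \<in> pset (pol_over V A b) a"
      then show "snd (h p) \<in> carrier (grp M a)"
        using alg_hom_carrier[OF h(1), of p] fst_h[of p] by (auto simp: pol_over_simps[OF b] carrier_total_alg opn_total_alg)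
    next
      fix a assume "a \<in> carrier A"
      then show "snd (h (pbase (pol_over V A b) a)) = \<one>\<^bsub>grp M a\<^esub>" using h(2) by (simp add: pol_over_simps[OF b])
    next
      fix w as us assume wa: "(w, as) \<in> op_args V A" and us: "us \<in> tuples (pset (pol_over V A b)) as"
      note wu = pol_over_tuplesD[OF b wa us]
      have "map (fst \<circ> h) us = as"
        using wu fst_h by (auto simp: op_args_def)
      moreover have "map2 (\<lambda>a p. snd (h p)) as us = map (snd \<circ> h) us"
        using us by (auto simp: tuples_iff intro!: nth_equalityI)
      ultimately show "snd (h (pop (pol_over V A b) w as us)) = mop M w as (map2 (\<lambda>a p. snd (h p)) as us)"
        using alg_hom_op[OF h(1) wu(1)] by (simp add: pol_over_simps[OF b] carrier_total_alg opn_total_alg)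
    qed
    then obtain \<psi> where \<psi>: "\<psi> \<in> amod_hom V A (zmod V A b) M"
      "\<And>a p. a \<in> carrier A \<Longrightarrow> p \<in> pset (pol_over V A b) a \<Longrightarrow> \<psi> a (modz_unit V A (pol_over V A b) a p) = snd (h p)"
      unfolding zmod_def by blast
    have "\<psi> b (zcls V A b (pvar V A)) = m"
      using \<psi>(2)[OF b, of "pvar V A"] h(3) pvar_closed
      by (simp add: zcls_def pol_eval_var[OF b] pol_over_simps[OF b])
    with \<psi>(1) show "\<exists>\<theta>. \<theta> \<in> amod_hom V A (zmod V A b) M \<and> \<theta> b (zcls V A b (pvar V A)) = m" by blast
  next
    fix \<theta> \<theta>'
    assume "\<theta> \<in> amod_hom V A (zmod V A b) M \<and> \<theta> b (zcls V A b (pvar V A)) = m"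
      and "\<theta>' \<in> amod_hom V A (zmod V A b) M \<and> \<theta>' b (zcls V A b (pvar V A)) = m"
    then have \<theta>: "\<theta> \<in> amod_hom V A (zmod V A b) M" "\<theta> b (zcls V A b (pvar V A)) = m"
      and \<theta>': "\<theta>' \<in> amod_hom V A (zmod V A b) M" "\<theta>' b (zcls V A b (pvar V A)) = m" by auto
    have "\<theta> a z = \<theta>' a z" if a: "a \<in> carrier A" and z: "z \<in> carrier (grp (zmod V A b) a)" for a z
      using amodule_group(2)[OF zmod_amodule[OF b] a] amodule_group(2)[OF M a]
        amod_homD(1)[OF \<theta>(1) a] amod_homD(1)[OF \<theta>'(1) a]
    proof (rule hom_eq_on_generate)
      show "z \<in> generate (grp (zmod V A b) a) (zcls V A b ` {u \<in> carrier (pol1 V A). pol_eval V A b u = a})"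
        using z generate_zmod[OF b a] by simp
    qed (use zcls_closed[OF b] val(1)[OF \<theta>] val(1)[OF \<theta>'] in auto)
    then show "\<theta> = \<theta>'" by (rule amod_hom_eqI[OF \<theta>(1) \<theta>'(1)])
  qed
qed

lemma theta_props:
  assumes "is_amodule V A M" "totally_in V A M" "b \<in> carrier A" "m \<in> carrier (grp M b)"
  shows theta_hom: "theta V A M b m \<in> amod_hom V A (zmod V A b) M"
    and theta_gen: "theta V A M b m b (zcls V A b (pvar V A)) = m"
  using theI'[OF theta_ex1[OF assms]] unfolding theta_def by blast+

text \<open>Recognizes an action by its value at (x)_b: to identify \<open>theta\<close> it is
  enough to exhibit one homomorphism with that value. Naturality, additivity in m and the comparison
  with \<open>lact\<close> are all proved this way.\<close>

lemma theta_eqI: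
  assumes "is_amodule V A M" "totally_in V A M" "b \<in> carrier A"
    and "\<phi> \<in> amod_hom V A (zmod V A b) M" "\<phi> b (zcls V A b (pvar V A)) = m"
  shows "theta V A M b m = \<phi>"
proof -
  have "m \<in> carrier (grp M b)"
    using hom_in_carrier[OF amod_homD(1)[OF assms(4,3)] zcls_pvar_closed[OF assms(3)]] assms(5) by simp
  from the1_equality[OF theta_ex1[OF assms(1-3) this]] show ?thesis
    unfolding theta_def using assms(4,5) by blast
qed

text \<open>Evaluating at \<open>as ! i\<close> turns the tuple of polynomials back into
  \<open>as\<close>, and the constants have class zero; so only slot \<open>i\<close> survives,
  carrying the class of the variable.\<close>

lemma zcls_basic_opn:
  assumes wa: "(w, as) \<in> op_args V A" and i: "i < length as"
  shows "zcls V A (as ! i) (opn (pol1 V A) w ((map (pconst V A) as)[i := pvar V A]))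
    = mop_i (zmod V A (as ! i)) w as i (zcls V A (as ! i) (pvar V A))"
proof -
  let ?b = "as ! i" and ?us = "(map (pconst V A) as)[i := pvar V A]"
  note as = op_argsD[OF wa]
  have b: "?b \<in> carrier A" using as(3) i .
  have "set ?us \<subseteq> carrier (pol1 V A)"
    using set_update_subset_insert by (rule subset_trans) (use as pconst_closed pvar_closed in auto)
  then have wu: "(w, ?us) \<in> op_args V (pol1 V A)" using as by (simp add: op_args_def in_lists_conv_set subset_iff)
  have ev: "map (pol_eval V A ?b) ?us = as"
    using i as pol_eval_props[OF b] by (auto intro!: nth_equalityI simp: nth_list_update)
  have z: "map (zcls V A ?b) ?us = (map (\<lambda>a. \<one>\<^bsub>grp (zmod V A ?b) a\<^esub>) as)[i := zcls V A ?b (pvar V A)]"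
    using i as zcls_const[OF b] by (auto intro!: nth_equalityI simp: nth_list_update)
  show ?thesis using zcls_opn[OF b wu] by (simp only: ev z mop_i_def)
qed

lemma zcls_basic_opn_closed:
  assumes wa: "(w, as) \<in> op_args V A" and i: "i < length as"
  shows "zcls V A (as ! i) (opn (pol1 V A) w ((map (pconst V A) as)[i := pvar V A]))
    \<in> carrier (grp (zmod V A (as ! i)) (opn A w as))"
  unfolding zcls_basic_opn[OF assms] using op_argsD(3)[OF assms]
  by (intro hom_in_carrier[OF mop_i_hom[OF zmod_amodule assms]] zcls_pvar_closed)

text \<open>A homomorphism commutes with one-slot maps, and \<open>theta\<close> sends the class of
  the variable to \<open>m\<close>. For the given module this recovers its operations; for a module
  \<open>zmod V A c\<close> it computes products with these coefficients in the ringoid.\<close>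

lemma theta_basic_opn:
  assumes M: "is_amodule V A M" "totally_in V A M"
    and wa: "(w, as) \<in> op_args V A" and i: "i < length as" and m: "m \<in> carrier (grp M (as ! i))"
  shows "theta V A M (as ! i) m (opn A w as)
    (zcls V A (as ! i) (opn (pol1 V A) w ((map (pconst V A) as)[i := pvar V A]))) = mop_i M w as i m"
proof -
  have b: "as ! i \<in> carrier A" using op_argsD(3)[OF wa i] .
  show ?thesis
    unfolding zcls_basic_opn[OF wa i]
    using amod_hom_mop_i[OF zmod_amodule[OF b] M(1) theta_hom[OF M b m] wa i zcls_pvar_closed[OF b]]
      theta_gen[OF M b m] by simp
qed

end


section \<open>Left modules over the enveloping ringoid\<close>

lemma env_ringoid_simps:
  "robj (env_ringoid V A) = carrier A"
  "rhom (env_ringoid V A) a b = grp (zmod V A b) a"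
  "rmul (env_ringoid V A) a b c z z' = theta V A (zmod V A c) b z' a z"
  "rid (env_ringoid V A) b = zcls V A b (pvar V A)"
  by (simp_all add: env_ringoid_def)

context algebra_in_variety
begin

lemma G_obj_simps:
  "lgrp (G_obj V A M) = grp M"
  "a \<in> carrier A \<Longrightarrow> b \<in> carrier A \<Longrightarrow> z \<in> carrier (grp (zmod V A b) a) \<Longrightarrow> m \<in> carrier (grp M b) \<Longrightarrow>
    lact (G_obj V A M) a b z m = theta V A M b m a z"
  by (simp_all add: G_obj_def env_ringoid_simps)

section \<open>From modules to left modules over the ringoid\<close>

lemma theta_closed:
  assumes "is_amodule V A M" "totally_in V A M" "a \<in> carrier A" "b \<in> carrier A"
    and "m \<in> carrier (grp M b)" "z \<in> carrier (grp (zmod V A b) a)"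
  shows "theta V A M b m a z \<in> carrier (grp M a)"
  using hom_in_carrier[OF amod_homD(1)[OF theta_hom[OF assms(1,2,4,5)] assms(3)] assms(6)] .

text \<open>Following \<open>theta\<close> for \<open>m\<close> by \<open>\<phi>\<close> gives a
  homomorphism sending (x)_b to \<open>\<phi> b m\<close>. It yields the action of G on arrows and,
  when \<open>\<phi>\<close> is itself a \<open>theta\<close>, associativity.\<close>

lemma theta_natural:
  assumes M: "is_amodule V A M" "totally_in V A M" and M': "is_amodule V A M'" "totally_in V A M'"
    and \<phi>: "\<phi> \<in> amod_hom V A M M'" and a: "a \<in> carrier A" and b: "b \<in> carrier A"
    and m: "m \<in> carrier (grp M b)" and z: "z \<in> carrier (grp (zmod V A b) a)"
  shows "theta V A M' b (\<phi> b m) a z = \<phi> a (theta V A M b m a z)"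
proof -
  have "theta V A M' b (\<phi> b m)
    = (\<lambda>a \<in> carrier A. compose (carrier (grp (zmod V A b) a)) (\<phi> a) (theta V A M b m a))"
    by (rule theta_eqI[OF M' b amod_hom_compose[OF zmod_amodule[OF b] M(1) M'(1) theta_hom[OF M b m] \<phi>]])
      (simp add: b compose_eq zcls_pvar_closed theta_gen[OF M b m])
  then show ?thesis using a z by (simp add: compose_eq)
qed

lemma theta_mult:
  assumes M: "is_amodule V A M" "totally_in V A M" and a: "a \<in> carrier A" and b: "b \<in> carrier A"
    and m: "m \<in> carrier (grp M b)" "n \<in> carrier (grp M b)" and z: "z \<in> carrier (grp (zmod V A b) a)"
  shows "theta V A M b (m \<otimes>\<^bsub>grp M b\<^esub> n) a z = theta V A M b m a z \<otimes>\<^bsub>grp M a\<^esub> theta V A M b n a z"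
proof -
  have "theta V A M b (m \<otimes>\<^bsub>grp M b\<^esub> n)
    = (\<lambda>a \<in> carrier A. \<lambda>z \<in> carrier (grp (zmod V A b) a). theta V A M b m a z \<otimes>\<^bsub>grp M a\<^esub> theta V A M b n a z)"
    by (rule theta_eqI[OF M b amod_hom_mult[OF zmod_amodule[OF b] M(1) theta_hom[OF M b m(1)] theta_hom[OF M b m(2)]]])
      (simp add: b zcls_pvar_closed theta_gen[OF M b m(1)] theta_gen[OF M b m(2)])
  then show ?thesis using a z by simp
qed

lemma G_obj_lmodule:
  assumes M: "is_amodule V A M" "totally_in V A M"
  shows "is_lmodule (env_ringoid V A) (G_obj V A M)"
  unfolding is_lmodule_def env_ringoid_simps G_obj_simps(1)
proof (intro conjI ballI)
  fix a assume a: "a \<in> carrier A"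
  show "comm_group (grp M a)" using M(1) a by (rule amodule_group)
  show "lact (G_obj V A M) a a (zcls V A a (pvar V A)) m = m" if "m \<in> carrier (grp M a)" for m
    using that a zcls_pvar_closed theta_gen[OF M] by (simp add: G_obj_simps)
  fix b assume b: "b \<in> carrier A"
  show "lact (G_obj V A M) a b z \<in> hom (grp M b) (grp M a)" if z: "z \<in> carrier (grp (zmod V A b) a)" for z
    using a b z theta_closed[OF M] theta_mult[OF M] amodule_group(4)[OF M(1) b]
    by (intro homI) (simp_all add: G_obj_simps monoid.m_closed)
  show "(\<lambda>z. lact (G_obj V A M) a b z m) \<in> hom (grp (zmod V A b) a) (grp M a)" if m: "m \<in> carrier (grp M b)" for m
    using a b m amod_homD(1)[OF theta_hom[OF M b m] a] amodule_group(4)[OF zmod_amodule[OF b] a]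
    by (intro homI) (simp_all add: G_obj_simps monoid.m_closed hom_mult hom_in_carrier)
  fix c z z' m assume *: "c \<in> carrier A" "z \<in> carrier (grp (zmod V A b) a)"
    "z' \<in> carrier (grp (zmod V A c) b)" "m \<in> carrier (grp M c)"
  have "theta V A (zmod V A c) b z' a z \<in> carrier (grp (zmod V A c) a)"
    using zmod_amodule[OF *(1)] zmod_totally_in[OF *(1)] a b *(3,2) by (rule theta_closed)
  \<comment> \<open>Associativity is naturality along the homomorphism
    \<open>theta V A M c m\<close> from \<open>zmod V A c\<close> to \<open>M\<close>, taken at the
    element z'.\<close>
  then show "lact (G_obj V A M) a c (theta V A (zmod V A c) b z' a z) m
    = lact (G_obj V A M) a b z (lact (G_obj V A M) b c z' m)"
    using a b * theta_closed[OF M b *(1,4,3)]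
      theta_natural[OF zmod_amodule[OF *(1)] zmod_totally_in[OF *(1)] M theta_hom[OF M *(1,4)] a b *(3,2)]
    by (simp add: G_obj_simps)
qed (auto simp: G_obj_def env_ringoid_simps)

lemma G_hom:
  assumes M: "is_amodule V A M" "totally_in V A M" and M': "is_amodule V A M'" "totally_in V A M'"
    and \<phi>: "\<phi> \<in> amod_hom V A M M'"
  shows "\<phi> \<in> lmod_hom (env_ringoid V A) (G_obj V A M) (G_obj V A M')"
  using \<phi> theta_natural[OF M M' \<phi>] hom_in_carrier[OF amod_homD(1)[OF \<phi>]]
  by (auto simp: lmod_hom_def amod_hom_def env_ringoid_simps G_obj_simps)

section \<open>From left modules over the ringoid to modules\<close>

lemma H_obj_simps: "grp (H_obj V A N) = lgrp N"
  by (simp add: H_obj_def)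

context
  fixes N :: "('a, ('a, 'f) zel, 'm) lmod"
  assumes N: "is_lmodule (env_ringoid V A) N"
begin

lemma lmodule_props:
  shows lmodule_group: "a \<in> carrier A \<Longrightarrow> comm_group (lgrp N a)"
    and lact_hom: "a \<in> carrier A \<Longrightarrow> b \<in> carrier A \<Longrightarrow> z \<in> carrier (grp (zmod V A b) a) \<Longrightarrow>
      lact N a b z \<in> hom (lgrp N b) (lgrp N a)"
    and lact_hom_left: "a \<in> carrier A \<Longrightarrow> b \<in> carrier A \<Longrightarrow> m \<in> carrier (lgrp N b) \<Longrightarrow>
      (\<lambda>z. lact N a b z m) \<in> hom (grp (zmod V A b) a) (lgrp N a)"
    and lact_id: "a \<in> carrier A \<Longrightarrow> m \<in> carrier (lgrp N a) \<Longrightarrow> lact N a a (zcls V A a (pvar V A)) m = m"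
    and lact_lact: "a \<in> carrier A \<Longrightarrow> b \<in> carrier A \<Longrightarrow> c \<in> carrier A \<Longrightarrow> z \<in> carrier (grp (zmod V A b) a) \<Longrightarrow>
      z' \<in> carrier (grp (zmod V A c) b) \<Longrightarrow> m \<in> carrier (lgrp N c) \<Longrightarrow>
      lact N a b z (lact N b c z' m) = lact N a c (theta V A (zmod V A c) b z' a z) m"
    and lact_undefined: "\<not> (a \<in> carrier A \<and> b \<in> carrier A \<and> z \<in> carrier (grp (zmod V A b) a) \<and> m \<in> carrier (lgrp N b)) \<Longrightarrow>
      lact N a b z m = undefined"
proof -
  note N' = N[unfolded is_lmodule_def env_ringoid_simps]
  note l = N'[THEN conjunct1] N'[THEN conjunct2, THEN conjunct1] N'[THEN conjunct2, THEN conjunct2, THEN conjunct1]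
    N'[THEN conjunct2, THEN conjunct2, THEN conjunct2, THEN conjunct1]
    N'[THEN conjunct2, THEN conjunct2, THEN conjunct2, THEN conjunct2, THEN conjunct1]
    N'[THEN conjunct2, THEN conjunct2, THEN conjunct2, THEN conjunct2, THEN conjunct2]
  show "a \<in> carrier A \<Longrightarrow> comm_group (lgrp N a)" using l(1) by blast
  show "a \<in> carrier A \<Longrightarrow> b \<in> carrier A \<Longrightarrow> z \<in> carrier (grp (zmod V A b) a) \<Longrightarrow>
      lact N a b z \<in> hom (lgrp N b) (lgrp N a)" using l(2) by blast
  show "a \<in> carrier A \<Longrightarrow> b \<in> carrier A \<Longrightarrow> m \<in> carrier (lgrp N b) \<Longrightarrow>
      (\<lambda>z. lact N a b z m) \<in> hom (grp (zmod V A b) a) (lgrp N a)" using l(3) by blast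
  show "a \<in> carrier A \<Longrightarrow> m \<in> carrier (lgrp N a) \<Longrightarrow> lact N a a (zcls V A a (pvar V A)) m = m"
    using l(4) by blast
  show "a \<in> carrier A \<Longrightarrow> b \<in> carrier A \<Longrightarrow> c \<in> carrier A \<Longrightarrow> z \<in> carrier (grp (zmod V A b) a) \<Longrightarrow>
      z' \<in> carrier (grp (zmod V A c) b) \<Longrightarrow> m \<in> carrier (lgrp N c) \<Longrightarrow>
      lact N a b z (lact N b c z' m) = lact N a c (theta V A (zmod V A c) b z' a z) m"
    using l(5) by simp
  show "\<not> (a \<in> carrier A \<and> b \<in> carrier A \<and> z \<in> carrier (grp (zmod V A b) a) \<and> m \<in> carrier (lgrp N b)) \<Longrightarrow>
      lact N a b z m = undefined"
    by (rule l(6)[rule_format])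
qed

lemma lact_coeff_hom:
  assumes "(w, as) \<in> op_args V A" "i < length as"
  shows "lact N (opn A w as) (as ! i) (zcls V A (as ! i) (opn (pol1 V A) w ((map (pconst V A) as)[i := pvar V A])))
    \<in> hom (lgrp N (as ! i)) (lgrp N (opn A w as))"
  using opn_closed op_argsD(3) zcls_basic_opn_closed assms by (intro lact_hom)

lemma mop_H_obj:
  assumes "(w, as) \<in> op_args V A" "ms \<in> mtuples (lgrp N) as"
  shows "mop (H_obj V A N) w as ms = finprod (lgrp N (opn A w as))
    (\<lambda>i. lact N (opn A w as) (as ! i)
      (zcls V A (as ! i) (opn (pol1 V A) w ((map (pconst V A) as)[i := pvar V A]))) (ms ! i)) {..<length as}"
  using assms by (simp add: H_obj_def)

lemma H_obj_amodule: "is_amodule V A (H_obj V A N)"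
  unfolding is_amodule_def H_obj_simps
proof (intro conjI)
  show "\<forall>(w, as) \<in> op_args V A. mop (H_obj V A N) w as \<in> hom (DirProd_list (map (lgrp N) as)) (lgrp N (opn A w as))"
  proof clarify
    fix w as assume wa: "(w, as) \<in> op_args V A"
    note h = finprod_hom_DirProd_list[where G = "lgrp N" and f = "\<lambda>i. lact N (opn A w as) (as ! i)
        (zcls V A (as ! i) (opn (pol1 V A) w ((map (pconst V A) as)[i := pvar V A])))", OF lmodule_group[OF opn_closed[OF wa]] lact_coeff_hom[OF wa]]
    have "map (\<lambda>i. ms ! i \<otimes>\<^bsub>lgrp N (as ! i)\<^esub> ns ! i) [0..<length as] \<in> mtuples (lgrp N) as"
      if "ms \<in> mtuples (lgrp N) as" "ns \<in> mtuples (lgrp N) as" for ms ns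
      using that lmodule_group op_argsD(3)[OF wa]
      by (auto simp: mtuples_iff intro!: monoid.m_closed group.is_monoid comm_group.axioms(2))
    then show "mop (H_obj V A N) w as \<in> hom (DirProd_list (map (lgrp N) as)) (lgrp N (opn A w as))"
      using h mop_H_obj[OF wa] unfolding hom_DirProd_list_iff by simp
  qed
qed (auto simp: H_obj_def lmodule_group)

lemma mop_i_H_obj:
  assumes "(w, as) \<in> op_args V A" "i < length as" "m \<in> carrier (lgrp N (as ! i))"
  shows "mop_i (H_obj V A N) w as i m = lact N (opn A w as) (as ! i)
    (zcls V A (as ! i) (opn (pol1 V A) w ((map (pconst V A) as)[i := pvar V A]))) m"
  using assms lact_coeff_hom mop_H_obj
  by (intro mop_i_eqI[OF H_obj_amodule, where f = "\<lambda>i. lact N (opn A w as) (as ! i)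
    (zcls V A (as ! i) (opn (pol1 V A) w ((map (pconst V A) as)[i := pvar V A])))"]) (simp_all add: H_obj_simps)

text \<open>Let q be the class of \<omega>(a_1, ..., x, ..., a_n). The one-slot map of
  \<open>H_obj V A N\<close> sends z m to q (z m) = (q z) m, and q z is the one-slot image of z in
  \<open>zmod V A b\<close> by \<open>theta_basic_opn\<close>.\<close>

lemma lact_amod_hom:
  assumes b: "b \<in> carrier A" and m: "m \<in> carrier (lgrp N b)"
  shows "(\<lambda>a \<in> carrier A. \<lambda>z \<in> carrier (grp (zmod V A b) a). lact N a b z m) \<in> amod_hom V A (zmod V A b) (H_obj V A N)"
proof (rule amod_homI[OF zmod_amodule[OF b] H_obj_amodule])
  fix a assume a: "a \<in> carrier A"
  then show "(\<lambda>a \<in> carrier A. \<lambda>z \<in> carrier (grp (zmod V A b) a). lact N a b z m) a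
      \<in> hom (grp (zmod V A b) a) (grp (H_obj V A N) a)"
    using restrict_hom[OF amodule_group(4)[OF zmod_amodule[OF b] a] lact_hom_left[OF a b m]] by (simp add: H_obj_simps)
next
  fix w as i z assume wa: "(w, as) \<in> op_args V A" and i: "i < length as" and z: "z \<in> carrier (grp (zmod V A b) (as ! i))"
  note a = op_argsD(3)[OF wa i] opn_closed[OF wa]
  have "lact N (as ! i) b z m \<in> carrier (lgrp N (as ! i))"
    using lact_hom[OF a(1) b z] m by (rule hom_in_carrier)
  then have "mop_i (H_obj V A N) w as i (lact N (as ! i) b z m) = lact N (opn A w as) b (mop_i (zmod V A b) w as i z) m"
    using mop_i_H_obj[OF wa i] lact_lact[OF a(2,1) b zcls_basic_opn_closed[OF wa i] z m]
      theta_basic_opn[OF zmod_amodule[OF b] zmod_totally_in[OF b] wa i z] by simp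
  then show "(\<lambda>a \<in> carrier A. \<lambda>z \<in> carrier (grp (zmod V A b) a). lact N a b z m) (opn A w as) (mop_i (zmod V A b) w as i z)
    = mop_i (H_obj V A N) w as i ((\<lambda>a \<in> carrier A. \<lambda>z \<in> carrier (grp (zmod V A b) a). lact N a b z m) (as ! i) z)"
    using a z hom_in_carrier[OF mop_i_hom[OF zmod_amodule[OF b] wa i] z] by simp
qed auto

text \<open>By the unit law every element \<open>x\<close> over \<open>c\<close> is the image of the
  class of the variable under z \<mapsto> z x, with base point \<open>c\<close>; so all elements may
  serve as generators.\<close>

lemma H_obj_totally_in: "totally_in V A (H_obj V A N)"
proof (rule totally_in_zmod_homs[OF H_obj_amodule, where S = "\<lambda>c. carrier (lgrp N c)"])
  show "generate (grp (H_obj V A N) c) (carrier (lgrp N c)) = carrier (grp (H_obj V A N) c)" if "c \<in> carrier A" for c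
  proof -
    interpret comm_group "lgrp N c" using that by (rule lmodule_group)
    show ?thesis using generate_incl[of "carrier (lgrp N c)"] by (auto simp: H_obj_simps intro: generate.incl)
  qed
  show "\<exists>b \<in> carrier A. \<exists>\<phi> \<in> amod_hom V A (zmod V A b) (H_obj V A N). \<exists>u \<in> carrier (pol1 V A).
      pol_eval V A b u = c \<and> \<phi> c (zcls V A b u) = x" if c: "c \<in> carrier A" and x: "x \<in> carrier (lgrp N c)" for c x
    using c lact_amod_hom[OF c x] pvar_closed pol_eval_var[OF c] zcls_pvar_closed[OF c] lact_id[OF c x]
    by (intro bexI conjI) auto
qed (simp add: H_obj_simps)

text \<open>The homomorphism z \<mapsto> z m has value \<open>m\<close> at the class of the variable
  by the unit law, hence is \<open>theta\<close>; \<open>H_obj_totally_in\<close> is what licenses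
  this conclusion.\<close>

lemma G_H_obj: "G_obj V A (H_obj V A N) = N"
proof (rule lmod.equality)
  show "lact (G_obj V A (H_obj V A N)) = lact N"
  proof (intro ext)
    fix a b z m
    show "lact (G_obj V A (H_obj V A N)) a b z m = lact N a b z m"
    proof (cases "a \<in> carrier A \<and> b \<in> carrier A \<and> z \<in> carrier (grp (zmod V A b) a) \<and> m \<in> carrier (lgrp N b)")
      case True
      then have *: "a \<in> carrier A" "b \<in> carrier A" "z \<in> carrier (grp (zmod V A b) a)" "m \<in> carrier (lgrp N b)" by auto
      have "theta V A (H_obj V A N) b m = (\<lambda>a \<in> carrier A. \<lambda>z \<in> carrier (grp (zmod V A b) a). lact N a b z m)"
        by (rule theta_eqI[OF H_obj_amodule H_obj_totally_in *(2) lact_amod_hom[OF *(2,4)]])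
          (simp add: * zcls_pvar_closed lact_id)
      then show ?thesis using * by (simp add: G_obj_simps H_obj_simps)
    next
      \<comment> \<open>Outside the domain both actions are \<open>undefined\<close>, on one side by
        the definition of \<open>G_obj\<close>, on the other by the last clause of
        \<open>is_lmodule\<close>.\<close>
      case False
      then show ?thesis using lact_undefined[OF False] by (auto simp: G_obj_def env_ringoid_simps H_obj_simps)
    qed
  qed
qed (simp_all add: G_obj_simps H_obj_simps)

end

text \<open>The one-slot maps of \<open>H_obj\<close> are actions of elements of the ringoid, and
  \<open>\<phi>\<close> commutes with these.\<close>

lemma H_hom:
  assumes N: "is_lmodule (env_ringoid V A) N" and N': "is_lmodule (env_ringoid V A) N'"
    and \<phi>: "\<phi> \<in> lmod_hom (env_ringoid V A) N N'"
  shows "\<phi> \<in> amod_hom V A (H_obj V A N) (H_obj V A N')"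
proof (rule amod_homI[OF H_obj_amodule[OF N] H_obj_amodule[OF N']])
  have fam: "\<phi> \<in> grp_fam_hom (carrier A) (lgrp N) (lgrp N')"
    using \<phi> by (simp add: lmod_hom_def env_ringoid_simps)
  then show "\<phi> \<in> extensional (carrier A)" by (auto simp: grp_fam_hom_def PiE_iff)
  fix a assume a: "a \<in> carrier A"
  then show "\<phi> a \<in> extensional (carrier (grp (H_obj V A N) a))"
    and "\<phi> a \<in> hom (grp (H_obj V A N) a) (grp (H_obj V A N') a)"
    using fam by (auto simp: grp_fam_hom_def H_obj_simps PiE_iff)
next
  fix w as i m assume *: "(w, as) \<in> op_args V A" "i < length as" "m \<in> carrier (grp (H_obj V A N) (as ! i))"
  note a = op_argsD(3)[OF *(1,2)] opn_closed[OF *(1)]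
  have m: "m \<in> carrier (lgrp N (as ! i))" using *(3) by (simp add: H_obj_simps)
  moreover have "\<phi> (as ! i) m \<in> carrier (lgrp N' (as ! i))"
    using \<phi> a m by (auto simp: lmod_hom_def grp_fam_hom_def env_ringoid_simps PiE_iff intro: hom_in_carrier)
  ultimately show "\<phi> (opn A w as) (mop_i (H_obj V A N) w as i m) = mop_i (H_obj V A N') w as i (\<phi> (as ! i) m)"
    using \<phi> a zcls_basic_opn_closed[OF *(1,2)] mop_i_H_obj[OF N *(1,2)] mop_i_H_obj[OF N' *(1,2)]
    by (simp add: lmod_hom_def env_ringoid_simps)
qed

text \<open>By \<open>theta_basic_opn\<close> the summands rebuilt from the action are the one-slot
  maps of \<open>M\<close>, and by \<open>mop_finprod\<close> they add up to the original
  operation.\<close>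

lemma H_G_obj:
  assumes M: "is_amodule V A M" "totally_in V A M"
  shows "H_obj V A (G_obj V A M) = M"
proof (rule amod.equality)
  show "mop (H_obj V A (G_obj V A M)) = mop M"
  proof (intro ext)
    fix w as ms
    show "mop (H_obj V A (G_obj V A M)) w as ms = mop M w as ms"
    proof (cases "(w, as) \<in> op_args V A \<and> ms \<in> mtuples (grp M) as")
      case True
      then have wa: "(w, as) \<in> op_args V A" and ms: "ms \<in> mtuples (grp M) as" by auto
      interpret H: comm_group "grp M (opn A w as)" using M(1) opn_closed[OF wa] by (rule amodule_group)
      have msi: "ms ! i \<in> carrier (grp M (as ! i))" if "i < length as" for i using ms that by (simp add: mtuples_iff)
      have "mop (H_obj V A (G_obj V A M)) w as ms
        = finprod (grp M (opn A w as)) (\<lambda>i. mop_i M w as i (ms ! i)) {..<length as}"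
        unfolding mop_H_obj[OF G_obj_lmodule[OF M] wa, unfolded G_obj_simps(1), OF ms]
        using op_argsD(3)[OF wa] opn_closed[OF wa] msi zcls_basic_opn_closed[OF wa]
          theta_basic_opn[OF M wa] hom_in_carrier[OF mop_i_hom[OF M(1) wa]]
        by (intro H.finprod_cong') (auto simp: G_obj_simps)
      then show ?thesis using mop_finprod[OF M(1) wa ms] by simp
    next
      case False
      then show ?thesis using M(1) unfolding is_amodule_def by (auto simp: H_obj_def G_obj_simps)
    qed
  qed
qed (simp_all add: G_obj_simps H_obj_simps)

end


section \<open>The categories and the functors\<close>

lemma grp_fam_homD:
  assumes "\<phi> \<in> grp_fam_hom S G G'"
  shows "\<phi> \<in> extensional S" "a \<in> S \<Longrightarrow> \<phi> a \<in> hom (G a) (G' a)" "a \<in> S \<Longrightarrow> \<phi> a \<in> extensional (carrier (G a))"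
  using assms by (auto simp: grp_fam_hom_def PiE_iff)

lemma extensional2_eqI:
  assumes "\<phi> \<in> extensional S" "\<psi> \<in> extensional S"
    and "\<And>a. a \<in> S \<Longrightarrow> \<phi> a \<in> extensional (T a)" "\<And>a. a \<in> S \<Longrightarrow> \<psi> a \<in> extensional (T a)"
    and "\<And>a m. a \<in> S \<Longrightarrow> m \<in> T a \<Longrightarrow> \<phi> a m = \<psi> a m"
  shows "\<phi> = \<psi>"
  using assms(1,2) by (rule extensionalityI) (use assms(3-5) in \<open>blast intro: extensionalityI\<close>)

text \<open>In both categories an arrow is a family of group homomorphisms composed fibrewise; the
  structure enters only through which families are allowed. The laws are thus proved once for
  hom-sets that contain identities and are closed under composition, and extensionality turns them
  into equalities.\<close>

lemma family_category:
  fixes G :: "'o \<Rightarrow> 'a \<Rightarrow> 'm monoid" and Hm :: "'o \<Rightarrow> 'o \<Rightarrow> ('a \<Rightarrow> 'm \<Rightarrow> 'm) set"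
  assumes fam: "\<And>x y. x \<in> Ob \<Longrightarrow> y \<in> Ob \<Longrightarrow> Hm x y \<subseteq> grp_fam_hom S (G x) (G y)"
    and ident: "\<And>x. x \<in> Ob \<Longrightarrow> (\<lambda>a \<in> S. \<lambda>m \<in> carrier (G x a). m) \<in> Hm x x"
    and comp: "\<And>x y z \<phi> \<psi>. x \<in> Ob \<Longrightarrow> y \<in> Ob \<Longrightarrow> z \<in> Ob \<Longrightarrow> \<phi> \<in> Hm x y \<Longrightarrow> \<psi> \<in> Hm y z \<Longrightarrow>
      (\<lambda>a \<in> S. compose (carrier (G x a)) (\<psi> a) (\<phi> a)) \<in> Hm x z"
  shows "is_category \<lparr>Obj = Ob, Arr = {(x, \<phi>, y). x \<in> Ob \<and> y \<in> Ob \<and> \<phi> \<in> Hm x y}, Dom = fst, Cod = snd \<circ> snd,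
    Idt = (\<lambda>x. (x, \<lambda>a \<in> S. \<lambda>m \<in> carrier (G x a). m, x)),
    Cmp = (\<lambda>(y, \<psi>, z) (x, \<phi>, _). (x, \<lambda>a \<in> S. compose (carrier (G x a)) (\<psi> a) (\<phi> a), z))\<rparr>"
proof -
  have left: "(\<lambda>a \<in> S. compose (carrier (G x a)) ((\<lambda>a \<in> S. \<lambda>m \<in> carrier (G y a). m) a) (\<phi> a)) = \<phi>"
    if "x \<in> Ob" "y \<in> Ob" "\<phi> \<in> Hm x y" for x y \<phi>
  proof -
    note \<phi> = grp_fam_homD[OF subsetD[OF fam that(3)], OF that(1,2)]
    show ?thesis
      by (rule extensional2_eqI[where S = S and T = "\<lambda>a. carrier (G x a)"])
        (use \<phi> hom_in_carrier[OF \<phi>(2)] in \<open>auto simp: compose_eq\<close>)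
  qed
  have right: "(\<lambda>a \<in> S. compose (carrier (G x a)) (\<phi> a) ((\<lambda>a \<in> S. \<lambda>m \<in> carrier (G x a). m) a)) = \<phi>"
    if "x \<in> Ob" "y \<in> Ob" "\<phi> \<in> Hm x y" for x y \<phi>
  proof -
    note \<phi> = grp_fam_homD[OF subsetD[OF fam that(3)], OF that(1,2)]
    show ?thesis
      by (rule extensional2_eqI[where S = S and T = "\<lambda>a. carrier (G x a)"]) (use \<phi> in \<open>auto simp: compose_eq\<close>)
  qed
  have assoc: "(\<lambda>a \<in> S. compose (carrier (G x a)) (\<chi> a) ((\<lambda>a \<in> S. compose (carrier (G x a)) (\<psi> a) (\<phi> a)) a))
      = (\<lambda>a \<in> S. compose (carrier (G x a)) ((\<lambda>a \<in> S. compose (carrier (G y a)) (\<chi> a) (\<psi> a)) a) (\<phi> a))"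
    if "x \<in> Ob" "y \<in> Ob" "\<phi> \<in> Hm x y" for x y \<phi> \<psi> \<chi>
  proof -
    note \<phi> = grp_fam_homD[OF subsetD[OF fam that(3)], OF that(1,2)]
    show ?thesis
      by (rule extensional2_eqI[where S = S and T = "\<lambda>a. carrier (G x a)"])
        (use hom_in_carrier[OF \<phi>(2)] in \<open>auto simp: compose_eq\<close>)
  qed
  show ?thesis
    unfolding is_category_def cat.simps
  proof (intro conjI ballI impI)
    fix f g h
    assume "f \<in> {(x, \<phi>, y). x \<in> Ob \<and> y \<in> Ob \<and> \<phi> \<in> Hm x y}" "g \<in> {(x, \<phi>, y). x \<in> Ob \<and> y \<in> Ob \<and> \<phi> \<in> Hm x y}"
      "h \<in> {(x, \<phi>, y). x \<in> Ob \<and> y \<in> Ob \<and> \<phi> \<in> Hm x y}" "(snd \<circ> snd) f = fst g" "(snd \<circ> snd) g = fst h"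
    then show "(\<lambda>(y, \<psi>, z) (x, \<phi>, _). (x, \<lambda>a \<in> S. compose (carrier (G x a)) (\<psi> a) (\<phi> a), z)) h
        ((\<lambda>(y, \<psi>, z) (x, \<phi>, _). (x, \<lambda>a \<in> S. compose (carrier (G x a)) (\<psi> a) (\<phi> a), z)) g f)
      = (\<lambda>(y, \<psi>, z) (x, \<phi>, _). (x, \<lambda>a \<in> S. compose (carrier (G x a)) (\<psi> a) (\<phi> a), z))
        ((\<lambda>(y, \<psi>, z) (x, \<phi>, _). (x, \<lambda>a \<in> S. compose (carrier (G x a)) (\<psi> a) (\<phi> a), z)) h g) f"
      using assoc by (clarsimp simp del: restrict_apply)
  qed (use ident comp left right in \<open>auto simp del: restrict_apply\<close>)
qed

context algebra_in_variety
begin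

lemma ab_cat_category: "is_category (ab_cat V A :: (('a, 'f, 'm) amod, _) cat)"
proof -
  let ?Ob = "{M :: ('a, 'f, 'm) amod. is_amodule V A M \<and> totally_in V A M}"
  have "ab_cat V A = \<lparr>Obj = ?Ob, Arr = {(M, \<phi>, M'). M \<in> ?Ob \<and> M' \<in> ?Ob \<and> \<phi> \<in> amod_hom V A M M'}, Dom = fst, Cod = snd \<circ> snd,
    Idt = (\<lambda>M. (M, \<lambda>a \<in> carrier A. \<lambda>m \<in> carrier (grp M a). m, M)),
    Cmp = (\<lambda>(M', \<psi>, M'') (M, \<phi>, _). (M, \<lambda>a \<in> carrier A. compose (carrier (grp M a)) (\<psi> a) (\<phi> a), M''))\<rparr>"
    by (auto simp: ab_cat_def)
  moreover have "is_category \<dots>"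
  proof (rule family_category)
    fix M M' M'' :: "('a, 'f, 'm) amod" and \<phi> \<psi>
    assume "M \<in> ?Ob" "M' \<in> ?Ob" "M'' \<in> ?Ob" "\<phi> \<in> amod_hom V A M M'" "\<psi> \<in> amod_hom V A M' M''"
    then show "(\<lambda>a \<in> carrier A. compose (carrier (grp M a)) (\<psi> a) (\<phi> a)) \<in> amod_hom V A M M''"
      by (blast intro: amod_hom_compose)
  next
    fix M M' :: "('a, 'f, 'm) amod"
    show "amod_hom V A M M' \<subseteq> grp_fam_hom (carrier A) (grp M) (grp M')" by (auto simp: amod_hom_def)
  qed (simp add: amod_hom_id)
  ultimately show ?thesis by simp
qed

text \<open>Transported from the identity of \<open>H_obj V A N\<close> by \<open>G_hom\<close>,
  since \<open>G_obj V A (H_obj V A N)\<close> is \<open>N\<close> itself.\<close>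

lemma lmod_hom_id:
  assumes N: "is_lmodule (env_ringoid V A) N"
  shows "(\<lambda>a \<in> carrier A. \<lambda>m \<in> carrier (lgrp N a). m) \<in> lmod_hom (env_ringoid V A) N N"
  using G_hom[OF H_obj_amodule H_obj_totally_in H_obj_amodule H_obj_totally_in amod_hom_id[OF H_obj_amodule], OF N N N N N]
  by (simp add: G_H_obj[OF N] H_obj_simps)

text \<open>The same transport: \<open>H_hom\<close> carries both factors to modules over
  \<open>A\<close>, where composites are known, and \<open>G_hom\<close> brings the composite
  back.\<close>

lemma lmod_hom_compose:
  assumes N: "is_lmodule (env_ringoid V A) N" and N': "is_lmodule (env_ringoid V A) N'"
    and N'': "is_lmodule (env_ringoid V A) N''"
    and \<phi>: "\<phi> \<in> lmod_hom (env_ringoid V A) N N'" and \<psi>: "\<psi> \<in> lmod_hom (env_ringoid V A) N' N''"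
  shows "(\<lambda>a \<in> carrier A. compose (carrier (lgrp N a)) (\<psi> a) (\<phi> a)) \<in> lmod_hom (env_ringoid V A) N N''"
  using G_hom[OF H_obj_amodule[OF N] H_obj_totally_in[OF N] H_obj_amodule[OF N''] H_obj_totally_in[OF N'']
      amod_hom_compose[OF H_obj_amodule[OF N] H_obj_amodule[OF N'] H_obj_amodule[OF N''] H_hom[OF N N' \<phi>] H_hom[OF N' N'' \<psi>]]]
  by (simp add: G_H_obj[OF N] G_H_obj[OF N''] H_obj_simps)

lemma lmod_cat_category:
  "is_category (lmod_cat (env_ringoid V A) :: (('a, ('a, 'f) zel, 'm) lmod, _) cat)"
proof -
  let ?R = "env_ringoid V A"
  let ?Ob = "{N :: ('a, ('a, 'f) zel, 'm) lmod. is_lmodule ?R N}"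
  have "lmod_cat ?R = \<lparr>Obj = ?Ob, Arr = {(N, \<phi>, N'). N \<in> ?Ob \<and> N' \<in> ?Ob \<and> \<phi> \<in> lmod_hom ?R N N'}, Dom = fst, Cod = snd \<circ> snd,
    Idt = (\<lambda>N. (N, \<lambda>a \<in> carrier A. \<lambda>m \<in> carrier (lgrp N a). m, N)),
    Cmp = (\<lambda>(N', \<psi>, N'') (N, \<phi>, _). (N, \<lambda>a \<in> carrier A. compose (carrier (lgrp N a)) (\<psi> a) (\<phi> a), N''))\<rparr>"
    by (auto simp: lmod_cat_def env_ringoid_simps)
  moreover have "is_category \<dots>"
  proof (rule family_category)
    fix N N' N'' :: "('a, ('a, 'f) zel, 'm) lmod" and \<phi> \<psi>
    assume "N \<in> ?Ob" "N' \<in> ?Ob" "N'' \<in> ?Ob" "\<phi> \<in> lmod_hom ?R N N'" "\<psi> \<in> lmod_hom ?R N' N''"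
    then show "(\<lambda>a \<in> carrier A. compose (carrier (lgrp N a)) (\<psi> a) (\<phi> a)) \<in> lmod_hom ?R N N''"
      by (blast intro: lmod_hom_compose)
  next
    fix N N' :: "('a, ('a, 'f) zel, 'm) lmod"
    show "lmod_hom ?R N N' \<subseteq> grp_fam_hom (carrier A) (lgrp N) (lgrp N')"
      by (auto simp: lmod_hom_def env_ringoid_simps)
  qed (simp add: lmod_hom_id)
  ultimately show ?thesis by simp
qed

lemma G_functor_functor:
  "is_functor (ab_cat V A :: (('a, 'f, 'm) amod, _) cat) (lmod_cat (env_ringoid V A)) (G_functor V A)"
  unfolding is_functor_def
  using ab_cat_category lmod_cat_category G_obj_lmodule G_hom
  by (auto simp: ab_cat_def lmod_cat_def G_functor_def G_obj_simps env_ringoid_simps)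

lemma H_functor_functor:
  "is_functor (lmod_cat (env_ringoid V A)) (ab_cat V A :: (('a, 'f, 'm) amod, _) cat) (H_functor V A)"
  unfolding is_functor_def
  using ab_cat_category lmod_cat_category H_obj_amodule H_obj_totally_in H_hom
  by (auto simp: ab_cat_def lmod_cat_def H_functor_def H_obj_simps env_ringoid_simps)

lemma H_G_functor: "func_eq (ab_cat V A) (func_comp (H_functor V A) (G_functor V A)) func_id"
  using H_G_obj by (auto simp: func_eq_def func_comp_def func_id_def ab_cat_def G_functor_def H_functor_def)

lemma G_H_functor: "func_eq (lmod_cat (env_ringoid V A)) (func_comp (G_functor V A) (H_functor V A)) func_id"
  using G_H_obj by (auto simp: func_eq_def func_comp_def func_id_def lmod_cat_def G_functor_def H_functor_def)

end

theorem theorem9p4: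
  fixes V :: "'f variety" and A :: "('a, 'f) alg"
  assumes "is_variety V" and "in_variety V A"
  shows "let Ab = (ab_cat V A :: (('a, 'f, 'm) amod, _) cat);
             ZMod = (lmod_cat (env_ringoid V A) :: (('a, ('a, 'f) zel, 'm) lmod, _) cat);
             G = G_functor V A;
             H = H_functor V A
         in is_functor Ab ZMod G \<and> is_functor ZMod Ab H \<and>
            func_eq Ab (func_comp H G) func_id \<and> func_eq ZMod (func_comp G H) func_id"
proof -
  interpret algebra_in_variety V A using assms by unfold_locales
  show ?thesis
    unfolding Let_def using G_functor_functor H_functor_functor H_G_functor G_H_functor by blast
qed

end
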